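(* A tree set $\tau$ is profinite if and only if it is chain-complete and splittable, contains no regular infinite splitting star, and has the property that $C(s,s')$ is finite for all regular unoriented separations $s,s'$ of $\tau$.
   Context: A separation system $(\vec S,\le,{}^* )$ is a poset with an order-reversing involution $\vec s\mapsto\overleftarrow s$; $s=\{\vec s,\overleftarrow s\}$ is the unoriented separation with orientations $\vec s,\overleftarrow s$. $\vec s$ is degenerate if $\vec s=\overleftarrow s$, small if $\vec s\le\overleftarrow s$. A set of oriented separations is regular if it contains no small element; an unoriented separation $s$ is regular if neither orientation is small. Unoriented $r,s$ are nested if some orientation of $r$ is $\le$ some orientation of $s$. $\vec r$ is trivial if there is $s$ with $\vec r<\vec s$ and $\vec r<\overleftarrow s$ (strictly). A tree set is a separation system in which any two separations are nested and which has no degenerate and no trivial elements. Write $\vec r\lneqq\vec s$ if $\vec r\le\vec s$ and $r\ne s$. An orientation is a set $O$ containing exactly one orientation of every unoriented separation; it is consistent if there are no $\vec r,\vec s\in O$ with $r\ne s$ and $\overleftarrow r\le\vec s$. A star is a set $\sigma$ with $\vec r\le\overleftarrow s$ for all distinct $\vec r,\vec s\in\sigma$. $\sigma$ is a splitting star of $\tau$ if $\tau$ has a consistent orientation $O$ such that every element of $O$ lies below some element of $\sigma$ and $\sigma$ is the set of maximal elements of $O$. A branching star is a splitting star with at least three elements; its elements are branching points. For unoriented $s,s'$, $C(s,s')$ is the set of branching points $\vec b$ of $\tau$ for which there are orientations $\vec s$ of $s$ and $\vec{s'}$ of $s'$ with $\vec s\le\vec b\le\vec{s'}$ or $\vec{s'}\le\vec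 b\le\vec s$. $\tau$ is chain-complete if every non-empty chain has a supremum in $\tau$. $\tau$ is splittable if for all $\vec r\lneqq\vec s$ in $\tau$ there are $\vec r',\vec s'\in\tau$ with $\vec r\le\vec r'\lneqq\vec s'\le\vec s$ such that $\vec r'$ and $\overleftarrow{s'}$ lie in a common splitting star. Homomorphisms commute with the involutions and preserve $\le$; isomorphisms are bijective homomorphisms with homomorphic inverse. An inverse system of finite separation systems is a family $(\vec S_p)_{p\in P}$ over a directed poset $P$ with homomorphisms $f_{qp}\colon\vec S_q\to\vec S_p$ ($p\le q$), $f_{pp}=\mathrm{id}$, $f_{qp}f_{tq}=f_{tp}$; its inverse limit is the set of compatible families $(\vec s_p)$ with coordinatewise order and involution. A separation system is profinite if it is isomorphic to such an inverse limit. *)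

theory Defs
  imports "HOL-Library.FuncSet"
begin

section \<open>Separation systems and tree sets\<close>

definition poset_on :: "'a set \<Rightarrow> ('a \<Rightarrow> 'a \<Rightarrow> bool) \<Rightarrow> bool" where
  "poset_on A le \<longleftrightarrow> reflp_on A le \<and> antisymp_on A le \<and> transp_on A le"

record 'a sep_sys =
  seps :: "'a set"
  leq :: "'a \<Rightarrow> 'a \<Rightarrow> bool"
  flip :: "'a \<Rightarrow> 'a"

definition separation_system :: "'a sep_sys \<Rightarrow> bool" where
  "separation_system T \<longleftrightarrow>
     poset_on (seps T) (leq T) \<and>
     (\<forall>x\<in>seps T. flip T x \<in> seps T \<and> flip T (flip T x) = x) \<and>
     (\<forall>x\<in>seps T. \<forall>y\<in>seps T. leq T x y \<longrightarrow> leq T (flip T y) (flip T x))"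

text \<open>The unoriented separation underlying \<open>x\<close> is the set of its orientations.\<close>

definition unor :: "'a sep_sys \<Rightarrow> 'a \<Rightarrow> 'a set" where
  "unor T x = {x, flip T x}"

definition unoriented :: "'a sep_sys \<Rightarrow> 'a set set" where
  "unoriented T = unor T ` seps T"

definition degenerate :: "'a sep_sys \<Rightarrow> 'a \<Rightarrow> bool" where
  "degenerate T x \<longleftrightarrow> x = flip T x"

definition small :: "'a sep_sys \<Rightarrow> 'a \<Rightarrow> bool" where
  "small T x \<longleftrightarrow> leq T x (flip T x)"

text \<open>As unoriented separations are sets of orientations, this covers both the regularity of
  a set of oriented separations and that of an unoriented separation.\<close>

definition regular :: "'a sep_sys \<Rightarrow> 'a set \<Rightarrow> bool" where
  "regular T X \<longleftrightarrow> (\<forall>x\<in>X. \<not> small T x)"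

definition nested :: "'a sep_sys \<Rightarrow> 'a set \<Rightarrow> 'a set \<Rightarrow> bool" where
  "nested T r s \<longleftrightarrow> (\<exists>x\<in>r. \<exists>y\<in>s. leq T x y)"

definition lt :: "'a sep_sys \<Rightarrow> 'a \<Rightarrow> 'a \<Rightarrow> bool" where
  "lt T x y \<longleftrightarrow> leq T x y \<and> x \<noteq> y"

text \<open>Comparable, with distinct underlying unoriented separations; stronger than \<^const>\<open>lt\<close>.\<close>

definition lneqq :: "'a sep_sys \<Rightarrow> 'a \<Rightarrow> 'a \<Rightarrow> bool" where
  "lneqq T x y \<longleftrightarrow> leq T x y \<and> unor T x \<noteq> unor T y"

definition trivial :: "'a sep_sys \<Rightarrow> 'a \<Rightarrow> bool" where
  "trivial T x \<longleftrightarrow> (\<exists>y\<in>seps T. lt T x y \<and> lt T x (flip T y))"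

definition tree_set :: "'a sep_sys \<Rightarrow> bool" where
  "tree_set T \<longleftrightarrow>
     separation_system T \<and>
     (\<forall>r\<in>unoriented T. \<forall>s\<in>unoriented T. nested T r s) \<and>
     (\<forall>x\<in>seps T. \<not> degenerate T x \<and> \<not> trivial T x)"


section \<open>Orientations and stars\<close>

definition orientation :: "'a sep_sys \<Rightarrow> 'a set \<Rightarrow> bool" where
  "orientation T Or \<longleftrightarrow> Or \<subseteq> seps T \<and> (\<forall>s\<in>unoriented T. \<exists>!x. x \<in> s \<and> x \<in> Or)"

definition consistent :: "'a sep_sys \<Rightarrow> 'a set \<Rightarrow> bool" where
  "consistent T Or \<longleftrightarrow>
     \<not> (\<exists>x\<in>Or. \<exists>y\<in>Or. unor T x \<noteq> unor T y \<and> leq T (flip T x) y)"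

definition star :: "'a sep_sys \<Rightarrow> 'a set \<Rightarrow> bool" where
  "star T \<sigma> \<longleftrightarrow> \<sigma> \<subseteq> seps T \<and> (\<forall>x\<in>\<sigma>. \<forall>y\<in>\<sigma>. x \<noteq> y \<longrightarrow> leq T x (flip T y))"

definition maximal_elements :: "'a sep_sys \<Rightarrow> 'a set \<Rightarrow> 'a set" where
  "maximal_elements T X = {x \<in> X. \<not> (\<exists>y\<in>X. lt T x y)}"

definition splitting_star :: "'a sep_sys \<Rightarrow> 'a set \<Rightarrow> bool" where
  "splitting_star T \<sigma> \<longleftrightarrow>
     star T \<sigma> \<and>
     (\<exists>Or. orientation T Or \<and> consistent T Or \<and>
           (\<forall>x\<in>Or. \<exists>y\<in>\<sigma>. leq T x y) \<and> \<sigma> = maximal_elements T Or)"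

definition branching_star :: "'a sep_sys \<Rightarrow> 'a set \<Rightarrow> bool" where
  "branching_star T \<sigma> \<longleftrightarrow> splitting_star T \<sigma> \<and> (infinite \<sigma> \<or> 3 \<le> card \<sigma>)"

definition branching_points :: "'a sep_sys \<Rightarrow> 'a set" where
  "branching_points T = \<Union> {\<sigma>. branching_star T \<sigma>}"

definition branching_between :: "'a sep_sys \<Rightarrow> 'a set \<Rightarrow> 'a set \<Rightarrow> 'a set" where
  "branching_between T s s' =
     {b \<in> branching_points T. \<exists>x\<in>s. \<exists>y\<in>s'.
        (leq T x b \<and> leq T b y) \<or> (leq T y b \<and> leq T b x)}"

definition is_supremum :: "'a sep_sys \<Rightarrow> 'a set \<Rightarrow> 'a \<Rightarrow> bool" where
  "is_supremum T X u \<longleftrightarrow>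
     u \<in> seps T \<and> (\<forall>x\<in>X. leq T x u) \<and>
     (\<forall>v\<in>seps T. (\<forall>x\<in>X. leq T x v) \<longrightarrow> leq T u v)"

definition chain_complete :: "'a sep_sys \<Rightarrow> bool" where
  "chain_complete T \<longleftrightarrow>
     (\<forall>X. X \<subseteq> seps T \<and> X \<noteq> {} \<and> Complete_Partial_Order.chain (leq T) X
          \<longrightarrow> (\<exists>u. is_supremum T X u))"

definition splittable :: "'a sep_sys \<Rightarrow> bool" where
  "splittable T \<longleftrightarrow>
     (\<forall>x\<in>seps T. \<forall>y\<in>seps T. lneqq T x y \<longrightarrow>
        (\<exists>x'\<in>seps T. \<exists>y'\<in>seps T.
           leq T x x' \<and> lneqq T x' y' \<and> leq T y' y \<and>
           (\<exists>\<sigma>. splitting_star T \<sigma> \<and> x' \<in> \<sigma> \<and> flip T y' \<in> \<sigma>)))"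


section \<open>Inverse limits and profinite separation systems\<close>

definition sep_hom :: "('a \<Rightarrow> 'b) \<Rightarrow> 'a sep_sys \<Rightarrow> 'b sep_sys \<Rightarrow> bool" where
  "sep_hom h S T \<longleftrightarrow>
     h ` seps S \<subseteq> seps T \<and>
     (\<forall>x\<in>seps S. h (flip S x) = flip T (h x)) \<and>
     (\<forall>x\<in>seps S. \<forall>y\<in>seps S. leq S x y \<longrightarrow> leq T (h x) (h y))"

definition sep_iso :: "('a \<Rightarrow> 'b) \<Rightarrow> 'a sep_sys \<Rightarrow> 'b sep_sys \<Rightarrow> bool" where
  "sep_iso h S T \<longleftrightarrow>
     bij_betw h (seps S) (seps T) \<and> sep_hom h S T \<and> sep_hom (inv_into (seps S) h) T S"

definition directed_poset :: "'p set \<Rightarrow> ('p \<Rightarrow> 'p \<Rightarrow> bool) \<Rightarrow> bool" where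
  "directed_poset P le \<longleftrightarrow>
     poset_on P le \<and> P \<noteq> {} \<and> (\<forall>p\<in>P. \<forall>q\<in>P. \<exists>t\<in>P. le p t \<and> le q t)"

definition finite_inverse_system ::
  "'p set \<Rightarrow> ('p \<Rightarrow> 'p \<Rightarrow> bool) \<Rightarrow> ('p \<Rightarrow> 'b sep_sys) \<Rightarrow> ('p \<Rightarrow> 'p \<Rightarrow> 'b \<Rightarrow> 'b) \<Rightarrow> bool" where
  "finite_inverse_system P le S f \<longleftrightarrow>
     directed_poset P le \<and>
     (\<forall>p\<in>P. separation_system (S p) \<and> finite (seps (S p))) \<and>
     (\<forall>p\<in>P. \<forall>q\<in>P. le p q \<longrightarrow> sep_hom (f q p) (S q) (S p)) \<and>
     (\<forall>p\<in>P. \<forall>x\<in>seps (S p). f p p x = x) \<and>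
     (\<forall>p\<in>P. \<forall>q\<in>P. \<forall>t\<in>P. le p q \<and> le q t \<longrightarrow>
        (\<forall>x\<in>seps (S t). f q p (f t q x) = f t p x))"

definition inverse_limit ::
  "'p set \<Rightarrow> ('p \<Rightarrow> 'p \<Rightarrow> bool) \<Rightarrow> ('p \<Rightarrow> 'b sep_sys) \<Rightarrow> ('p \<Rightarrow> 'p \<Rightarrow> 'b \<Rightarrow> 'b)
     \<Rightarrow> ('p \<Rightarrow> 'b) sep_sys" where
  "inverse_limit P le S f =
     \<lparr>seps = {s \<in> (\<Pi>\<^sub>E p\<in>P. seps (S p)). \<forall>p\<in>P. \<forall>q\<in>P. le p q \<longrightarrow> f q p (s q) = s p},
      leq = (\<lambda>s t. \<forall>p\<in>P. leq (S p) (s p) (t p)),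
      flip = (\<lambda>s. \<lambda>p\<in>P. flip (S p) (s p))\<rparr>"

text \<open>HOL does not allow an existential quantifier over the types of the indices and of the
  elements of the finite systems, so these are fixed here. This is no restriction: by
  \<open>profiniteI\<close> below, being isomorphic to the inverse limit of any inverse system of
  finite separation systems, over whatever types, implies \<open>profinite\<close>.\<close>

definition profinite :: "'a sep_sys \<Rightarrow> bool" where
  "profinite T \<longleftrightarrow>
     (\<exists>(P :: ('a \<times> 'a) set set) le (S :: ('a \<times> 'a) set \<Rightarrow> nat sep_sys) f \<phi>.
        finite_inverse_system P le S f \<and> sep_iso \<phi> T (inverse_limit P le S f))"

text \<open>The original index \<open>p\<close> is replaced by the preorder which the \<open>p\<close>-th
  coordinate induces on \<open>T\<close>, and the \<open>p\<close>-th system by the quotient of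
  \<open>T\<close> by this preorder.\<close>

lemma profiniteI:
  fixes T :: "'a sep_sys" and P :: "'p set" and S :: "'p \<Rightarrow> 'b sep_sys"
  assumes T: "separation_system T"
    and sys: "finite_inverse_system P le S f"
    and iso: "sep_iso \<phi> T (inverse_limit P le S f)"
  shows "profinite T"
proof -
  define A where "A = seps T"
  define L where "L = inverse_limit P le S f"
  define R where "R p = {(x, y). x \<in> A \<and> y \<in> A \<and> leq (S p) (\<phi> x p) (\<phi> y p)}" for p
  have bij: "bij_betw \<phi> A (seps L)" and hom: "sep_hom \<phi> T L"
    and hom': "sep_hom (inv_into A \<phi>) L T"
    using iso unfolding sep_iso_def A_def L_def by auto
  have ss: "separation_system (S p)" and fin: "finite (seps (S p))" if "p \<in> P" for p
    using sys that unfolding finite_inverse_system_def by auto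
  have flA: "flip T x \<in> A" "flip T (flip T x) = x" if "x \<in> A" for x
    using T that unfolding separation_system_def A_def by auto
  have phiL: "\<phi> x \<in> seps L" if "x \<in> A" for x
    using bij that by (auto simp: bij_betw_def)
  have phiS: "\<phi> x p \<in> seps (S p)" if "x \<in> A" "p \<in> P" for x p
    using phiL[OF that(1)] that(2) unfolding L_def inverse_limit_def by (auto simp: PiE_def)
  have phif: "f q p (\<phi> x q) = \<phi> x p" if "x \<in> A" "p \<in> P" "q \<in> P" "le p q" for x p q
    using phiL[OF that(1)] that unfolding L_def inverse_limit_def by auto
  have phifl: "\<phi> (flip T x) p = flip (S p) (\<phi> x p)" if "x \<in> A" "p \<in> P" for x p
  proof -
    have "\<phi> (flip T x) = flip L (\<phi> x)"
      using hom that(1) unfolding sep_hom_def A_def by auto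
    then show ?thesis using that(2) by (simp add: L_def inverse_limit_def)
  qed
  have leT: "leq T x y \<longleftrightarrow> (\<forall>p\<in>P. leq (S p) (\<phi> x p) (\<phi> y p))" if "x \<in> A" "y \<in> A" for x y
  proof
    assume "leq T x y"
    then have "leq L (\<phi> x) (\<phi> y)" using hom that unfolding sep_hom_def A_def by auto
    then show "\<forall>p\<in>P. leq (S p) (\<phi> x p) (\<phi> y p)" by (simp add: L_def inverse_limit_def)
  next
    assume "\<forall>p\<in>P. leq (S p) (\<phi> x p) (\<phi> y p)"
    then have "leq L (\<phi> x) (\<phi> y)" by (simp add: L_def inverse_limit_def)
    then have "leq T (inv_into A \<phi> (\<phi> x)) (inv_into A \<phi> (\<phi> y))"
      using hom' phiL that unfolding sep_hom_def by auto
    then show "leq T x y" using bij that by (simp add: bij_betw_def)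
  qed
  have reflS: "leq (S p) a a" if "p \<in> P" "a \<in> seps (S p)" for p a
    using ss[OF that(1)] that(2) unfolding separation_system_def poset_on_def
    by (auto dest: reflp_onD)
  have antiS: "a = b" if "p \<in> P" "a \<in> seps (S p)" "b \<in> seps (S p)" "leq (S p) a b" "leq (S p) b a"
    for p a b
    using ss[OF that(1)] that unfolding separation_system_def poset_on_def
    by (auto dest: antisymp_onD)
  have transS: "leq (S p) a c" if "p \<in> P" "a \<in> seps (S p)" "b \<in> seps (S p)" "c \<in> seps (S p)"
    "leq (S p) a b" "leq (S p) b c" for p a b c
    using ss[OF that(1)] that unfolding separation_system_def poset_on_def
    by (auto dest: transp_onD)
  have flS: "leq (S p) (flip (S p) b) (flip (S p) a)"
    if "p \<in> P" "a \<in> seps (S p)" "b \<in> seps (S p)" "leq (S p) a b" for p a b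
    using ss[OF that(1)] that unfolding separation_system_def by auto
  have homf: "leq (S p) (f q p a) (f q p b)"
    if "p \<in> P" "q \<in> P" "le p q" "a \<in> seps (S q)" "b \<in> seps (S q)" "leq (S q) a b" for p q a b
    using sys that unfolding finite_inverse_system_def sep_hom_def by blast
  have Rmono: "R q \<subseteq> R p" if "p \<in> P" "q \<in> P" "le p q" for p q
  proof
    fix z assume "z \<in> R q"
    then obtain x y where z: "z = (x, y)" and xy: "x \<in> A" "y \<in> A" "leq (S q) (\<phi> x q) (\<phi> y q)"
      unfolding R_def by auto
    from homf[OF that phiS phiS xy(3)] xy that have "leq (S p) (f q p (\<phi> x q)) (f q p (\<phi> y q))"
      by simp
    then show "z \<in> R p" using z xy phif that by (simp add: R_def)
  qed
  have Req: "\<phi> x p = \<phi> y p \<longleftrightarrow> (x, y) \<in> R p \<and> (y, x) \<in> R p"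
    if "p \<in> P" "x \<in> A" "y \<in> A" for p x y
    using that antiS reflS phiS unfolding R_def by auto
  define P' where "P' = R ` P"
  have "\<forall>r\<in>P'. \<exists>k :: 'a \<Rightarrow> nat. finite (k ` A) \<and>
      (\<forall>x\<in>A. \<forall>y\<in>A. k x = k y \<longleftrightarrow> (x, y) \<in> r \<and> (y, x) \<in> r)"
  proof
    fix r assume "r \<in> P'"
    then obtain p where p: "p \<in> P" "r = R p" unfolding P'_def by auto
    from finite_imp_inj_to_nat_seg[OF fin[OF p(1)]]
    obtain h :: "'b \<Rightarrow> nat" where h: "inj_on h (seps (S p))" by auto
    have "(\<lambda>x. h (\<phi> x p)) ` A \<subseteq> h ` seps (S p)" using phiS p by auto
    then have "finite ((\<lambda>x. h (\<phi> x p)) ` A)" using fin[OF p(1)] finite_subset by blast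
    moreover have "h (\<phi> x p) = h (\<phi> y p) \<longleftrightarrow> (x, y) \<in> r \<and> (y, x) \<in> r" if "x \<in> A" "y \<in> A" for x y
      using Req[OF p(1) that] h phiS[OF _ p(1)] that p(2) by (auto simp: inj_on_eq_iff)
    ultimately show "\<exists>k :: 'a \<Rightarrow> nat. finite (k ` A) \<and>
      (\<forall>x\<in>A. \<forall>y\<in>A. k x = k y \<longleftrightarrow> (x, y) \<in> r \<and> (y, x) \<in> r)"
      by (intro exI[of _ "\<lambda>x. h (\<phi> x p)"]) auto
  qed
  then obtain k :: "('a \<times> 'a) set \<Rightarrow> 'a \<Rightarrow> nat" where
    kfin: "\<And>r. r \<in> P' \<Longrightarrow> finite (k r ` A)" and
    keq: "\<And>r x y. r \<in> P' \<Longrightarrow> x \<in> A \<Longrightarrow> y \<in> A \<Longrightarrow> k r x = k r y \<longleftrightarrow> (x, y) \<in> r \<and> (y, x) \<in> r"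
    by metis
  define g where "g r n = inv_into A (k r) n" for r n
  have gA: "g r (k r x) \<in> A" and kg: "k r (g r (k r x)) = k r x" if "x \<in> A" for r x
    unfolding g_def using that by (auto intro: inv_into_into f_inv_into_f)
  have grel: "(g r (k r x), x) \<in> r" "(x, g r (k r x)) \<in> r" if "r \<in> P'" "x \<in> A" for r x
    using keq[OF that(1) gA[OF that(2)] that(2)] kg[OF that(2)] by auto
  have rtrans: "(x, z) \<in> r" if r: "r \<in> P'" and xyz: "(x, y) \<in> r" "(y, z) \<in> r" for r x y z
  proof -
    obtain p where p: "p \<in> P" "r = R p" using r unfolding P'_def by auto
    then show ?thesis
      using xyz transS[OF p(1) phiS phiS phiS, of x y z] unfolding R_def by auto
  qed
  have rrefl: "(x, x) \<in> r" if "r \<in> P'" "x \<in> A" for r x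
    using that reflS phiS unfolding P'_def R_def by auto
  have rflip: "(flip T y, flip T x) \<in> r" if "r \<in> P'" "(x, y) \<in> r" for r x y
    using that flS phiS phifl flA unfolding P'_def R_def by auto
  have rA: "x \<in> A \<and> y \<in> A" if "r \<in> P'" "(x, y) \<in> r" for r x y
    using that unfolding P'_def R_def by auto
  define S' where "S' r = \<lparr>seps = k r ` A, leq = (\<lambda>m n. (g r m, g r n) \<in> r),
      flip = (\<lambda>n. k r (flip T (g r n)))\<rparr>" for r
  have S'seps: "seps (S' r) = k r ` A" for r by (simp add: S'_def)
  have S'le: "leq (S' r) (k r x) (k r y) \<longleftrightarrow> (x, y) \<in> r" if "r \<in> P'" "x \<in> A" "y \<in> A" for r x y
    using grel[OF that(1)] that rtrans[OF that(1)] by (simp add: S'_def) blast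
  have S'fl: "flip (S' r) (k r x) = k r (flip T x)" if "r \<in> P'" "x \<in> A" for r x
    using that grel[OF that] rflip flA gA keq by (simp add: S'_def)
  have S'ss: "separation_system (S' r)" if r: "r \<in> P'" for r
    unfolding separation_system_def poset_on_def
  proof (intro conjI ballI impI)
    show "reflp_on (seps (S' r)) (leq (S' r))"
      by (rule reflp_onI) (auto simp: S'seps S'le r rrefl)
    show "antisymp_on (seps (S' r)) (leq (S' r))"
      by (rule antisymp_onI) (auto simp: S'seps S'le r keq)
    show "transp_on (seps (S' r)) (leq (S' r))"
      by (rule transp_onI) (auto simp: S'seps S'le r dest: rtrans[OF r])
    show "flip (S' r) m \<in> seps (S' r)" if "m \<in> seps (S' r)" for m
      using that by (auto simp: S'seps S'fl r flA)
    show "flip (S' r) (flip (S' r) m) = m" if "m \<in> seps (S' r)" for m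
      using that by (auto simp: S'seps S'fl r flA)
    show "leq (S' r) (flip (S' r) n) (flip (S' r) m)"
      if "m \<in> seps (S' r)" "n \<in> seps (S' r)" "leq (S' r) m n" for m n
      using that by (auto simp: S'seps S'le S'fl r flA rflip)
  qed
  define le' :: "('a \<times> 'a) set \<Rightarrow> ('a \<times> 'a) set \<Rightarrow> bool" where "le' r s \<longleftrightarrow> s \<subseteq> r" for r s
  define f' where "f' s r n = k r (g s n)" for s r n
  have f'k: "f' s r (k s x) = k r x" if "r \<in> P'" "s \<in> P'" "le' r s" "x \<in> A" for r s x
    using that grel[OF that(2,4)] keq[OF that(1) gA[OF that(4)] that(4)]
    unfolding f'_def le'_def by auto
  have dir: "directed_poset P' le'"
  proof -
    have "\<exists>t\<in>P. le p t \<and> le q t" if "p \<in> P" "q \<in> P" for p q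
      using sys that unfolding finite_inverse_system_def directed_poset_def by blast
    note dirP = this
    have "\<exists>t\<in>P'. le' r t \<and> le' s t" if r: "r \<in> P'" and s: "s \<in> P'" for r s
    proof -
      obtain p q where p: "p \<in> P" "r = R p" and q: "q \<in> P" "s = R q"
        using r s unfolding P'_def by auto
      obtain t where t: "t \<in> P" "le p t" "le q t" using dirP[OF p(1) q(1)] by auto
      have "R t \<in> P'" using t(1) unfolding P'_def by simp
      moreover have "le' r (R t)" "le' s (R t)"
        using Rmono[OF p(1) t(1,2)] Rmono[OF q(1) t(1,3)] p(2) q(2) by (simp_all add: le'_def)
      ultimately show ?thesis by blast
    qed
    moreover have "P' \<noteq> {}"
      using sys unfolding finite_inverse_system_def directed_poset_def P'_def by blast
    moreover have "poset_on P' le'"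
      unfolding poset_on_def le'_def by (auto intro!: reflp_onI antisymp_onI transp_onI)
    ultimately show ?thesis unfolding directed_poset_def by blast
  qed
  have sys': "finite_inverse_system P' le' S' f'"
    unfolding finite_inverse_system_def
  proof (intro conjI ballI impI)
    show "directed_poset P' le'" by (rule dir)
    show "separation_system (S' r)" if "r \<in> P'" for r by (rule S'ss[OF that])
    show "finite (seps (S' r))" if "r \<in> P'" for r using kfin[OF that] by (simp add: S'seps)
    show "sep_hom (f' s r) (S' s) (S' r)" if rs: "r \<in> P'" "s \<in> P'" "le' r s" for r s
      unfolding sep_hom_def S'seps
      using rs by (auto simp: f'k S'le S'fl flA) (auto simp: le'_def)
    show "f' r r x = x" if "r \<in> P'" "x \<in> seps (S' r)" for r x
      using that f'k[OF that(1,1)] by (auto simp: S'seps le'_def)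
    show "f' s r (f' t s x) = f' t r x"
      if "r \<in> P'" "s \<in> P'" "t \<in> P'" "le' r s \<and> le' s t" "x \<in> seps (S' t)" for r s t x
    proof -
      have "le' r t" using that(4) by (auto simp: le'_def)
      then show ?thesis using that by (auto simp: S'seps f'k)
    qed
  qed
  define L' where "L' = inverse_limit P' le' S' f'"
  define \<psi> where "\<psi> x = (\<lambda>r\<in>P'. k r x)" for x
  have psiL: "\<psi> x \<in> seps L'" if "x \<in> A" for x
    using that by (auto simp: L'_def inverse_limit_def \<psi>_def S'seps f'k)
  have psile: "leq L' (\<psi> x) (\<psi> y) \<longleftrightarrow> leq T x y" if "x \<in> A" "y \<in> A" for x y
  proof -
    have "leq L' (\<psi> x) (\<psi> y) \<longleftrightarrow> (\<forall>r\<in>P'. (x, y) \<in> r)"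
      using that by (auto simp: L'_def inverse_limit_def \<psi>_def S'le)
    also have "\<dots> \<longleftrightarrow> leq T x y"
      using that leT[OF that] by (auto simp: P'_def R_def)
    finally show ?thesis .
  qed
  have psifl: "\<psi> (flip T x) = flip L' (\<psi> x)" if "x \<in> A" for x
    using that by (auto simp: L'_def inverse_limit_def \<psi>_def S'fl intro!: restrict_ext)
  have psiinj: "inj_on \<psi> A"
  proof (rule inj_onI)
    fix x y assume xy: "x \<in> A" "y \<in> A" "\<psi> x = \<psi> y"
    have "leq L' (\<psi> x) (\<psi> x)" "leq L' (\<psi> y) (\<psi> y)"
      using xy T psile unfolding separation_system_def poset_on_def A_def
      by (auto dest: reflp_onD)
    then have "leq T x y" "leq T y x" using xy psile by metis+
    then show "x = y" using xy T unfolding separation_system_def poset_on_def A_def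
      by (auto dest: antisymp_onD)
  qed
  have psisurj: "t \<in> \<psi> ` A" if t: "t \<in> seps L'" for t
  proof -
    have tk: "t r \<in> k r ` A" if "r \<in> P'" for r
      using t that by (auto simp: L'_def inverse_limit_def S'seps PiE_def)
    have tf: "f' s r (t s) = t r" if "r \<in> P'" "s \<in> P'" "le' r s" for r s
      using t that by (auto simp: L'_def inverse_limit_def)
    have "\<forall>p\<in>P. \<exists>x\<in>A. k (R p) x = t (R p)"
      using tk unfolding P'_def by (metis image_iff)
    then obtain x where xA: "\<And>p. p \<in> P \<Longrightarrow> x p \<in> A"
      and xt: "\<And>p. p \<in> P \<Longrightarrow> k (R p) (x p) = t (R p)" by metis
    define s where "s = (\<lambda>p\<in>P. \<phi> (x p) p)"
    have kphi: "\<phi> u p = \<phi> v p" if "p \<in> P" "u \<in> A" "v \<in> A" "k (R p) u = k (R p) v" for p u v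
      using that Req keq[of "R p" u v] unfolding P'_def by blast
    have "f q p (s q) = s p" if pq: "p \<in> P" "q \<in> P" "le p q" for p q
    proof -
      have "R p \<in> P'" "R q \<in> P'" "le' (R p) (R q)"
        using pq Rmono unfolding P'_def le'_def by auto
      then have "k (R p) (x q) = k (R p) (x p)"
        using f'k[of "R p" "R q" "x q"] tf[of "R p" "R q"] xt xA pq by simp
      then have "\<phi> (x q) p = \<phi> (x p) p" using kphi pq xA by blast
      then show ?thesis using pq phif xA by (simp add: s_def)
    qed
    then have "s \<in> seps L"
      using phiS xA by (auto simp: L_def inverse_limit_def s_def)
    then obtain y where y: "y \<in> A" "\<phi> y = s"
      using bij unfolding bij_betw_def by (metis imageE)
    have "t r = k r y" if r: "r \<in> P'" for r
    proof -
      obtain p where p: "p \<in> P" "r = R p" using r unfolding P'_def by auto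
      have "\<phi> y p = \<phi> (x p) p" using y p by (simp add: s_def)
      then have "k r y = k r (x p)" using Req[OF p(1) y(1) xA[OF p(1)]] keq r y xA p by blast
      then show ?thesis using xt p by simp
    qed
    moreover have "t \<in> extensional P'" using t by (auto simp: L'_def inverse_limit_def PiE_def)
    ultimately have "t = \<psi> y"
      unfolding \<psi>_def by (auto intro!: extensionalityI[of t P'])
    then show ?thesis using y by blast
  qed
  have psibij: "bij_betw \<psi> A (seps L')"
    using psiinj psisurj psiL by (auto simp: bij_betw_def)
  have "sep_hom \<psi> T L'"
    unfolding sep_hom_def using psiL psifl psile unfolding A_def by auto
  moreover have "sep_hom (inv_into A \<psi>) L' T"
  proof -
    have im: "seps L' = \<psi> ` A" using psibij by (simp add: bij_betw_def)
    show ?thesis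
      unfolding sep_hom_def im
      using psiinj psile flA by (auto simp: psifl[symmetric] A_def[symmetric])
  qed
  ultimately have "sep_iso \<psi> T L'"
    using psibij unfolding sep_iso_def A_def by blast
  then show ?thesis
    using sys' unfolding profinite_def L'_def by blast
qed

end

theory Submission
  imports Defs
begin

text \<open>Necessity: along an ultrafilter, each coordinate of an inverse limit of finite systems is
  eventually constant, so ultrafilters converge coordinatewise and limits respect the order and the
  involution. Suprema of chains are such limits. A coordinate that distinguishes \<open>r < s\<close> cuts
  the interval between them into two parts that are closed under limits, which yields a jump and hence
  a splitting star. The limit of infinitely many elements of a star is small and belongs to the star.
  If there were infinitely many branching points \<open>b\<close> between two regular separations, then
  these together with a third point \<open>c b\<close> of each star would converge to \<open>w\<close>
  and \<open>z\<close> with \<open>z\<close> below both orientations of \<open>w\<close>, which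
  is impossible.

  Sufficiency: a finite set \<open>F\<close> of separations induces the finite quotient that
  records, for each \<open>x\<close>, which elements of \<open>F\<close> lie below \<open>x\<close> and which
  lie below its inverse. Only those \<open>b\<close> may be used in \<open>F\<close> that are not forced to
  be limits of separations not above them; by splittability there are enough of them to separate points.
  Every compatible family of quotient elements gives an ultrafilter, and it remains to find its limit.
  The ultrafilter determines a down-closed orientation of \<open>T\<close>. This orientation either comes
  from a splitting star, which must be infinite and have a small element as its limit, or contains an
  unbounded chain, whose supremum is the limit up to inversion; the second case is where the
  finiteness of the number of branching points is needed.\<close>

section \<open>Ultrafilters\<close>

definition ultra :: "'i filter \<Rightarrow> bool" where
  "ultra G \<longleftrightarrow> G \<noteq> bot \<and> (\<forall>Q. eventually Q G \<or> eventually (\<lambda>x. \<not> Q x) G)"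

text \<open>Zorn's lemma for the reversed order yields a minimal proper filter below
  \<open>F\<close>. If it does not contain the negation of \<open>Q\<close>, then restricting it to
  \<open>Q\<close> leaves it proper, so by minimality it already contains \<open>Q\<close>.\<close>

lemma ultra_exists:
  assumes "F \<noteq> bot"
  obtains G :: "'i filter" where "G \<le> F" "ultra G"
proof -
  define A where "A = {G. G \<le> F \<and> G \<noteq> bot}"
  have "\<exists>m\<in>A. \<forall>G\<in>A. G \<le> m \<longrightarrow> G = m"
  proof (rule predicate_Zorn[where P = "\<lambda>G H. H \<le> G"])
    show "partial_order_on A (relation_of (\<lambda>G H. H \<le> G) A)"
      by (auto simp: partial_order_on_def preorder_on_def refl_on_def trans_def antisym_def
          relation_of_def)
  next
    fix C assume C: "C \<in> Chains (relation_of (\<lambda>G H. H \<le> G) A)"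
    show "\<exists>u\<in>A. \<forall>a\<in>C. u \<le> a"
    proof (cases "C = {}")
      case True
      then show ?thesis using assms by (auto simp: A_def)
    next
      case False
      have CA: "C \<subseteq> A" and tot: "\<And>G H. G \<in> C \<Longrightarrow> H \<in> C \<Longrightarrow> G \<le> H \<or> H \<le> G"
        using C by (auto simp: Chains_def relation_of_def)
      \<comment> \<open>A chain of filters is a filter base, so its infimum contains only predicates
        of its members and stays proper.\<close>
      have "eventually Q (Inf C) \<longleftrightarrow> (\<exists>b\<in>C. eventually Q b)" for Q
        by (rule eventually_Inf_base[OF False]) (meson tot inf_greatest order_refl)
      then have "Inf C \<noteq> bot"
        using CA by (auto simp: trivial_limit_def A_def)
      moreover have "Inf C \<le> F"
        using False CA by (auto simp: A_def intro: Inf_lower2)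
      ultimately show ?thesis by (auto simp: A_def intro: Inf_lower)
    qed
  qed
  then obtain G where G: "G \<le> F" "G \<noteq> bot"
    and max: "\<And>H. H \<le> F \<Longrightarrow> H \<noteq> bot \<Longrightarrow> H \<le> G \<Longrightarrow> H = G"
    by (auto simp: A_def)
  have "eventually Q G" if "\<not> eventually (\<lambda>x. \<not> Q x) G" for Q
  proof -
    have "inf G (principal {x. Q x}) \<noteq> bot"
      using that by (simp add: trivial_limit_def eventually_inf_principal)
    then have "inf G (principal {x. Q x}) = G"
      using G(1) by (intro max) (auto intro: le_infI1)
    moreover have "eventually Q (inf G (principal {x. Q x}))"
      by (simp add: eventually_inf_principal)
    ultimately show ?thesis by simp
  qed
  then show ?thesis using that G unfolding ultra_def by blast
qed

text \<open>This is compactness of a finite set: if each value were eventually avoided, then so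
  would be all of them at once.\<close>

lemma ultra_finite_range:
  assumes G: "ultra G" and V: "finite V" and ev: "eventually (\<lambda>i. h i \<in> V) G"
  shows "\<exists>v\<in>V. eventually (\<lambda>i. h i = v) G"
proof (rule ccontr)
  assume "\<not> ?thesis"
  then have "\<forall>v\<in>V. eventually (\<lambda>i. h i \<noteq> v) G"
    using G unfolding ultra_def by blast
  then have "eventually (\<lambda>i. \<forall>v\<in>V. h i \<noteq> v) G"
    by (rule eventually_ball_finite[OF V])
  then have "eventually (\<lambda>i. False) G"
    using ev by eventually_elim blast
  then show False using G by (simp add: ultra_def trivial_limit_def)
qed

lemma ultra_ex: "ultra G \<Longrightarrow> eventually Q G \<Longrightarrow> \<exists>x. Q x"
  unfolding ultra_def by (meson eventually_happens trivial_limit_def)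

lemma ultra_const: "ultra G \<Longrightarrow> eventually (\<lambda>x. c) G \<longleftrightarrow> c"
  unfolding ultra_def by (cases c) (simp_all add: trivial_limit_def)

lemma ultra_disj:
  assumes "ultra G" "eventually (\<lambda>x. Q x \<or> R x) G"
  shows "eventually Q G \<or> eventually R G"
proof -
  have "eventually R G" if "eventually (\<lambda>x. \<not> Q x) G"
    using assms(2) that by eventually_elim blast
  then show ?thesis using assms(1) unfolding ultra_def by blast
qed

text \<open>The cofinite filter restricted to \<open>B\<close> is proper because \<open>B\<close> is
  infinite, and every ultrafilter refining it will do. It avoids each single index, so its limits
  are accumulation points.\<close>

lemma infinite_ultra:
  assumes "infinite B"
  obtains G where "ultra G" "eventually (\<lambda>i. i \<in> B) G" "\<And>i. eventually (\<lambda>j. j \<noteq> i) G"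
proof -
  have "inf cofinite (principal B) \<noteq> bot"
    using assms by (simp add: trivial_limit_def eventually_inf_principal eventually_cofinite)
  then obtain G where G: "G \<le> inf cofinite (principal B)" "ultra G"
    by (rule ultra_exists)
  have "eventually (\<lambda>i. i \<in> B) (inf cofinite (principal B))"
    by (simp add: eventually_inf_principal)
  moreover have "eventually (\<lambda>j. j \<noteq> i) (inf cofinite (principal B))" for i
    by (rule filter_leD[OF inf_le1]) (simp add: eventually_cofinite)
  ultimately show ?thesis using that G filter_leD by blast
qed

section \<open>Tree sets\<close>

locale tree =
  fixes T :: "'a sep_sys"
  assumes tree: "tree_set T"
begin

abbreviation E where "E \<equiv> seps T"
abbreviation le (infix "\<sqsubseteq>" 50) where "x \<sqsubseteq> y \<equiv> leq T x y"
abbreviation inv ("\<ominus> _" [80] 80) where "\<ominus> x \<equiv> flip T x"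

lemma sepsys: "separation_system T"
  using tree by (simp add: tree_set_def)

lemma fl_in [simp]: "x \<in> E \<Longrightarrow> \<ominus> x \<in> E"
  and flfl [simp]: "x \<in> E \<Longrightarrow> \<ominus> \<ominus> x = x"
  using sepsys by (auto simp: separation_system_def)

lemma le_refl [simp]: "x \<in> E \<Longrightarrow> x \<sqsubseteq> x"
  using sepsys by (auto simp: separation_system_def poset_on_def dest: reflp_onD)

lemma le_antisym: "x \<sqsubseteq> y \<Longrightarrow> y \<sqsubseteq> x \<Longrightarrow> x \<in> E \<Longrightarrow> y \<in> E \<Longrightarrow> x = y"
  using sepsys by (auto simp: separation_system_def poset_on_def dest: antisymp_onD)

lemma le_trans: "x \<sqsubseteq> y \<Longrightarrow> y \<sqsubseteq> z \<Longrightarrow> x \<in> E \<Longrightarrow> y \<in> E \<Longrightarrow> z \<in> E \<Longrightarrow> x \<sqsubseteq> z"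
  using sepsys by (auto simp: separation_system_def poset_on_def dest: transp_onD)

lemma fl_mono: "x \<sqsubseteq> y \<Longrightarrow> x \<in> E \<Longrightarrow> y \<in> E \<Longrightarrow> \<ominus> y \<sqsubseteq> \<ominus> x"
  using sepsys by (auto simp: separation_system_def)

lemma fl_le_iff [simp]: "x \<in> E \<Longrightarrow> y \<in> E \<Longrightarrow> \<ominus> y \<sqsubseteq> \<ominus> x \<longleftrightarrow> x \<sqsubseteq> y"
  by (metis fl_mono fl_in flfl)

lemma le_fl: "x \<sqsubseteq> \<ominus> y \<Longrightarrow> x \<in> E \<Longrightarrow> y \<in> E \<Longrightarrow> y \<sqsubseteq> \<ominus> x"
  and fl_le: "\<ominus> x \<sqsubseteq> y \<Longrightarrow> x \<in> E \<Longrightarrow> y \<in> E \<Longrightarrow> \<ominus> y \<sqsubseteq> x"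
  by (metis fl_mono fl_in flfl)+

lemma fl_inj [simp]: "x \<in> E \<Longrightarrow> y \<in> E \<Longrightarrow> \<ominus> x = \<ominus> y \<longleftrightarrow> x = y"
  by (metis flfl)

lemma nondeg [simp]: "x \<in> E \<Longrightarrow> \<ominus> x \<noteq> x" "x \<in> E \<Longrightarrow> x \<noteq> \<ominus> x"
  using tree unfolding tree_set_def degenerate_def by metis+

lemma nontriv: "x \<sqsubseteq> y \<Longrightarrow> x \<sqsubseteq> \<ominus> y \<Longrightarrow> x \<in> E \<Longrightarrow> y \<in> E \<Longrightarrow> x = y \<or> x = \<ominus> y"
  using tree unfolding tree_set_def trivial_def lt_def by blast

lemma nested_cases:
  assumes "x \<in> E" "y \<in> E"
  shows "x \<sqsubseteq> y \<or> y \<sqsubseteq> x \<or> x \<sqsubseteq> \<ominus> y \<or> \<ominus> x \<sqsubseteq> y"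
proof -
  have "nested T (unor T x) (unor T y)"
    using tree assms by (auto simp: tree_set_def unoriented_def)
  then have "x \<sqsubseteq> y \<or> x \<sqsubseteq> \<ominus> y \<or> \<ominus> x \<sqsubseteq> y \<or> \<ominus> x \<sqsubseteq> \<ominus> y"
    by (auto simp: nested_def unor_def)
  then show ?thesis using assms by auto
qed

lemma unor_eq: "x \<in> E \<Longrightarrow> y \<in> E \<Longrightarrow> unor T x = unor T y \<longleftrightarrow> x = y \<or> x = \<ominus> y"
  by (auto simp: unor_def doubleton_eq_iff)

lemma lneqq_iff: "x \<in> E \<Longrightarrow> y \<in> E \<Longrightarrow> lneqq T x y \<longleftrightarrow> x \<sqsubseteq> y \<and> x \<noteq> y \<and> x \<noteq> \<ominus> y"
  by (auto simp: lneqq_def unor_eq)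

text \<open>Anything strictly below a small separation is below both of its orientations and hence
  trivial. Dually, nothing lies strictly above the inverse of a small separation.\<close>

lemma small_minimal:
  assumes "s \<sqsubseteq> \<ominus> s" "x \<sqsubseteq> s" "x \<in> E" "s \<in> E"
  shows "x = s"
  using nontriv[of x s] le_trans[of x s "\<ominus> s"] le_antisym[of "\<ominus> s" s] assms by auto

lemma cosmall_maximal:
  assumes "\<ominus> s \<sqsubseteq> s" "s \<sqsubseteq> x" "x \<in> E" "s \<in> E"
  shows "x = s"
  using small_minimal[of "\<ominus> s" "\<ominus> x"] assms by (simp add: fl_mono)

lemma between_small:
  assumes "x \<sqsubseteq> y" "y \<sqsubseteq> \<ominus> x" "x \<in> E" "y \<in> E"
  shows "y = x \<or> y = \<ominus> x"
  using nontriv[OF assms(1) le_fl[OF assms(2,4,3)] assms(3,4)] assms by auto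

subsection \<open>Orientations\<close>

definition down_closed where
  "down_closed Or \<longleftrightarrow> (\<forall>x\<in>E. \<forall>y\<in>Or. x \<sqsubseteq> y \<longrightarrow> x \<in> Or)"

text \<open>The elementwise form of \<open>orientation\<close>, without unoriented separations. The
  two agree because no separation is degenerate.\<close>

definition oriented where
  "oriented Or \<longleftrightarrow> Or \<subseteq> E \<and> (\<forall>x\<in>E. x \<in> Or \<or> \<ominus> x \<in> Or) \<and> (\<forall>x\<in>Or. \<ominus> x \<notin> Or)"

lemma orientation_iff: "orientation T Or \<longleftrightarrow> oriented Or"
proof
  assume Or: "orientation T Or"
  have "(x \<in> Or \<or> \<ominus> x \<in> Or) \<and> (x \<in> Or \<longrightarrow> \<ominus> x \<notin> Or)" if "x \<in> E" for x
  proof -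
    have "\<exists>!y. y \<in> unor T x \<and> y \<in> Or"
      using Or that by (auto simp: orientation_def unoriented_def)
    then show ?thesis using nondeg[OF that] by (auto simp: unor_def)
  qed
  then show "oriented Or" using Or unfolding oriented_def orientation_def by blast
next
  assume Or: "oriented Or"
  have "\<exists>!y. y \<in> unor T x \<and> y \<in> Or" if "x \<in> E" for x
    using Or that nondeg[OF that] by (cases "x \<in> Or") (auto simp: oriented_def unor_def)
  then show "orientation T Or" using Or by (auto simp: oriented_def orientation_def unoriented_def)
qed

text \<open>A violating pair would put both orientations of \<open>x\<close> into \<open>Or\<close>.
  Down-closedness is stronger than consistency: it also excludes elements above their own
  inverse.\<close>

lemma consistent_down_closed:
  assumes "oriented Or" "down_closed Or"
  shows "consistent T Or"
  unfolding consistent_def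
proof (intro notI, elim bexE conjE)
  fix x y assume *: "x \<in> Or" "y \<in> Or" "\<ominus> x \<sqsubseteq> y"
  then have "\<ominus> x \<in> Or"
    using assms unfolding oriented_def down_closed_def by (metis fl_in subsetD)
  then show False using * assms by (auto simp: oriented_def)
qed

text \<open>All separations are oriented toward \<open>a\<close>, and \<open>a\<close> is chosen
  from its own two orientations. The inverse of \<open>a\<close> has to be excluded explicitly
  because it satisfies the last disjunct.\<close>

definition toward where
  "toward a = {x \<in> E. x \<noteq> \<ominus> a \<and> (x \<sqsubseteq> a \<or> x \<sqsubseteq> \<ominus> a)}"

lemma toward_oriented:
  assumes "a \<in> E"
  shows "oriented (toward a)"
proof -
  have "\<not> (x \<in> toward a \<and> \<ominus> x \<in> toward a)" if "x \<in> E" for x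
  proof
    assume "x \<in> toward a \<and> \<ominus> x \<in> toward a"
    then have *: "x \<noteq> \<ominus> a" "x \<noteq> a" "x \<sqsubseteq> a \<or> x \<sqsubseteq> \<ominus> a" "\<ominus> x \<sqsubseteq> a \<or> \<ominus> x \<sqsubseteq> \<ominus> a"
      using assms that by (auto simp: toward_def)
    note [simp] = assms that
    have "x \<sqsubseteq> a \<Longrightarrow> \<ominus> x \<sqsubseteq> a \<Longrightarrow> False"
      using nontriv[of "\<ominus> a" x] fl_le[of x a] fl_mono[of x a] * by force
    moreover have "x \<sqsubseteq> \<ominus> a \<Longrightarrow> \<ominus> x \<sqsubseteq> \<ominus> a \<Longrightarrow> False"
      using nontriv[of a x] le_fl[of x a] * by force
    moreover have "x \<sqsubseteq> a \<Longrightarrow> \<ominus> x \<sqsubseteq> \<ominus> a \<Longrightarrow> False"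
      using le_antisym[of x a] * by force
    moreover have "x \<sqsubseteq> \<ominus> a \<Longrightarrow> \<ominus> x \<sqsubseteq> a \<Longrightarrow> False"
      using le_antisym[of x "\<ominus> a"] fl_le[of x a] * by force
    ultimately show False using * by blast
  qed
  moreover have "x \<in> toward a \<or> \<ominus> x \<in> toward a" if "x \<in> E" for x
  proof (cases "x = a \<or> x = \<ominus> a")
    case False
    then show ?thesis
      using nested_cases[OF that assms] that assms by (auto simp: toward_def)
  qed (use assms in \<open>auto simp: toward_def\<close>)
  ultimately show ?thesis unfolding oriented_def by (auto simp: toward_def)
qed

text \<open>Consistency excludes other elements above the inverse of \<open>a\<close>, and
  maximality excludes those above \<open>a\<close>. Nestedness leaves only members of
  \<open>toward a\<close>, and an orientation contained in another one equals it.\<close>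

lemma oriented_maximal_toward:
  assumes Or: "oriented Or" "consistent T Or" and a: "a \<in> maximal_elements T Or"
  shows "Or = toward a"
proof -
  have aO: "a \<in> Or" and aE: "a \<in> E" and max: "\<And>y. y \<in> Or \<Longrightarrow> a \<sqsubseteq> y \<Longrightarrow> y = a"
    using a Or by (auto simp: maximal_elements_def lt_def oriented_def)
  have sub: "Or \<subseteq> toward a"
  proof
    fix x assume x: "x \<in> Or"
    then have xE: "x \<in> E" using Or by (auto simp: oriented_def)
    have ne: "x \<noteq> \<ominus> a" using x aO aE Or by (auto simp: oriented_def)
    show "x \<in> toward a"
    proof (cases "x = a")
      case False
      have "\<not> \<ominus> a \<sqsubseteq> x"
        using Or(2) x aO ne False unor_eq[OF aE xE] xE aE unfolding consistent_def
        by (metis flfl)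
      moreover have "\<not> a \<sqsubseteq> x" using max x False by auto
      ultimately show ?thesis
        using nested_cases[OF xE aE] fl_le[OF _ xE aE] ne xE unfolding toward_def by blast
    qed (use aE ne in \<open>auto simp: toward_def\<close>)
  qed
  have "x \<in> Or" if "x \<in> toward a" for x
  proof (rule ccontr)
    assume "x \<notin> Or"
    then have "\<ominus> x \<in> toward a" "x \<in> E"
      using sub Or(1) that by (auto simp: oriented_def toward_def)
    then show False using toward_oriented[OF aE] that by (auto simp: oriented_def)
  qed
  then show ?thesis using sub by blast
qed

section \<open>Splitting stars and the orientations that induce them\<close>

definition splits where
  "splits Or \<sigma> \<longleftrightarrow> star T \<sigma> \<and> oriented Or \<and> consistent T Or \<and>
     (\<forall>x\<in>Or. \<exists>y\<in>\<sigma>. x \<sqsubseteq> y) \<and> \<sigma> = maximal_elements T Or"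

lemma splitting_star_iff: "splitting_star T \<sigma> \<longleftrightarrow> (\<exists>Or. splits Or \<sigma>)"
  by (auto simp: splitting_star_def splits_def orientation_iff)

lemma splitsD:
  assumes "splits Or \<sigma>"
  shows "\<sigma> \<subseteq> E" "\<sigma> \<subseteq> Or" "Or \<subseteq> E"
    and "m \<in> \<sigma> \<Longrightarrow> x \<in> Or \<Longrightarrow> m \<sqsubseteq> x \<Longrightarrow> x = m"
    and "x \<in> Or \<Longrightarrow> \<exists>y\<in>\<sigma>. x \<sqsubseteq> y"
    and "x \<in> \<sigma> \<Longrightarrow> y \<in> \<sigma> \<Longrightarrow> x \<noteq> y \<Longrightarrow> x \<sqsubseteq> \<ominus> y"
    and "x \<in> Or \<Longrightarrow> \<ominus> x \<notin> Or"
    and "x \<in> E \<Longrightarrow> x \<notin> Or \<Longrightarrow> \<ominus> x \<in> Or"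
proof -
  have *: "star T \<sigma>" "oriented Or" "\<forall>x\<in>Or. \<exists>y\<in>\<sigma>. x \<sqsubseteq> y" "\<sigma> = maximal_elements T Or"
    using assms by (auto simp: splits_def)
  show "\<sigma> \<subseteq> E" "x \<in> \<sigma> \<Longrightarrow> y \<in> \<sigma> \<Longrightarrow> x \<noteq> y \<Longrightarrow> x \<sqsubseteq> \<ominus> y"
    using *(1) unfolding star_def by blast+
  show "\<sigma> \<subseteq> Or" "m \<in> \<sigma> \<Longrightarrow> x \<in> Or \<Longrightarrow> m \<sqsubseteq> x \<Longrightarrow> x = m"
    using *(4) unfolding maximal_elements_def lt_def by blast+
  show "Or \<subseteq> E" "x \<in> Or \<Longrightarrow> \<ominus> x \<notin> Or" "x \<in> E \<Longrightarrow> x \<notin> Or \<Longrightarrow> \<ominus> x \<in> Or"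
    using *(2) unfolding oriented_def by blast+
  show "x \<in> Or \<Longrightarrow> \<exists>y\<in>\<sigma>. x \<sqsubseteq> y"
    using *(3) by blast
qed

lemma splits_toward: "splits Or \<sigma> \<Longrightarrow> a \<in> \<sigma> \<Longrightarrow> Or = toward a"
  unfolding splits_def using oriented_maximal_toward by blast

text \<open>Both stars come from the orientation \<open>toward a\<close>, so any one element
  determines its splitting star.\<close>

lemma splitting_star_unique:
  assumes "splitting_star T \<sigma>" "splitting_star T \<sigma>'" "a \<in> \<sigma>" "a \<in> \<sigma>'"
  shows "\<sigma> = \<sigma>'"
  using assms splits_toward unfolding splitting_star_iff by (metis splits_def)

text \<open>The star property is automatic: \<open>Or\<close> is \<open>toward x\<close> for each
  maximal \<open>x\<close>, so another maximal \<open>y\<close> lies below \<open>x\<close> or below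
  its inverse, and maximality of \<open>y\<close> excludes the former.\<close>

lemma splitting_starI:
  assumes Or: "oriented Or" "consistent T Or"
    and max: "\<And>x. x \<in> Or \<Longrightarrow> \<exists>y\<in>maximal_elements T Or. x \<sqsubseteq> y"
  shows "splitting_star T (maximal_elements T Or)"
proof -
  have "x \<sqsubseteq> \<ominus> y"
    if xy: "x \<in> maximal_elements T Or" "y \<in> maximal_elements T Or" "x \<noteq> y" for x y
  proof -
    have *: "x \<in> Or" "y \<in> Or" "x \<in> E" "y \<in> E" "\<not> x \<sqsubseteq> y"
      using xy Or by (auto simp: maximal_elements_def lt_def oriented_def)
    have "y \<in> toward x" "y \<noteq> \<ominus> x"
      using oriented_maximal_toward[OF Or xy(1)] * Or(1) by (auto simp: oriented_def)
    then have "y \<sqsubseteq> x \<or> y \<sqsubseteq> \<ominus> x" by (auto simp: toward_def)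
    moreover have "\<not> y \<sqsubseteq> x" using xy * by (auto simp: maximal_elements_def lt_def)
    ultimately show ?thesis using * le_fl by blast
  qed
  then have "star T (maximal_elements T Or)"
    using Or by (auto simp: star_def maximal_elements_def oriented_def)
  then show ?thesis using Or max by (auto simp: splitting_star_def orientation_iff)
qed

text \<open>In a violating pair, elements on the same side of \<open>a\<close> are squeezed between
  \<open>a\<close> and its inverse, and both equal \<open>a\<close>. If they are on different sides,
  one of them is the inverse of \<open>a\<close>, which \<open>toward a\<close> omits.\<close>

lemma toward_consistent:
  assumes a: "a \<in> E"
  shows "consistent T (toward a)"
  unfolding consistent_def
proof (intro notI, elim bexE conjE)
  fix y z assume y: "y \<in> toward a" and z: "z \<in> toward a"
    and ne: "unor T y \<noteq> unor T z" and le: "\<ominus> y \<sqsubseteq> z"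
  have E: "y \<in> E" "z \<in> E" and na: "y \<noteq> \<ominus> a" "z \<noteq> \<ominus> a"
    and yz: "y \<noteq> z" and le': "\<ominus> z \<sqsubseteq> y"
    using y z ne le fl_le by (auto simp: toward_def)
  have A: "u = a" if "u \<sqsubseteq> a" "\<ominus> a \<sqsubseteq> u" "u \<in> E" "u \<noteq> \<ominus> a" for u
    using nontriv[of "\<ominus> a" u] that a by auto
  have B: "u = a" if "u \<sqsubseteq> \<ominus> a" "a \<sqsubseteq> u" "u \<in> E" "u \<noteq> \<ominus> a" for u
    using nontriv[of a u] le_fl[OF that(1)] that a by auto
  have C: "False" if "u \<sqsubseteq> a" "v \<sqsubseteq> \<ominus> a" "\<ominus> u \<sqsubseteq> v" "u \<in> E" "v \<in> E" "v \<noteq> \<ominus> a" for u v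
  proof -
    have "\<ominus> a \<sqsubseteq> v" using le_trans[of "\<ominus> a" "\<ominus> u" v] that a by simp
    then show False using le_antisym[of "\<ominus> a" v] that a by auto
  qed
  consider "y \<sqsubseteq> a" "z \<sqsubseteq> a" | "y \<sqsubseteq> a" "z \<sqsubseteq> \<ominus> a" | "y \<sqsubseteq> \<ominus> a" "z \<sqsubseteq> a" | "y \<sqsubseteq> \<ominus> a" "z \<sqsubseteq> \<ominus> a"
    using y z by (auto simp: toward_def)
  then show False
  proof cases
    case 1
    then have "\<ominus> a \<sqsubseteq> z" "\<ominus> a \<sqsubseteq> y"
      using le_trans[of "\<ominus> a" "\<ominus> y" z] le_trans[of "\<ominus> a" "\<ominus> z" y] le le' E a by simp_all
    then show ?thesis using A 1 E na yz by blast
  next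
    case 2
    then show ?thesis using C le E na by blast
  next
    case 3
    then show ?thesis using C le' E na by blast
  next
    case 4
    then have "a \<sqsubseteq> z" "a \<sqsubseteq> y"
      using le_trans[of a "\<ominus> y" z] le_trans[of a "\<ominus> z" y] le le' E a le_fl by simp_all
    then show ?thesis using B 4 E na yz by blast
  qed
qed

section \<open>Maximal elements, suprema of chains and jumps\<close>

text \<open>Zorn's lemma is applied to the elements of \<open>Q\<close> above \<open>x\<close>. Thus
  only non-empty chains above \<open>x\<close> have to be bounded; the empty chain is bounded by
  \<open>x\<close>.\<close>

lemma zorn:
  assumes Q: "Q \<subseteq> E" and x: "x \<in> Q"
    and bound: "\<And>X. X \<subseteq> Q \<Longrightarrow> X \<noteq> {} \<Longrightarrow> Complete_Partial_Order.chain (leq T) X \<Longrightarrow>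
      \<forall>y\<in>X. x \<sqsubseteq> y \<Longrightarrow> \<exists>u\<in>Q. \<forall>y\<in>X. y \<sqsubseteq> u"
  obtains m where "m \<in> Q" "x \<sqsubseteq> m" "\<And>y. y \<in> Q \<Longrightarrow> m \<sqsubseteq> y \<Longrightarrow> y = m"
proof -
  define A where "A = {y \<in> Q. x \<sqsubseteq> y}"
  have AE: "A \<subseteq> E" and xA: "x \<in> A" using Q x by (auto simp: A_def)
  have "\<exists>m\<in>A. \<forall>y\<in>A. m \<sqsubseteq> y \<longrightarrow> y = m"
  proof (rule predicate_Zorn)
    have 1: "refl_on A (relation_of (leq T) A)" "relation_of (leq T) A \<subseteq> A \<times> A"
      using AE by (auto simp: refl_on_def relation_of_def)
    have 2: "trans (relation_of (leq T) A)"
      using AE le_trans unfolding trans_def relation_of_def by blast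
    have 3: "antisym (relation_of (leq T) A)"
      using AE le_antisym unfolding antisym_def relation_of_def by blast
    show "partial_order_on A (relation_of (leq T) A)"
      using 1 2 3 by (simp add: partial_order_on_def preorder_on_def)
  next
    fix C assume "C \<in> Chains (relation_of (leq T) A)"
    then have C: "C \<subseteq> A" "Complete_Partial_Order.chain (leq T) C"
      unfolding Chains_def relation_of_def Complete_Partial_Order.chain_def by blast+
    show "\<exists>u\<in>A. \<forall>y\<in>C. y \<sqsubseteq> u"
    proof (cases "C = {}")
      case False
      then obtain u where u: "u \<in> Q" "\<forall>y\<in>C. y \<sqsubseteq> u"
        using bound[of C] C by (auto simp: A_def)
      obtain y where "y \<in> C" using False by blast
      then have "x \<sqsubseteq> u" using le_trans[of x y u] u C(1) Q x by (auto simp: A_def)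
      then show ?thesis using u by (auto simp: A_def)
    qed (use xA in auto)
  qed
  then obtain m where m: "m \<in> A" "\<And>y. y \<in> A \<Longrightarrow> m \<sqsubseteq> y \<Longrightarrow> y = m" by blast
  show ?thesis
  proof (rule that)
    show "m \<in> Q" "x \<sqsubseteq> m" using m(1) by (auto simp: A_def)
    show "y = m" if "y \<in> Q" "m \<sqsubseteq> y" for y
    proof (rule m(2)[OF _ that(2)])
      show "y \<in> A" using le_trans[of x m y] that m(1) Q x by (auto simp: A_def)
    qed
  qed
qed

lemma chain_completeD:
  assumes "chain_complete T" "X \<subseteq> E" "X \<noteq> {}" "Complete_Partial_Order.chain (leq T) X"
  obtains u where "u \<in> E" "\<And>x. x \<in> X \<Longrightarrow> x \<sqsubseteq> u"
    "\<And>v. v \<in> E \<Longrightarrow> (\<And>x. x \<in> X \<Longrightarrow> x \<sqsubseteq> v) \<Longrightarrow> u \<sqsubseteq> v"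
proof -
  obtain u where "is_supremum T X u"
    using assms unfolding chain_complete_def by metis
  then show ?thesis using that[of u] unfolding is_supremum_def by blast
qed

lemma chain_total:
  "Complete_Partial_Order.chain (leq T) X \<Longrightarrow> x \<in> X \<Longrightarrow> y \<in> X \<Longrightarrow> x \<sqsubseteq> y \<or> y \<sqsubseteq> x"
  unfolding Complete_Partial_Order.chain_def by blast

text \<open>The orientation \<open>toward a\<close> induces the star: \<open>between_small\<close>
  makes \<open>a\<close> maximal, and an element strictly above the inverse of \<open>b\<close>
  would contradict the jump or put that inverse below both orientations of \<open>a\<close>.\<close>

lemma jump_splitting_star:
  assumes cc: "chain_complete T" and a: "a \<in> E" and b: "b \<in> E"
    and ab: "a \<sqsubseteq> b" "a \<noteq> b" "a \<noteq> \<ominus> b"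
    and jump: "\<And>w. w \<in> E \<Longrightarrow> a \<sqsubseteq> w \<Longrightarrow> w \<sqsubseteq> b \<Longrightarrow> w = a \<or> w = b"
  shows "\<exists>\<sigma>. splitting_star T \<sigma> \<and> a \<in> \<sigma> \<and> \<ominus> b \<in> \<sigma>"
proof (intro exI conjI)
  let ?M = "maximal_elements T (toward a)"
  have ba: "\<ominus> b \<sqsubseteq> \<ominus> a" "\<ominus> b \<noteq> \<ominus> a" using ab a b by auto
  have tE: "toward a \<subseteq> E" by (auto simp: toward_def)
  show aM: "a \<in> ?M"
  proof -
    have "a = y" if y: "y \<in> toward a" "a \<sqsubseteq> y" for y
    proof -
      have "y \<in> E" "y \<noteq> \<ominus> a" "y \<sqsubseteq> a \<or> y \<sqsubseteq> \<ominus> a" using y by (auto simp: toward_def)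
      then show ?thesis using le_antisym[of a y] between_small[of a y] y(2) a by blast
    qed
    then show ?thesis using a by (auto simp: maximal_elements_def lt_def toward_def)
  qed
  show bM: "\<ominus> b \<in> ?M"
  proof -
    have "\<ominus> b = y" if y: "y \<in> toward a" "\<ominus> b \<sqsubseteq> y" for y
    proof -
      have yE: "y \<in> E" "y \<noteq> \<ominus> a" "y \<sqsubseteq> a \<or> y \<sqsubseteq> \<ominus> a" using y by (auto simp: toward_def)
      show ?thesis
      proof (cases "y \<sqsubseteq> \<ominus> a")
        case True
        then have "\<ominus> y = a \<or> \<ominus> y = b"
          using jump[of "\<ominus> y"] le_fl[OF True] fl_le[OF y(2)] a b yE by auto
        then show ?thesis using yE a b by auto
      next
        case False
        then have "\<ominus> b \<sqsubseteq> a" using le_trans[OF y(2), of a] yE a b by simp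
        then show ?thesis using nontriv[of "\<ominus> b" a] ba ab a b by auto
      qed
    qed
    then show ?thesis using ba ab a b by (auto simp: maximal_elements_def lt_def toward_def)
  qed
  \<comment> \<open>By Zorn's lemma: an unbounded chain would have supremum \<open>\<ominus> a\<close>, but the elements
    of the chain are all below \<open>b\<close> or all below \<open>\<ominus> b\<close>.\<close>
  show "splitting_star T ?M"
  proof (rule splitting_starI[OF toward_oriented[OF a] toward_consistent[OF a]])
    fix x assume x: "x \<in> toward a"
    show "\<exists>y\<in>?M. x \<sqsubseteq> y"
    proof (cases "x \<sqsubseteq> a")
      case False
      have "\<exists>u\<in>toward a. \<forall>y\<in>X. y \<sqsubseteq> u"
        if X: "X \<subseteq> toward a" "X \<noteq> {}" "Complete_Partial_Order.chain (leq T) X" "\<forall>y\<in>X. x \<sqsubseteq> y" for X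
      proof -
        have XE: "X \<subseteq> E" using X tE by blast
        have Xa: "y \<sqsubseteq> \<ominus> a" "y \<noteq> \<ominus> a" "\<not> y \<sqsubseteq> a" "y \<in> E" if "y \<in> X" for y
        proof -
          show yE: "y \<in> E" and "y \<noteq> \<ominus> a" using that X(1) by (auto simp: toward_def)
          show *: "\<not> y \<sqsubseteq> a" using False le_trans[of x y a] X(4) x tE that yE a by blast
          show "y \<sqsubseteq> \<ominus> a" using * that X(1) by (auto simp: toward_def)
        qed
        obtain u where u: "u \<in> E" "\<And>y. y \<in> X \<Longrightarrow> y \<sqsubseteq> u"
          "\<And>v. v \<in> E \<Longrightarrow> (\<And>y. y \<in> X \<Longrightarrow> y \<sqsubseteq> v) \<Longrightarrow> u \<sqsubseteq> v"
          using chain_completeD[OF cc XE X(2,3)] by blast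
        have ua: "u \<sqsubseteq> \<ominus> a" using u(3) Xa a by simp
        have "u \<noteq> \<ominus> a"
        proof
          assume eq: "u = \<ominus> a"
          have alt: "y \<sqsubseteq> b \<or> y \<sqsubseteq> \<ominus> b" if y: "y \<in> X" for y
          proof -
            have "y = \<ominus> b" if "\<ominus> b \<sqsubseteq> y"
            proof -
              have "\<ominus> y = a \<or> \<ominus> y = b"
                using jump[of "\<ominus> y"] Xa[OF y] le_fl[OF Xa(1)[OF y]] fl_le[OF that] a b by auto
              then show ?thesis using Xa[OF y] a b by auto
            qed
            moreover have "\<not> b \<sqsubseteq> y"
            proof
              assume "b \<sqsubseteq> y"
              then have "a \<sqsubseteq> y" using le_trans ab a b Xa(4)[OF y] by blast
              then have "y = a" using between_small[of a y] Xa[OF y] a by blast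
              then show False using Xa(3)[OF y] a by simp
            qed
            ultimately show ?thesis
              using nested_cases[OF Xa(4)[OF y] b] fl_le[of y b] Xa[OF y] b le_refl[of "\<ominus> b"] by auto
          qed
          show False
          proof (cases "\<forall>y\<in>X. y \<sqsubseteq> \<ominus> b")
            case True
            then have "\<ominus> a \<sqsubseteq> \<ominus> b" using u(3)[of "\<ominus> b"] eq b by simp
            then show False using le_antisym[OF ba(1)] ba a b by auto
          next
            case notall: False
            then obtain c where c: "c \<in> X" "\<not> c \<sqsubseteq> \<ominus> b" by blast
            have "y \<sqsubseteq> b" if y: "y \<in> X" for y
              using chain_total[OF X(3) c(1) y] alt[OF c(1)] alt[OF y] c le_trans[of y c b]
                le_trans[of c y "\<ominus> b"] Xa(4)[OF y] Xa(4)[OF c(1)] b by auto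
            then have "\<ominus> a \<sqsubseteq> b" using u(3)[OF b] eq by simp
            then have "\<ominus> b \<sqsubseteq> a" using fl_le a b by blast
            then show False using nontriv[of "\<ominus> b" a] ba ab a b by auto
          qed
        qed
        then have "u \<in> toward a" using u ua by (simp add: toward_def)
        then show ?thesis using u by blast
      qed
      from zorn[OF tE x this] obtain m
        where "m \<in> toward a" "x \<sqsubseteq> m" "\<And>y. y \<in> toward a \<Longrightarrow> m \<sqsubseteq> y \<Longrightarrow> y = m"
        by blast
      then show ?thesis by (auto simp: maximal_elements_def lt_def)
    qed (use aM in blast)
  qed
qed

end

section \<open>Profinite tree sets\<close>

text \<open>These are the properties of an inverse limit of finite systems that the arguments rest
  on: order and involution are coordinatewise, and along an ultrafilter each coordinate is
  eventually that of a limit point.\<close>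

locale profinite_tree = tree T for T :: "'a sep_sys" +
  fixes P :: "'p set" and S :: "'p \<Rightarrow> 'b sep_sys" and \<phi> :: "'a \<Rightarrow> 'p \<Rightarrow> 'b"
  assumes le_iff: "\<And>x y. x \<in> E \<Longrightarrow> y \<in> E \<Longrightarrow> x \<sqsubseteq> y \<longleftrightarrow> (\<forall>p\<in>P. leq (S p) (\<phi> x p) (\<phi> y p))"
    and coord_flip: "\<And>x p. x \<in> E \<Longrightarrow> p \<in> P \<Longrightarrow> \<phi> (\<ominus> x) p = flip (S p) (\<phi> x p)"
    and limit: "\<And>G :: 'a filter. \<And>h. ultra G \<Longrightarrow> eventually (\<lambda>i. h i \<in> E) G \<Longrightarrow>
      \<exists>z\<in>E. \<forall>p\<in>P. eventually (\<lambda>i. \<phi> (h i) p = \<phi> z p) G"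
begin

text \<open>For each coordinate one index \<open>i\<close> suffices, at which \<open>h i\<close> has
  the coordinate of \<open>z\<close> and the inequality holds.\<close>

lemma le_limit:
  assumes "ultra G" "eventually (\<lambda>i. h i \<in> E) G" "z \<in> E"
    "\<And>p. p \<in> P \<Longrightarrow> eventually (\<lambda>i. \<phi> (h i) p = \<phi> z p) G"
    "y \<in> E" "eventually (\<lambda>i. y \<sqsubseteq> h i) G"
  shows "y \<sqsubseteq> z"
  unfolding le_iff[OF assms(5,3)]
proof
  fix p assume p: "p \<in> P"
  have "eventually (\<lambda>i. h i \<in> E \<and> \<phi> (h i) p = \<phi> z p \<and> y \<sqsubseteq> h i) G"
    using assms(2) assms(4)[OF p] assms(6) by eventually_elim blast
  from ultra_ex[OF assms(1) this] show "leq (S p) (\<phi> y p) (\<phi> z p)"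
    using le_iff assms(5) p by metis
qed

lemma limit_le:
  assumes "ultra G" "eventually (\<lambda>i. h i \<in> E) G" "z \<in> E"
    "\<And>p. p \<in> P \<Longrightarrow> eventually (\<lambda>i. \<phi> (h i) p = \<phi> z p) G"
    "y \<in> E" "eventually (\<lambda>i. h i \<sqsubseteq> y) G"
  shows "z \<sqsubseteq> y"
  unfolding le_iff[OF assms(3,5)]
proof
  fix p assume p: "p \<in> P"
  have "eventually (\<lambda>i. h i \<in> E \<and> \<phi> (h i) p = \<phi> z p \<and> h i \<sqsubseteq> y) G"
    using assms(2) assms(4)[OF p] assms(6) by eventually_elim blast
  from ultra_ex[OF assms(1) this] show "leq (S p) (\<phi> z p) (\<phi> y p)"
    using le_iff assms(5) p by metis
qed

text \<open>The limit along an ultrafilter that refines the tails of the chain is the supremum. By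
  the last clause each coordinate of the supremum is attained in the chain, so conditions on one
  coordinate pass to suprema.\<close>

lemma chain_limit:
  assumes X: "X \<subseteq> E" "X \<noteq> {}" "Complete_Partial_Order.chain (leq T) X"
  obtains z where "z \<in> E" "\<And>x. x \<in> X \<Longrightarrow> x \<sqsubseteq> z"
    "\<And>v. v \<in> E \<Longrightarrow> (\<And>x. x \<in> X \<Longrightarrow> x \<sqsubseteq> v) \<Longrightarrow> z \<sqsubseteq> v"
    "\<And>p. p \<in> P \<Longrightarrow> \<exists>x\<in>X. \<phi> x p = \<phi> z p"
proof -
  define F where "F = (INF x\<in>X. principal {y \<in> X. x \<sqsubseteq> y})"
  have F: "eventually Q F \<longleftrightarrow> (\<exists>x\<in>X. \<forall>y\<in>X. x \<sqsubseteq> y \<longrightarrow> Q y)" for Q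
    unfolding F_def
  proof (subst eventually_INF_base[OF X(2)])
    fix a b assume ab: "a \<in> X" "b \<in> X"
    have "\<And>x y z. x \<in> X \<Longrightarrow> y \<in> X \<Longrightarrow> z \<in> X \<Longrightarrow> x \<sqsubseteq> y \<Longrightarrow> y \<sqsubseteq> z \<Longrightarrow> x \<sqsubseteq> z"
      using le_trans X(1) by blast
    then have "a \<sqsubseteq> b \<Longrightarrow> {y \<in> X. b \<sqsubseteq> y} \<subseteq> {y \<in> X. a \<sqsubseteq> y}"
      "b \<sqsubseteq> a \<Longrightarrow> {y \<in> X. a \<sqsubseteq> y} \<subseteq> {y \<in> X. b \<sqsubseteq> y}"
      using ab by blast+
    then show "\<exists>x\<in>X. principal {y \<in> X. x \<sqsubseteq> y}
        \<le> inf (principal {y \<in> X. a \<sqsubseteq> y}) (principal {y \<in> X. b \<sqsubseteq> y})"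
      using chain_total[OF X(3) ab] ab by auto
  qed (auto simp: eventually_principal)
  have "F \<noteq> bot"
    unfolding trivial_limit_def F using X(1) le_refl by blast
  then obtain G where G: "G \<le> F" "ultra G" by (rule ultra_exists)
  have evX: "eventually (\<lambda>y. y \<in> X) G"
    by (rule filter_leD[OF G(1)]) (use X(2) in \<open>auto simp: F\<close>)
  then have evE: "eventually (\<lambda>y. y \<in> E) G"
    by eventually_elim (use X(1) in blast)
  obtain z where z: "z \<in> E" "\<And>p. p \<in> P \<Longrightarrow> eventually (\<lambda>i. \<phi> i p = \<phi> z p) G"
    using limit[OF G(2) evE] by blast
  show ?thesis
  proof (rule that[OF z(1)])
    show "x \<sqsubseteq> z" if "x \<in> X" for x
    proof (rule le_limit[OF G(2) evE z])
      show "x \<in> E" using that X by blast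
      show "eventually (\<lambda>i. x \<sqsubseteq> i) G"
        by (rule filter_leD[OF G(1)]) (use that in \<open>auto simp: F\<close>)
    qed
    show "z \<sqsubseteq> v" if v: "v \<in> E" "\<And>x. x \<in> X \<Longrightarrow> x \<sqsubseteq> v" for v
      by (rule limit_le[OF G(2) evE z v(1)]) (use evX v(2) in \<open>auto elim: eventually_mono\<close>)
    show "\<exists>x\<in>X. \<phi> x p = \<phi> z p" if "p \<in> P" for p
      using ultra_ex[OF G(2) eventually_conj[OF evX z(2)[OF that]]] by blast
  qed
qed

lemma chain_complete: "chain_complete T"
  unfolding chain_complete_def is_supremum_def by (metis chain_limit)

text \<open>Zorn's lemma applies because the supremum of a chain shares its
  \<open>p\<close>-coordinate with a member of the chain and so inherits \<open>K\<close>.\<close>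

lemma maximal_below:
  assumes s: "s \<in> E" and p: "p \<in> P" and x: "x \<in> E" "x \<sqsubseteq> s" "K (\<phi> x p)"
  obtains m where "m \<in> E" "m \<sqsubseteq> s" "K (\<phi> m p)" "x \<sqsubseteq> m"
    "\<And>y. y \<in> E \<Longrightarrow> y \<sqsubseteq> s \<Longrightarrow> K (\<phi> y p) \<Longrightarrow> m \<sqsubseteq> y \<Longrightarrow> y = m"
proof -
  define Q where "Q = {y \<in> E. y \<sqsubseteq> s \<and> K (\<phi> y p)}"
  have QE: "Q \<subseteq> E" and xQ: "x \<in> Q" using x by (auto simp: Q_def)
  have "\<exists>u\<in>Q. \<forall>y\<in>X. y \<sqsubseteq> u"
    if X: "X \<subseteq> Q" "X \<noteq> {}" "Complete_Partial_Order.chain (leq T) X" for X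
  proof -
    have XE: "X \<subseteq> E" using X QE by blast
    obtain z where z: "z \<in> E" "\<And>x. x \<in> X \<Longrightarrow> x \<sqsubseteq> z"
      "\<And>v. v \<in> E \<Longrightarrow> (\<And>x. x \<in> X \<Longrightarrow> x \<sqsubseteq> v) \<Longrightarrow> z \<sqsubseteq> v"
      "\<And>p. p \<in> P \<Longrightarrow> \<exists>x\<in>X. \<phi> x p = \<phi> z p"
      using chain_limit[OF XE X(2,3)] by blast
    have "z \<sqsubseteq> s" using z(3)[OF s] X(1) by (auto simp: Q_def)
    moreover have "K (\<phi> z p)" using z(4)[OF p] X(1) by (auto simp: Q_def)
    ultimately have "z \<in> Q" using z(1) by (simp add: Q_def)
    then show ?thesis using z(2) by blast
  qed
  from zorn[OF QE xQ this] obtain m where "m \<in> Q" "x \<sqsubseteq> m" "\<And>y. y \<in> Q \<Longrightarrow> m \<sqsubseteq> y \<Longrightarrow> y = m"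
    by blast
  then show ?thesis using that unfolding Q_def by blast
qed

text \<open>At a coordinate \<open>p\<close> showing that \<open>s\<close> is not below
  \<open>r\<close>, let \<open>a\<close> be maximal between \<open>r\<close> and \<open>s\<close>
  with coordinate at most that of \<open>r\<close>, and then \<open>b\<close> minimal between
  \<open>a\<close> and \<open>s\<close> with coordinate not at most that of
  \<open>r\<close>.\<close>

lemma splittable: "splittable T"
  unfolding splittable_def
proof (intro ballI impI)
  fix r s assume rE: "r \<in> E" and sE: "s \<in> E" and "lneqq T r s"
  then have rs: "r \<sqsubseteq> s" "r \<noteq> s" "r \<noteq> \<ominus> s" by (auto simp: lneqq_iff)
  then have "\<not> s \<sqsubseteq> r" using le_antisym rE sE by blast
  then obtain p where p: "p \<in> P" "\<not> leq (S p) (\<phi> s p) (\<phi> r p)"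
    using le_iff rE sE by blast
  have r_r: "leq (S p) (\<phi> r p) (\<phi> r p)" using le_iff[OF rE rE] rE p(1) by simp
  obtain a where a: "a \<in> E" "a \<sqsubseteq> s" "leq (S p) (\<phi> a p) (\<phi> r p)" "r \<sqsubseteq> a"
    "\<And>y. y \<in> E \<Longrightarrow> y \<sqsubseteq> s \<Longrightarrow> leq (S p) (\<phi> y p) (\<phi> r p) \<Longrightarrow> a \<sqsubseteq> y \<Longrightarrow> y = a"
    using maximal_below[OF sE p(1) rE rs(1), of "\<lambda>v. leq (S p) v (\<phi> r p)"] r_r by blast
  have "\<ominus> s \<sqsubseteq> \<ominus> a" "\<not> leq (S p) (flip (S p) (\<phi> (\<ominus> s) p)) (\<phi> r p)"
    using a sE p coord_flip[of "\<ominus> s" p] by auto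
  \<comment> \<open>The minimal \<open>b\<close> above \<open>a\<close> is found as the inverse of a
    maximal \<open>c\<close> below the inverse of \<open>a\<close>.\<close>
  then obtain c where c: "c \<in> E" "c \<sqsubseteq> \<ominus> a" "\<not> leq (S p) (flip (S p) (\<phi> c p)) (\<phi> r p)" "\<ominus> s \<sqsubseteq> c"
    "\<And>y. y \<in> E \<Longrightarrow> y \<sqsubseteq> \<ominus> a \<Longrightarrow> \<not> leq (S p) (flip (S p) (\<phi> y p)) (\<phi> r p) \<Longrightarrow> c \<sqsubseteq> y \<Longrightarrow> y = c"
    using maximal_below[of "\<ominus> a" p "\<ominus> s" "\<lambda>v. \<not> leq (S p) (flip (S p) v) (\<phi> r p)"] a(1) sE p
    by (metis fl_in)
  define b where "b = \<ominus> c"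
  have b: "b \<in> E" "a \<sqsubseteq> b" "\<not> leq (S p) (\<phi> b p) (\<phi> r p)" "b \<sqsubseteq> s"
    using c a sE p coord_flip[of c p] le_fl[OF c(2)] fl_le[OF c(4)] by (auto simp: b_def)
  have b_min: "w = b" if w: "w \<in> E" "a \<sqsubseteq> w" "\<not> leq (S p) (\<phi> w p) (\<phi> r p)" "w \<sqsubseteq> b" for w
  proof -
    have "\<ominus> w = c"
      using c(5)[of "\<ominus> w"] w a c p coord_flip[of "\<ominus> w" p] le_fl[of w c] by (auto simp: b_def)
    then show ?thesis using w by (auto simp: b_def)
  qed
  have ab: "a \<noteq> b" using a b by auto
  \<comment> \<open>Otherwise \<open>a\<close> and the inverse of \<open>b\<close> are small, so
    \<open>r = a\<close> and \<open>s = b\<close> by extremality, and \<open>r\<close> would be the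
    inverse of \<open>s\<close>.\<close>
  have ab': "a \<noteq> \<ominus> b"
  proof
    assume eq: "a = \<ominus> b"
    then have "a \<sqsubseteq> \<ominus> a" using b by simp
    then have "r = a" using small_minimal a rE by blast
    moreover have "s = b"
      using cosmall_maximal[of b s] eq b sE by simp
    ultimately show False using eq rs by simp
  qed
  \<comment> \<open>A separation in between is on one side of the cut at \<open>p\<close>: below the
    cut it is \<open>a\<close> by maximality, above it \<open>b\<close> by minimality.\<close>
  have "w = a \<or> w = b" if "w \<in> E" "a \<sqsubseteq> w" "w \<sqsubseteq> b" for w
    using a(5)[of w] b_min[of w] that le_trans[of w b s] b sE by blast
  then obtain \<sigma> where "splitting_star T \<sigma>" "a \<in> \<sigma>" "\<ominus> b \<in> \<sigma>"
    using jump_splitting_star[OF chain_complete a(1) b(1,2) ab ab'] by blast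
  then show "\<exists>x'\<in>E. \<exists>y'\<in>E. r \<sqsubseteq> x' \<and> lneqq T x' y' \<and> y' \<sqsubseteq> s \<and>
      (\<exists>\<sigma>. splitting_star T \<sigma> \<and> x' \<in> \<sigma> \<and> \<ominus> y' \<in> \<sigma>)"
    using a b ab ab' lneqq_iff[OF a(1) b(1)] by blast
qed

section \<open>Infinite splitting stars of profinite tree sets\<close>

text \<open>All elements of the star except \<open>y\<close> lie below the inverse of
  \<open>y\<close>, hence so does a limit \<open>z\<close> along a non-principal ultrafilter. Then
  the whole star lies below the inverse of \<open>z\<close>, and a second passage to the limit shows
  that \<open>z\<close> is small. It remains to place \<open>z\<close> in the star.\<close>

lemma infinite_splitting_star_small:
  assumes \<sigma>: "splitting_star T \<sigma>" "infinite \<sigma>"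
  shows "\<not> regular T \<sigma>"
proof -
  obtain Or where Or': "splits Or \<sigma>" using \<sigma>(1) splitting_star_iff by blast
  note Or = splitsD[OF Or']
  obtain G where G: "ultra G" "eventually (\<lambda>i. i \<in> \<sigma>) G" "\<And>i. eventually (\<lambda>j. j \<noteq> i) G"
    using infinite_ultra[OF \<sigma>(2)] by blast
  have evE: "eventually (\<lambda>i. i \<in> E) G"
    using G(2) by eventually_elim (use Or(1) in blast)
  obtain z where z: "z \<in> E" "\<And>p. p \<in> P \<Longrightarrow> eventually (\<lambda>i. \<phi> i p = \<phi> z p) G"
    using limit[OF G(1) evE] by blast
  have zy: "z \<sqsubseteq> \<ominus> y" if y: "y \<in> \<sigma>" for y
  proof (rule limit_le[OF G(1) evE z])
    show "\<ominus> y \<in> E" using y Or(1) by auto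
    show "eventually (\<lambda>i. i \<sqsubseteq> \<ominus> y) G"
      using G(2) G(3)[of y] by eventually_elim (use Or(6) y in blast)
  qed
  have "z \<sqsubseteq> \<ominus> z"
  proof (rule limit_le[OF G(1) evE z fl_in[OF z(1)]])
    show "eventually (\<lambda>i. i \<sqsubseteq> \<ominus> z) G"
      using G(2) by eventually_elim (use zy Or(1) z(1) le_fl in blast)
  qed
  \<comment> \<open>Otherwise some \<open>y\<close> in the star is the inverse of \<open>z\<close>,
    and all other elements lie below \<open>z\<close> and equal it, so the star has at most two
    elements.\<close>
  have "z \<in> Or"
  proof (rule ccontr)
    assume "z \<notin> Or"
    then obtain y where y: "y \<in> \<sigma>" "\<ominus> z \<sqsubseteq> y" using Or(5,8) z(1) by blast
    have yE: "y \<in> E" using y Or(1) by blast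
    have "y \<sqsubseteq> \<ominus> z" using le_fl[OF zy[OF y(1)]] z(1) yE by blast
    then have "y = \<ominus> z" using le_antisym y(2) yE z(1) by simp
    then have all: "i = z" if "i \<in> \<sigma>" "i \<noteq> y" for i
      using Or(6)[OF that(1) y(1) that(2)] small_minimal[OF \<open>z \<sqsubseteq> \<ominus> z\<close>] that(1) Or(1) z(1) by auto
    have "eventually (\<lambda>i. False) G"
      using G(2) G(3)[of y] G(3)[of z] by eventually_elim (use all in blast)
    then show False using ultra_ex[OF G(1)] by blast
  qed
  then obtain y where y: "y \<in> \<sigma>" "z \<sqsubseteq> y" using Or(5) by blast
  have yE: "y \<in> E" using y Or(1) by blast
  have "z = y"
    using nontriv[OF y(2) zy[OF y(1)] z(1) yE] \<open>z \<in> Or\<close> y(1) Or(2,7) by blast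
  then show ?thesis using y(1) \<open>z \<sqsubseteq> \<ominus> z\<close> by (auto simp: regular_def small_def)
qed

section \<open>Finiteness of the branching points between regular separations\<close>

text \<open>Let \<open>d\<close> be the element of the star above the inverse of \<open>y\<close>;
  any third element \<open>c\<close> will do. Every \<open>b'\<close> between \<open>b\<close> and
  \<open>y\<close> leads to the same \<open>d\<close>, so its inverse lies below \<open>d\<close>,
  and \<open>c\<close> lies below the inverse of \<open>d\<close>.\<close>

lemma branching_third_point:
  assumes "b \<in> branching_points T" "b \<noteq> y" "b \<sqsubseteq> y" "y \<in> E"
  shows "\<exists>c\<in>E. c \<sqsubseteq> \<ominus> b \<and> (\<forall>b'\<in>E. b \<sqsubseteq> b' \<and> b \<noteq> b' \<and> b' \<sqsubseteq> y \<longrightarrow> c \<sqsubseteq> b')"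
proof -
  obtain \<sigma> where \<sigma>: "splitting_star T \<sigma>" "infinite \<sigma> \<or> 3 \<le> card \<sigma>" "b \<in> \<sigma>"
    using assms(1) by (auto simp: branching_points_def branching_star_def)
  obtain Or where Or': "splits Or \<sigma>" using \<sigma>(1) splitting_star_iff by blast
  note Or = splitsD[OF Or']
  have flip_in: "\<ominus> u \<in> Or" if "u \<in> E" "b \<sqsubseteq> u" "b \<noteq> u" for u
    using that Or(4,8) \<sigma>(3) by blast
  then obtain d where d: "d \<in> \<sigma>" "\<ominus> y \<sqsubseteq> d" using Or(5) assms by blast
  have "\<exists>c\<in>\<sigma>. c \<noteq> b \<and> c \<noteq> d"
  proof (rule ccontr)
    assume "\<not> ?thesis"
    then have sub: "\<sigma> \<subseteq> {b, d}" by blast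
    then have "card \<sigma> \<le> card {b, d}" by (intro card_mono) auto
    also have "card {b, d} \<le> 2" by (simp add: card_insert_if)
    finally show False using \<sigma>(2) finite_subset[OF sub] by simp
  qed
  then obtain c where c: "c \<in> \<sigma>" "c \<noteq> b" "c \<noteq> d" by blast
  have E: "b \<in> E" "c \<in> E" "d \<in> E" using \<sigma>(3) c d Or(1) by auto
  have "c \<sqsubseteq> b'" if b': "b' \<in> E" "b \<sqsubseteq> b'" "b \<noteq> b'" "b' \<sqsubseteq> y" for b'
  proof -
    obtain e where e: "e \<in> \<sigma>" "\<ominus> b' \<sqsubseteq> e" using Or(5) flip_in[OF b'(1-3)] by blast
    have eE: "e \<in> E" using e Or(1) by blast
    have ye: "\<ominus> y \<sqsubseteq> e"
      using le_trans[of "\<ominus> y" "\<ominus> b'" e] e b' assms(4) eE by simp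
    \<comment> \<open>If \<open>d\<close> and \<open>e\<close> were distinct, the inverse of
      \<open>y\<close> would lie below both orientations of \<open>e\<close>.\<close>
    have "e = d"
    proof (rule ccontr)
      assume ne: "e \<noteq> d"
      have "\<ominus> y \<sqsubseteq> \<ominus> e"
        using le_trans[OF d(2) Or(6)[OF d(1) e(1)]] ne assms(4) E eE by simp
      then have "\<ominus> y = e \<or> \<ominus> y = \<ominus> e" using nontriv[OF ye] assms(4) eE by simp
      moreover have "\<ominus> y \<noteq> \<ominus> e"
        using flip_in[OF assms(4,3,2)] e(1) Or(2,7) by auto
      ultimately show False using Or(4)[of e d] d e(1) ne Or(2) by auto
    qed
    then have "\<ominus> d \<sqsubseteq> b'" using fl_le e(2) b'(1) E by blast
    then show ?thesis using le_trans[OF Or(6)[OF c(1) d(1) c(3)]] E b'(1) by simp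
  qed
  then show ?thesis using E(2) Or(6)[OF c(1) \<sigma>(3) c(2)] by blast
qed

text \<open>The conditions on the ends enter twice: they make the branching points in between a
  chain, and they keep a limit \<open>w\<close> of these points and its inverse from being small.
  The point \<open>y\<close> is removed so that every remaining \<open>b\<close> has something
  strictly above it.\<close>

lemma finite_branching_interval:
  assumes x: "x \<in> E" "\<not> x \<sqsubseteq> \<ominus> x" and y: "y \<in> E" "\<not> \<ominus> y \<sqsubseteq> y"
  shows "finite {b \<in> branching_points T. x \<sqsubseteq> b \<and> b \<sqsubseteq> y}"
proof (rule ccontr)
  define B where "B = {b \<in> branching_points T. x \<sqsubseteq> b \<and> b \<sqsubseteq> y} - {y}"
  assume "\<not> ?thesis"
  then have inf: "infinite B" by (simp add: B_def)
  have BE: "b \<in> E" if "b \<in> B" for b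
    using that by (auto simp: B_def branching_points_def branching_star_def splitting_star_def star_def)
  have Bxy: "x \<sqsubseteq> b" "b \<sqsubseteq> y" "b \<noteq> y" "b \<in> branching_points T" if "b \<in> B" for b
    using that by (auto simp: B_def)
  \<comment> \<open>If \<open>b\<close> were below the inverse of \<open>b'\<close>, then
    \<open>x\<close> would be below its own inverse; the other case is dual and concerns
    \<open>y\<close>.\<close>
  have total: "b \<sqsubseteq> b' \<or> b' \<sqsubseteq> b" if b: "b \<in> B" "b' \<in> B" for b b'
  proof -
    have "\<not> b \<sqsubseteq> \<ominus> b'"
    proof
      assume "b \<sqsubseteq> \<ominus> b'"
      then have "x \<sqsubseteq> \<ominus> b'" using le_trans Bxy(1)[OF b(1)] BE[OF b(1)] BE[OF b(2)] x(1) fl_in by blast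
      then have "b' \<sqsubseteq> \<ominus> x" using le_fl BE[OF b(2)] x(1) by blast
      then show False using le_trans Bxy(1)[OF b(2)] BE[OF b(2)] x fl_in by blast
    qed
    moreover have "\<not> \<ominus> b \<sqsubseteq> b'"
    proof
      assume "\<ominus> b \<sqsubseteq> b'"
      then have "\<ominus> b \<sqsubseteq> y" using le_trans Bxy(2)[OF b(2)] BE[OF b(1)] BE[OF b(2)] y(1) fl_in by blast
      then have "\<ominus> y \<sqsubseteq> b" using fl_le BE[OF b(1)] y(1) by blast
      then show False using le_trans Bxy(2)[OF b(1)] BE[OF b(1)] y fl_in by blast
    qed
    ultimately show ?thesis using nested_cases[OF BE[OF b(1)] BE[OF b(2)]] by blast
  qed
  have "\<forall>b\<in>B. \<exists>c\<in>E. c \<sqsubseteq> \<ominus> b \<and> (\<forall>b'\<in>E. b \<sqsubseteq> b' \<and> b \<noteq> b' \<and> b' \<sqsubseteq> y \<longrightarrow> c \<sqsubseteq> b')"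
    using branching_third_point Bxy y(1) by metis
  then obtain c where c: "\<And>b. b \<in> B \<Longrightarrow> c b \<in> E" "\<And>b. b \<in> B \<Longrightarrow> c b \<sqsubseteq> \<ominus> b"
    "\<And>b b'. b \<in> B \<Longrightarrow> b' \<in> B \<Longrightarrow> b \<sqsubseteq> b' \<Longrightarrow> b \<noteq> b' \<Longrightarrow> c b \<sqsubseteq> b'"
    using BE Bxy by metis
  obtain G where G: "ultra G" "eventually (\<lambda>i. i \<in> B) G" "\<And>i. eventually (\<lambda>j. j \<noteq> i) G"
    using infinite_ultra[OF inf] by blast
  have ev: "eventually (\<lambda>i. i \<in> E) G" "eventually (\<lambda>i. c i \<in> E) G"
    using G(2) by (eventually_elim, use BE c in blast)+
  obtain w where w: "w \<in> E" "\<And>p. p \<in> P \<Longrightarrow> eventually (\<lambda>i. \<phi> i p = \<phi> w p) G"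
    using limit[OF G(1) ev(1)] by blast
  obtain z where z: "z \<in> E" "\<And>p. p \<in> P \<Longrightarrow> eventually (\<lambda>i. \<phi> (c i) p = \<phi> z p) G"
    using limit[OF G(1) ev(2)] by blast
  have xw: "x \<sqsubseteq> w"
    by (rule le_limit[OF G(1) ev(1) w x(1)]) (use G(2) Bxy(1) in \<open>auto elim: eventually_mono\<close>)
  have wy: "w \<sqsubseteq> y"
    by (rule limit_le[OF G(1) ev(1) w y(1)]) (use G(2) Bxy(2) in \<open>auto elim: eventually_mono\<close>)
  \<comment> \<open>Two distinct branching points are chosen that both have the limiting coordinates
    at \<open>p\<close>. They are comparable, and the third point of the lower one lies below the
    upper one.\<close>
  have "z \<sqsubseteq> w"
    unfolding le_iff[OF z(1) w(1)]
  proof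
    fix p assume p: "p \<in> P"
    have *: "eventually (\<lambda>i. i \<in> B \<and> \<phi> i p = \<phi> w p \<and> \<phi> (c i) p = \<phi> z p) G"
      using G(2) w(2)[OF p] z(2)[OF p] by eventually_elim blast
    obtain b where b: "b \<in> B" "\<phi> b p = \<phi> w p" "\<phi> (c b) p = \<phi> z p"
      using ultra_ex[OF G(1) *] by blast
    obtain b' where b': "b' \<in> B" "\<phi> b' p = \<phi> w p" "\<phi> (c b') p = \<phi> z p" "b' \<noteq> b"
      using ultra_ex[OF G(1) eventually_conj[OF * G(3)[of b]]] by blast
    have "c b \<sqsubseteq> b' \<or> c b' \<sqsubseteq> b" using total[OF b(1) b'(1)] c(3) b b' by metis
    then show "leq (S p) (\<phi> z p) (\<phi> w p)"
      using le_iff c(1) BE b b' p by metis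
  qed
  moreover have "z \<sqsubseteq> \<ominus> w"
    unfolding le_iff[OF z(1) fl_in[OF w(1)]]
  proof
    fix p assume p: "p \<in> P"
    have *: "eventually (\<lambda>i. i \<in> B \<and> \<phi> i p = \<phi> w p \<and> \<phi> (c i) p = \<phi> z p) G"
      using G(2) w(2)[OF p] z(2)[OF p] by eventually_elim blast
    obtain b where b: "b \<in> B" "\<phi> b p = \<phi> w p" "\<phi> (c b) p = \<phi> z p"
      using ultra_ex[OF G(1) *] by blast
    have "\<phi> (\<ominus> b) p = \<phi> (\<ominus> w) p"
      using b(2) coord_flip[OF BE[OF b(1)] p] coord_flip[OF w(1) p] by simp
    then show "leq (S p) (\<phi> z p) (\<phi> (\<ominus> w) p)"
      using le_iff[OF c(1)[OF b(1)] fl_in[OF BE[OF b(1)]]] c(2)[OF b(1)] b(3) p by metis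
  qed
  \<comment> \<open>Being below both orientations of \<open>w\<close>, \<open>z\<close> is one of
    them. So \<open>w\<close> or its inverse is small, and extremality identifies \<open>w\<close>
    with \<open>x\<close> or with \<open>y\<close>.\<close>
  ultimately have "z = w \<or> z = \<ominus> w" using nontriv z(1) w(1) by blast
  then show False
  proof
    assume "z = w"
    then show False using small_minimal[of w x] \<open>z \<sqsubseteq> \<ominus> w\<close> xw x w(1) by auto
  next
    assume "z = \<ominus> w"
    then show False using cosmall_maximal[of w y] \<open>z \<sqsubseteq> w\<close> wy y w(1) by auto
  qed
qed

text \<open>Intervals between orientations of \<open>s\<close> and \<open>s'\<close> cover the set,
  and regularity means that no end is small or the inverse of a small separation.\<close>

lemma finite_branching_between:
  assumes "s \<in> unoriented T" "s' \<in> unoriented T" "regular T s" "regular T s'"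
  shows "finite (branching_between T s s')"
proof -
  let ?U = "s \<union> s'"
  have U: "finite ?U" and UE: "?U \<subseteq> E"
    using assms(1,2) by (auto simp: unoriented_def unor_def)
  have reg: "\<not> x \<sqsubseteq> \<ominus> x" "\<not> \<ominus> x \<sqsubseteq> x" if "x \<in> ?U" for x
  proof -
    have "\<ominus> x \<in> ?U" using that assms(1,2) by (auto simp: unoriented_def unor_def)
    then show "\<not> x \<sqsubseteq> \<ominus> x" "\<not> \<ominus> x \<sqsubseteq> x"
      using that assms(3,4) UE unfolding regular_def small_def by (metis Un_iff flfl subsetD)+
  qed
  have "branching_between T s s' \<subseteq> (\<Union>x\<in>?U. \<Union>y\<in>?U. {b \<in> branching_points T. x \<sqsubseteq> b \<and> b \<sqsubseteq> y})"
    by (auto simp: branching_between_def)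
  moreover have "finite \<dots>"
    using U UE reg by (intro finite_UN_I finite_branching_interval) blast+
  ultimately show ?thesis by (rule finite_subset)
qed

end

section \<open>The coordinates of an inverse limit\<close>

lemma profinite_necessary:
  fixes T :: "'a sep_sys"
  assumes "tree_set T" "profinite T"
  shows "chain_complete T \<and> splittable T \<and>
    \<not> (\<exists>\<sigma>. splitting_star T \<sigma> \<and> regular T \<sigma> \<and> infinite \<sigma>) \<and>
    (\<forall>s\<in>unoriented T. \<forall>s'\<in>unoriented T.
       regular T s \<and> regular T s' \<longrightarrow> finite (branching_between T s s'))"
proof -
  interpret tree T using assms(1) by (rule tree.intro)
  obtain P :: "('a \<times> 'a) set set" and le' and S :: "('a \<times> 'a) set \<Rightarrow> nat sep_sys" and f \<phi>
    where sys: "finite_inverse_system P le' S f"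
    and iso: "sep_iso \<phi> T (inverse_limit P le' S f)"
    using assms(2) unfolding profinite_def by blast
  define L where "L = inverse_limit P le' S f"
  have bij: "bij_betw \<phi> E (seps L)" and hom: "sep_hom \<phi> T L"
    and hom': "sep_hom (inv_into E \<phi>) L T"
    using iso unfolding sep_iso_def L_def by auto
  have phiL: "\<phi> x \<in> seps L" if "x \<in> E" for x
    using bij that by (auto simp: bij_betw_def)
  have phiS: "\<phi> x p \<in> seps (S p)" if "x \<in> E" "p \<in> P" for x p
    using phiL[OF that(1)] that(2) unfolding L_def inverse_limit_def by (auto simp: PiE_def)
  have leT: "x \<sqsubseteq> y \<longleftrightarrow> (\<forall>p\<in>P. leq (S p) (\<phi> x p) (\<phi> y p))" if "x \<in> E" "y \<in> E" for x y
  proof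
    assume "x \<sqsubseteq> y"
    then have "leq L (\<phi> x) (\<phi> y)" using hom that unfolding sep_hom_def by auto
    then show "\<forall>p\<in>P. leq (S p) (\<phi> x p) (\<phi> y p)" by (simp add: L_def inverse_limit_def)
  next
    assume "\<forall>p\<in>P. leq (S p) (\<phi> x p) (\<phi> y p)"
    then have "leq L (\<phi> x) (\<phi> y)" by (simp add: L_def inverse_limit_def)
    then have "inv_into E \<phi> (\<phi> x) \<sqsubseteq> inv_into E \<phi> (\<phi> y)"
      using hom' phiL that unfolding sep_hom_def by auto
    then show "x \<sqsubseteq> y" using bij that by (simp add: bij_betw_def)
  qed
  interpret profinite_tree T P S \<phi>
  proof
    show "x \<sqsubseteq> y \<longleftrightarrow> (\<forall>p\<in>P. leq (S p) (\<phi> x p) (\<phi> y p))" if "x \<in> E" "y \<in> E" for x y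
      by (rule leT[OF that])
    show "\<phi> (\<ominus> x) p = flip (S p) (\<phi> x p)" if "x \<in> E" "p \<in> P" for x p
    proof -
      have "\<phi> (\<ominus> x) = flip L (\<phi> x)" using hom that(1) unfolding sep_hom_def by auto
      then show ?thesis using that(2) by (simp add: L_def inverse_limit_def)
    qed
    fix G :: "'a filter" and h assume G: "ultra G" and hE: "eventually (\<lambda>i. h i \<in> E) G"
    \<comment> \<open>The ultrafilter selects one value in each finite coordinate. The values are
      compatible because every \<open>\<phi> (h i)\<close> is, so they form a point of the inverse
      limit.\<close>
    have "\<exists>v\<in>seps (S p). eventually (\<lambda>i. \<phi> (h i) p = v) G" if p: "p \<in> P" for p
    proof (rule ultra_finite_range[OF G])
      show "finite (seps (S p))" using sys p unfolding finite_inverse_system_def by blast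
      show "eventually (\<lambda>i. \<phi> (h i) p \<in> seps (S p)) G"
        using hE by eventually_elim (rule phiS[OF _ p])
    qed
    then obtain v where v: "\<And>p. p \<in> P \<Longrightarrow> v p \<in> seps (S p)"
      "\<And>p. p \<in> P \<Longrightarrow> eventually (\<lambda>i. \<phi> (h i) p = v p) G" by metis
    have "f q p (v q) = v p" if "p \<in> P" "q \<in> P" "le' p q" for p q
    proof -
      have "eventually (\<lambda>i. f q p (v q) = v p) G"
        using hE v(2)[OF that(1)] v(2)[OF that(2)]
      proof eventually_elim
        case (elim i)
        have "f q p (\<phi> (h i) q) = \<phi> (h i) p"
          using phiL[OF elim(1)] that by (auto simp: L_def inverse_limit_def)
        then show ?case using elim by simp
      qed
      then show ?thesis using ultra_ex[OF G] by blast
    qed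
    then have "restrict v P \<in> seps L"
      using v(1) by (auto simp: L_def inverse_limit_def)
    then obtain z where "z \<in> E" "\<phi> z = restrict v P"
      using bij unfolding bij_betw_def by (metis imageE)
    then show "\<exists>z\<in>E. \<forall>p\<in>P. eventually (\<lambda>i. \<phi> (h i) p = \<phi> z p) G"
      using v(2) by (intro bexI[of _ z]) simp_all
  qed
  show ?thesis
    using chain_complete splittable infinite_splitting_star_small finite_branching_between by blast
qed


section \<open>Sufficiency of the combinatorial conditions\<close>

locale splittable_tree = tree +
  assumes cc: "chain_complete T" and spl: "splittable T"
    and star_small: "\<And>\<sigma>. splitting_star T \<sigma> \<Longrightarrow> infinite \<sigma> \<Longrightarrow> \<exists>s\<in>\<sigma>. s \<sqsubseteq> \<ominus> s"
    and finite_between: "\<And>s s'. s \<in> unoriented T \<Longrightarrow> s' \<in> unoriented T \<Longrightarrow>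
      regular T s \<Longrightarrow> regular T s' \<Longrightarrow> finite (branching_between T s s')"
begin

definition limit_point where
  "limit_point e \<longleftrightarrow> (\<exists>X. X \<subseteq> E \<and> X \<noteq> {} \<and> Complete_Partial_Order.chain (leq T) X \<and>
     e \<notin> X \<and> is_supremum T X e)"

text \<open>The elements of an infinite splitting star have to converge to one of its small elements;
  if there are several of these, any choice gives a profinite topology.\<close>

definition star_limit where
  "star_limit \<sigma> = (SOME s. s \<in> \<sigma> \<and> s \<sqsubseteq> \<ominus> s)"

definition accumulated where
  "accumulated = {a \<in> E. a \<sqsubseteq> \<ominus> a \<and>
     (limit_point (\<ominus> a) \<or> (\<exists>\<sigma>. splitting_star T \<sigma> \<and> infinite \<sigma> \<and> a = star_limit \<sigma>))}"

text \<open>The up-set of \<open>b\<close> can be clopen only if \<open>b\<close> is not a limit of separations that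
  are not above it. Such limits are suprema of chains from below and, on account of infinite stars
  and of unbounded chains with small inverse, the accumulated separations and their inverses.\<close>

definition J where
  "J = {b \<in> E. \<not> limit_point b \<and> b \<notin> accumulated \<and> \<ominus> b \<notin> accumulated}"

lemma star_limit:
  assumes "splitting_star T \<sigma>" "infinite \<sigma>"
  shows "star_limit \<sigma> \<in> \<sigma>" "star_limit \<sigma> \<sqsubseteq> \<ominus> star_limit \<sigma>"
  using someI_ex[of "\<lambda>s. s \<in> \<sigma> \<and> s \<sqsubseteq> \<ominus> s"] star_small[OF assms]
  unfolding star_limit_def by blast+

lemma accumulatedD: "a \<in> accumulated \<Longrightarrow> a \<in> E \<and> a \<sqsubseteq> \<ominus> a"
  by (simp add: accumulated_def)

lemma JE: "b \<in> J \<Longrightarrow> b \<in> E"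
  by (simp add: J_def)

lemma limit_point_below:
  assumes "limit_point e"
  shows "\<exists>x\<in>E. x \<sqsubseteq> e \<and> x \<noteq> e"
  using assms unfolding limit_point_def is_supremum_def by blast

section \<open>Splitting stars, limits of chains and members of \<open>J\<close>\<close>

text \<open>A chain with supremum \<open>\<ominus> c\<close> that avoids \<open>\<ominus> c\<close>
  stays in the orientation of the star. It lies below a single element \<open>m\<close> of the star,
  so \<open>\<ominus> c\<close> is below \<open>m\<close>. This forces \<open>m = c\<close> and puts
  \<open>a\<close> below \<open>c\<close>, against maximality of \<open>a\<close>.\<close>

lemma star_not_limit_point:
  assumes \<sigma>: "splitting_star T \<sigma>" and ac: "a \<in> \<sigma>" "c \<in> \<sigma>" "a \<noteq> c"
  shows "\<not> limit_point (\<ominus> c)"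
proof
  assume "limit_point (\<ominus> c)"
  then obtain X where XE: "X \<subseteq> E" and X: "X \<noteq> {}" "Complete_Partial_Order.chain (leq T) X"
    "\<ominus> c \<notin> X" "is_supremum T X (\<ominus> c)"
    unfolding limit_point_def by blast
  have sup: "x \<sqsubseteq> \<ominus> c" if "x \<in> X" for x
    using X(4) that by (simp add: is_supremum_def)
  have lub: "\<ominus> c \<sqsubseteq> v" if "v \<in> E" "\<And>x. x \<in> X \<Longrightarrow> x \<sqsubseteq> v" for v
    using X(4) that by (simp add: is_supremum_def)
  obtain Or where Or': "splits Or \<sigma>" using \<sigma> splitting_star_iff by blast
  note Or = splitsD[OF Or']
  have cE: "c \<in> E" and aE: "a \<in> E" using ac Or(1) by auto
  have XO: "x \<in> Or" if x: "x \<in> X" for x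
  proof (rule ccontr)
    have xE: "x \<in> E" using x XE by blast
    assume "x \<notin> Or"
    then have "\<ominus> x = c"
      using Or(4)[OF ac(2)] Or(8)[OF xE] le_fl[OF sup[OF x] xE cE] by blast
    then show False using x X(3) xE by auto
  qed
  obtain x m where x: "x \<in> X" and m: "m \<in> \<sigma>" "x \<sqsubseteq> m" using X(1) XO Or(5) by blast
  have xE: "x \<in> E" and mE: "m \<in> E" using x m XE Or(1) by auto
  have "y \<sqsubseteq> m" if y: "y \<in> X" for y
  proof (cases "y \<sqsubseteq> x")
    case True
    then show ?thesis using le_trans m(2) xE mE y XE by blast
  next
    case False
    then have xy: "x \<sqsubseteq> y" using chain_total[OF X(2) x y] by blast
    obtain n where n: "n \<in> \<sigma>" "y \<sqsubseteq> n" using XO[OF y] Or(5) by blast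
    have E: "y \<in> E" "n \<in> E" using y n XE Or(1) by auto
    have xn: "x \<sqsubseteq> n" using le_trans[OF xy n(2)] xE E by simp
    \<comment> \<open>Distinct elements of the star would put \<open>x\<close> below both
      orientations of \<open>m\<close>, so that \<open>x = m\<close> and \<open>m\<close> lies below
      \<open>n\<close>.\<close>
    have "n = m"
    proof (rule ccontr)
      assume nm: "n \<noteq> m"
      have "x \<sqsubseteq> \<ominus> m" using le_trans[OF xn Or(6)[OF n(1) m(1) nm]] xE mE E by simp
      then have "x = m \<or> x = \<ominus> m" using nontriv m(2) xE mE by blast
      moreover have "x \<noteq> \<ominus> m" using Or(7) XO[OF x] m(1) Or(2) by blast
      ultimately have "m \<sqsubseteq> n" using xn by simp
      then show False using Or(4)[OF m(1)] n(1) Or(2) nm by blast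
    qed
    then show ?thesis using n by simp
  qed
  then have cm: "\<ominus> c \<sqsubseteq> m" using lub mE by blast
  have "m = c"
  proof (rule ccontr)
    assume "m \<noteq> c"
    then have "m = \<ominus> c" using le_antisym[OF Or(6)[OF m(1) ac(2)] cm] mE cE by simp
    then show False using Or(7)[of c] ac(2) m(1) Or(2) by blast
  qed
  then have "a \<sqsubseteq> c" using le_trans[OF Or(6)[OF ac] cm] aE cE by simp
  then show False using Or(4)[OF ac(1)] ac Or(2) by blast
qed

text \<open>Splittability is combined with the fact that the two points of the star are not limits
  from the side of the gap.\<close>

lemma split_between:
  assumes "x \<in> E" "y \<in> E" "x \<sqsubseteq> y" "x \<noteq> y" "x \<noteq> \<ominus> y"
  obtains a b \<sigma> where "a \<in> E" "b \<in> E" "x \<sqsubseteq> a" "a \<sqsubseteq> b" "b \<sqsubseteq> y" "a \<noteq> b" "a \<noteq> \<ominus> b"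
    "splitting_star T \<sigma>" "a \<in> \<sigma>" "\<ominus> b \<in> \<sigma>" "\<not> limit_point b" "\<not> limit_point (\<ominus> a)"
proof -
  have "lneqq T x y" using assms lneqq_iff by blast
  then obtain a b \<sigma> where ab: "a \<in> E" "b \<in> E" "x \<sqsubseteq> a" "lneqq T a b" "b \<sqsubseteq> y"
    "splitting_star T \<sigma>" "a \<in> \<sigma>" "\<ominus> b \<in> \<sigma>"
    using spl assms(1,2) unfolding splittable_def by metis
  then have ab': "a \<sqsubseteq> b" "a \<noteq> b" "a \<noteq> \<ominus> b" using lneqq_iff by blast+
  have "\<not> limit_point b"
    using star_not_limit_point[OF ab(6,7,8) ab'(3)] ab(2) by simp
  moreover have "\<not> limit_point (\<ominus> a)"
    using star_not_limit_point[OF ab(6,8,7)] ab'(3) by metis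
  ultimately show ?thesis using that ab ab' by metis
qed

text \<open>The element \<open>b\<close> is not accumulated, as \<open>a\<close> is strictly below
  it. If its inverse is accumulated, then this is due to an infinite star, which by uniqueness is
  \<open>\<sigma>\<close>.\<close>

lemma split_upper:
  assumes ab: "a \<in> E" "b \<in> E" "a \<sqsubseteq> b" "a \<noteq> b" "\<not> limit_point b"
    and \<sigma>: "splitting_star T \<sigma>" "\<ominus> b \<in> \<sigma>"
  shows "b \<in> J \<or> \<ominus> b = star_limit \<sigma> \<and> \<ominus> b \<sqsubseteq> b"
proof -
  have "b \<notin> accumulated"
    using accumulatedD[of b] small_minimal[of b a] ab by blast
  moreover have "\<ominus> b = star_limit \<sigma> \<and> \<ominus> b \<sqsubseteq> b" if b: "\<ominus> b \<in> accumulated"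
  proof -
    have sm: "\<ominus> b \<sqsubseteq> b" using accumulatedD[OF b] ab by simp
    obtain \<sigma>' where \<sigma>': "splitting_star T \<sigma>'" "infinite \<sigma>'" "\<ominus> b = star_limit \<sigma>'"
      using b ab unfolding accumulated_def by auto
    then have "\<ominus> b \<in> \<sigma>'" using star_limit by simp
    then have "\<sigma>' = \<sigma>" using splitting_star_unique \<sigma>'(1) \<sigma> by blast
    then show ?thesis using \<sigma>'(3) sm by simp
  qed
  ultimately show ?thesis using ab by (auto simp: J_def)
qed

text \<open>This is the way out when \<open>b\<close> is not in \<open>J\<close>: each star has only
  one chosen limit, and here it is the inverse of \<open>b\<close>, so \<open>a\<close> is not
  accumulated. The inverse of \<open>a\<close> is not small because \<open>b\<close> is strictly
  above \<open>a\<close>.\<close>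

lemma split_lower_accumulated:
  assumes ab: "a \<in> E" "b \<in> E" "a \<sqsubseteq> b" "a \<noteq> b" "a \<noteq> \<ominus> b" "\<not> limit_point (\<ominus> a)"
    and \<sigma>: "splitting_star T \<sigma>" "a \<in> \<sigma>" "\<ominus> b = star_limit \<sigma>"
  shows "a \<notin> accumulated" "\<ominus> a \<notin> accumulated"
proof -
  show "a \<notin> accumulated"
  proof
    assume "a \<in> accumulated"
    then obtain \<sigma>' where \<sigma>': "splitting_star T \<sigma>'" "infinite \<sigma>'" "a = star_limit \<sigma>'"
      using ab(6) unfolding accumulated_def by blast
    then have "a \<in> \<sigma>'" using star_limit by simp
    then have "\<sigma>' = \<sigma>" using splitting_star_unique \<sigma>'(1) \<sigma>(1,2) by blast
    then show False using \<sigma>' \<sigma>(3) ab(5) by simp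
  qed
  show "\<ominus> a \<notin> accumulated"
    using accumulatedD[of "\<ominus> a"] cosmall_maximal[of a b] ab by auto
qed

text \<open>The exceptional case of \<open>split_upper\<close> cannot occur: if the inverse of
  \<open>b\<close> were small, then \<open>b\<close> would be maximal and equal to
  \<open>y\<close>.\<close>

lemma J_below:
  assumes xy: "x \<in> E" "y \<in> E" "x \<sqsubseteq> y" "x \<noteq> y" and y: "\<not> \<ominus> y \<sqsubseteq> y"
  obtains a b where "a \<in> E" "b \<in> J" "x \<sqsubseteq> a" "a \<sqsubseteq> b" "a \<noteq> b" "b \<sqsubseteq> y"
proof -
  have "x \<noteq> \<ominus> y" using xy y by auto
  then obtain a b \<sigma> where ab: "a \<in> E" "b \<in> E" "x \<sqsubseteq> a" "a \<sqsubseteq> b" "b \<sqsubseteq> y" "a \<noteq> b"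
    "splitting_star T \<sigma>" "\<ominus> b \<in> \<sigma>" "\<not> limit_point b"
    using split_between[OF xy] by metis
  have "\<not> \<ominus> b \<sqsubseteq> b" using cosmall_maximal[of b y] ab xy y by blast
  then have "b \<in> J" using split_upper[OF ab(1,2,4,6,9,7,8)] by blast
  then show ?thesis using that ab by blast
qed

lemma regular_in_J_if_minimal:
  assumes "r \<in> E" "\<And>x. x \<in> E \<Longrightarrow> x \<sqsubseteq> r \<Longrightarrow> x = r" "r \<notin> accumulated" "\<not> \<ominus> r \<sqsubseteq> r"
  shows "r \<in> J"
  using assms limit_point_below[of r] accumulatedD[of "\<ominus> r"] by (auto simp: J_def)

section \<open>Separating the points by members of \<open>J\<close>\<close>

text \<open>A splitting pair \<open>a\<close>, \<open>b\<close> between \<open>s\<close> and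
  \<open>r\<close> separates them: \<open>b\<close> does so if it is in \<open>J\<close>, and
  otherwise the inverse of \<open>a\<close>.\<close>

lemma separate_comparable:
  assumes rs: "r \<in> E" "s \<in> E" "s \<sqsubseteq> r" "s \<noteq> r" "s \<noteq> \<ominus> r"
  shows "\<exists>b\<in>J. (b \<sqsubseteq> r \<and> \<not> b \<sqsubseteq> s) \<or> (b \<sqsubseteq> \<ominus> s \<and> \<not> b \<sqsubseteq> \<ominus> r)"
proof -
  obtain a b \<sigma> where ab: "a \<in> E" "b \<in> E" "s \<sqsubseteq> a" "a \<sqsubseteq> b" "b \<sqsubseteq> r" "a \<noteq> b" "a \<noteq> \<ominus> b"
    "splitting_star T \<sigma>" "a \<in> \<sigma>" "\<ominus> b \<in> \<sigma>" "\<not> limit_point b" "\<not> limit_point (\<ominus> a)"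
    using split_between[OF rs(2,1,3,4,5)] by metis
  have nba: "\<not> b \<sqsubseteq> a" using le_antisym ab by blast
  show ?thesis
  proof (cases "b \<in> J")
    case True
    have "\<not> b \<sqsubseteq> s" using nba le_trans[of b s a] ab rs by blast
    then show ?thesis using True ab by blast
  next
    case False
    then have "\<ominus> b = star_limit \<sigma>" using split_upper[OF ab(1,2,4,6,11,8,10)] by blast
    then have "\<ominus> a \<in> J"
      using split_lower_accumulated[OF ab(1,2,4,6,7,12,8,9)] ab by (simp add: J_def)
    moreover have "\<ominus> a \<sqsubseteq> \<ominus> s" using ab rs by simp
    moreover have "\<not> \<ominus> a \<sqsubseteq> \<ominus> r" using nba le_trans[of b r a] ab rs by auto
    ultimately show ?thesis by blast
  qed
qed

text \<open>A member of \<open>J\<close> below \<open>r\<close> cannot lie below \<open>s\<close>,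
  which is below the inverse of \<open>r\<close>. The remaining case is that \<open>r\<close> is
  accumulated; then a member of \<open>J\<close> between \<open>r\<close> and the inverse of
  \<open>s\<close> is used.\<close>

lemma separate_disjoint:
  assumes rs: "r \<in> E" "s \<in> E" "r \<sqsubseteq> \<ominus> s" "r \<noteq> \<ominus> s" "\<not> r \<sqsubseteq> s"
  shows "\<exists>b\<in>J. (b \<sqsubseteq> r \<and> \<not> b \<sqsubseteq> s) \<or> (b \<sqsubseteq> \<ominus> s \<and> \<not> b \<sqsubseteq> \<ominus> r)"
proof -
  have ncs: "\<not> \<ominus> r \<sqsubseteq> r" using cosmall_maximal[of r "\<ominus> s"] rs by auto
  have neq: "r \<noteq> s" using rs by auto
  consider x where "x \<in> E" "x \<sqsubseteq> r" "x \<noteq> r" | "r \<in> J"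
    | "r \<in> accumulated"
    using regular_in_J_if_minimal[OF rs(1) _ _ ncs] by blast
  then show ?thesis
  proof cases
    case 1
    then obtain b where b: "b \<in> J" "b \<sqsubseteq> r" using J_below[OF _ rs(1) _ _ ncs] by metis
    have bE: "b \<in> E" using b JE by blast
    have "\<not> b \<sqsubseteq> s"
    proof
      assume bs: "b \<sqsubseteq> s"
      have "b \<sqsubseteq> \<ominus> r" using le_trans[OF bs le_fl[OF rs(3,1,2)]] bE rs by simp
      then have "b = r \<or> b = \<ominus> r" using nontriv[OF b(2)] bE rs by blast
      then show False using bs b(2) rs(5) ncs by auto
    qed
    then show ?thesis using b by blast
  next
    case 2
    then show ?thesis using rs by auto
  next
    case 3
    have sm: "r \<sqsubseteq> \<ominus> r" using accumulatedD[OF 3] by blast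
    obtain a b \<sigma> where ab: "a \<in> E" "b \<in> E" "r \<sqsubseteq> a" "a \<sqsubseteq> b" "b \<sqsubseteq> \<ominus> s" "a \<noteq> b" "a \<noteq> \<ominus> b"
      "splitting_star T \<sigma>" "a \<in> \<sigma>" "\<ominus> b \<in> \<sigma>" "\<not> limit_point b" "\<not> limit_point (\<ominus> a)"
      using split_between[of r "\<ominus> s"] rs neq by (metis fl_in flfl)
    \<comment> \<open>Between \<open>r\<close> and its inverse there are only these two, and nothing
      lies strictly above the inverse of the small \<open>r\<close>.\<close>
    have not_below: "\<not> w \<sqsubseteq> \<ominus> r"
      if "u \<in> E" "w \<in> E" "r \<sqsubseteq> u" "u \<sqsubseteq> w" "u \<noteq> w" "w \<sqsubseteq> \<ominus> s" for u w
    proof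
      assume w: "w \<sqsubseteq> \<ominus> r"
      have rw: "r \<sqsubseteq> w" using le_trans that rs by blast
      have "w \<noteq> r" using le_antisym that rs by blast
      then have "w = \<ominus> r" using between_small[OF rw w] rs that by blast
      then have "\<ominus> s = \<ominus> r"
        using cosmall_maximal[of "\<ominus> r" "\<ominus> s"] sm that rs by simp
      then show False using neq rs by simp
    qed
    show ?thesis
    proof (cases "b \<in> J")
      case True
      then show ?thesis using not_below[OF ab(1-4,6,5)] ab by blast
    next
      case False
      then have b: "\<ominus> b = star_limit \<sigma>"
        using split_upper[OF ab(1,2,4,6,11,8,10)] by blast
      note na = split_lower_accumulated[OF ab(1,2,4,6,7,12,8,9) b]
      \<comment> \<open>When \<open>b\<close> is exceptional, \<open>a\<close> is not accumulated
        while \<open>r\<close> is, so there is room between \<open>r\<close> and \<open>a\<close>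
        for a member of \<open>J\<close>.\<close>
      have ra: "r \<noteq> a" using na 3 by blast
      have nca: "\<not> \<ominus> a \<sqsubseteq> a" using cosmall_maximal[of a b] ab by blast
      obtain a' b' where b': "a' \<in> E" "b' \<in> J" "r \<sqsubseteq> a'" "a' \<sqsubseteq> b'" "a' \<noteq> b'" "b' \<sqsubseteq> a"
        using J_below[OF rs(1) ab(1,3) ra nca] by metis
      have "b' \<sqsubseteq> b" using le_trans[OF b'(6) ab(4)] b' JE ab by blast
      then have "b' \<sqsubseteq> \<ominus> s" using le_trans[OF _ ab(5)] b' JE ab rs by simp
      then show ?thesis using not_below[OF b'(1) JE[OF b'(2)] b'(3-5)] b' by blast
    qed
  qed
qed

text \<open>Any member of \<open>J\<close> below the inverse of \<open>s\<close> with something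
  strictly below it works, since \<open>s\<close> is minimal. Without further separations below the
  inverse of \<open>s\<close>, the tree set consists of \<open>s\<close> and its inverse, and the
  latter is in \<open>J\<close>.\<close>

lemma separate_small:
  assumes s: "s \<in> E" "s \<sqsubseteq> \<ominus> s"
  shows "\<exists>b\<in>J. b \<sqsubseteq> \<ominus> s \<and> \<not> b \<sqsubseteq> s"
proof (cases "\<exists>y\<in>E. y \<sqsubseteq> \<ominus> s \<and> y \<noteq> \<ominus> s \<and> y \<noteq> s")
  case True
  then obtain y where y: "y \<in> E" "y \<sqsubseteq> \<ominus> s" "y \<noteq> \<ominus> s" "y \<noteq> s" by blast
  obtain a b \<sigma> where ab: "a \<in> E" "b \<in> E" "y \<sqsubseteq> a" "a \<sqsubseteq> b" "b \<sqsubseteq> \<ominus> s" "a \<noteq> b" "a \<noteq> \<ominus> b"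
    "splitting_star T \<sigma>" "a \<in> \<sigma>" "\<ominus> b \<in> \<sigma>" "\<not> limit_point b" "\<not> limit_point (\<ominus> a)"
    using split_between[of y "\<ominus> s"] s y by (metis fl_in flfl)
  have not_below: "\<not> w \<sqsubseteq> s" if "u \<in> E" "w \<in> E" "u \<sqsubseteq> w" "u \<noteq> w" for u w
    using small_minimal[OF s(2) _ _ s(1)] that by metis
  show ?thesis
  proof (cases "b \<in> J")
    case True
    then show ?thesis using not_below[OF ab(1,2,4,6)] ab by blast
  next
    case False
    then have b: "\<ominus> b = star_limit \<sigma>" "\<ominus> b \<sqsubseteq> b"
      using split_upper[OF ab(1,2,4,6,11,8,10)] by blast+
    \<comment> \<open>With \<open>b\<close> exceptional, \<open>a\<close> separates if it is in
      \<open>J\<close>. Otherwise \<open>a\<close> is a limit of a chain and has a member of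
      \<open>J\<close> below it.\<close>
    have "b = \<ominus> s" using cosmall_maximal[OF b(2) ab(5)] ab s by simp
    then have as: "a \<noteq> s" using ab s by simp
    have asup: "a \<sqsubseteq> \<ominus> s" using le_trans[OF ab(4,5)] ab s by simp
    note na = split_lower_accumulated[OF ab(1,2,4,6,7,12,8,9) b(1)]
    show ?thesis
    proof (cases "limit_point a")
      case False
      then have "a \<in> J" using na ab by (simp add: J_def)
      moreover have "\<not> a \<sqsubseteq> s" using small_minimal[OF s(2) _ ab(1) s(1)] as by blast
      ultimately show ?thesis using asup by blast
    next
      case True
      then obtain x where x: "x \<in> E" "x \<sqsubseteq> a" "x \<noteq> a" using limit_point_below by blast
      have nca: "\<not> \<ominus> a \<sqsubseteq> a" using cosmall_maximal[of a b] ab by blast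
      obtain a' b' where b': "a' \<in> E" "b' \<in> J" "a' \<sqsubseteq> b'" "a' \<noteq> b'" "b' \<sqsubseteq> a"
        using J_below[OF x(1) ab(1) x(2,3) nca] by metis
      have "b' \<sqsubseteq> \<ominus> s" using le_trans[OF b'(5) asup] b' JE ab s by simp
      then show ?thesis using not_below[OF b'(1) JE[OF b'(2)] b'(3,4)] b' by blast
    qed
  qed
next
  case False
  then have two: "y = s \<or> y = \<ominus> s" if "y \<in> E" "y \<sqsubseteq> \<ominus> s" for y using that by blast
  have E2: "y = s \<or> y = \<ominus> s" if y: "y \<in> E" for y
    using nested_cases[OF y s(1)] two[OF y] two[of "\<ominus> y"] small_minimal[OF s(2), of y]
      small_minimal[OF s(2), of "\<ominus> y"] y s by auto
  have nle: "\<not> \<ominus> s \<sqsubseteq> s" using le_antisym[OF s(2)] s by auto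
  have "\<not> limit_point (\<ominus> s)"
  proof
    assume "limit_point (\<ominus> s)"
    then obtain X where X: "X \<subseteq> E" "\<ominus> s \<notin> X" "is_supremum T X (\<ominus> s)"
      unfolding limit_point_def by blast
    have "x \<sqsubseteq> s" if x: "x \<in> X" for x
    proof -
      have "x \<in> E" "x \<noteq> \<ominus> s" using x X(1,2) by blast+
      then show ?thesis using E2[of x] s(1) by simp
    qed
    then show False using X(3) s(1) nle unfolding is_supremum_def by blast
  qed
  moreover have "\<ominus> s \<notin> accumulated" using accumulatedD[of "\<ominus> s"] nle s by auto
  moreover have "s \<notin> accumulated"
  proof
    assume "s \<in> accumulated"
    then obtain \<sigma> where \<sigma>: "splitting_star T \<sigma>" "infinite \<sigma>"
      using \<open>\<not> limit_point (\<ominus> s)\<close> unfolding accumulated_def by blast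
    have "\<sigma> \<subseteq> {s, \<ominus> s}" using \<sigma>(1) E2 unfolding splitting_star_def star_def by blast
    then show False using \<sigma>(2) finite_subset by blast
  qed
  ultimately have "\<ominus> s \<in> J" using s by (simp add: J_def)
  then show ?thesis using nle le_refl[OF fl_in[OF s(1)]] by blast
qed

lemma separate_regular:
  assumes r: "r \<in> E" "\<not> r \<sqsubseteq> \<ominus> r" "\<not> \<ominus> r \<sqsubseteq> r"
  shows "\<exists>b\<in>J. b \<sqsubseteq> r \<and> \<not> b \<sqsubseteq> \<ominus> r"
proof (cases "\<exists>x\<in>E. x \<sqsubseteq> r \<and> x \<noteq> r")
  case True
  then obtain b where b: "b \<in> J" "b \<sqsubseteq> r" using J_below[OF _ r(1) _ _ r(3)] by metis
  have "\<not> b \<sqsubseteq> \<ominus> r"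
    using nontriv[OF b(2) _ JE[OF b(1)] r(1)] b r by auto
  then show ?thesis using b by blast
next
  case False
  then have "r \<in> J"
    using regular_in_J_if_minimal[OF r(1) _ _ r(3)] accumulatedD[of r] r(2) by blast
  then show ?thesis using r(2) le_refl[OF r(1)] by blast
qed

text \<open>Nestedness reduces to the cases above. The result makes the traces on finite subsets of
  \<open>J\<close> jointly reflect the order.\<close>

lemma separation:
  assumes rs: "r \<in> E" "s \<in> E" "\<not> r \<sqsubseteq> s"
  shows "\<exists>b\<in>J. (b \<sqsubseteq> r \<and> \<not> b \<sqsubseteq> s) \<or> (b \<sqsubseteq> \<ominus> s \<and> \<not> b \<sqsubseteq> \<ominus> r)"
proof (cases "r = \<ominus> s")
  case True
  then have s: "s = \<ominus> r" using rs by simp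
  show ?thesis
  proof (cases "s \<sqsubseteq> \<ominus> s")
    case True
    then show ?thesis using separate_small[OF rs(2)] \<open>r = \<ominus> s\<close> by blast
  next
    case False
    then show ?thesis using separate_regular[OF rs(1)] rs s by auto
  qed
next
  case False
  have neq: "r \<noteq> s" "s \<noteq> \<ominus> r" using rs False by auto
  consider "s \<sqsubseteq> r" | "r \<sqsubseteq> \<ominus> s" | "\<ominus> r \<sqsubseteq> s" using nested_cases[OF rs(1,2)] rs(3) by blast
  then show ?thesis
  proof cases
    case 1
    then show ?thesis using separate_comparable[OF rs(1,2)] neq by blast
  next
    case 2
    then show ?thesis using separate_disjoint[OF rs(1,2)] rs(3) False by blast
  next
    case 3
    have "\<ominus> s \<sqsubseteq> r" using fl_le[OF 3 rs(1,2)] .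
    then show ?thesis
      using separate_disjoint[of "\<ominus> s" "\<ominus> r"] rs False by auto
  qed
qed

section \<open>A branching point between three directions\<close>

text \<open>The separations between \<open>c\<close> and the inverse of \<open>f\<close> form a complete chain, and the
  branching star sits at the place where \<open>x\<close> changes from one side of the chain to the other.\<close>

lemma branching_point_between:
  assumes E: "c \<in> E" "f \<in> E" "x \<in> E"
    and star: "c \<sqsubseteq> \<ominus> f" "c \<sqsubseteq> \<ominus> x" "x \<sqsubseteq> \<ominus> f"
    and regular: "\<not> c \<sqsubseteq> \<ominus> c" "\<not> f \<sqsubseteq> \<ominus> f"
    and ne: "x \<noteq> c" "x \<noteq> \<ominus> c" "x \<noteq> f" "x \<noteq> \<ominus> f"
  shows "\<exists>l\<in>branching_points T. c \<sqsubseteq> l \<and> l \<sqsubseteq> \<ominus> f"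
proof -
  define I where "I = {y \<in> E. c \<sqsubseteq> y \<and> y \<sqsubseteq> \<ominus> f}"
  define L where "L = {y \<in> I. x \<sqsubseteq> \<ominus> y}"
  define U where "U = {y \<in> I. x \<sqsubseteq> y}"
  have I: "y \<in> E" "c \<sqsubseteq> y" "y \<sqsubseteq> \<ominus> f" "f \<sqsubseteq> \<ominus> y" if "y \<in> I" for y
    using that E le_fl by (auto simp: I_def)
  have I_ne: "x \<noteq> y" "x \<noteq> \<ominus> y" if y: "y \<in> I" for y
  proof -
    show "x \<noteq> y"
      using nontriv[OF _ star(2) E(1,3)] I[OF y] ne E by auto
    show "x \<noteq> \<ominus> y"
      using nontriv[OF _ le_fl[OF star(3) E(3,2)] E(2,3)] I[OF y] ne E by auto
  qed
  have LU: "y \<in> L \<or> y \<in> U" if y: "y \<in> I" for y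
  proof -
    have "\<not> y \<sqsubseteq> x"
    proof
      assume "y \<sqsubseteq> x"
      then have "c \<sqsubseteq> x" using le_trans[OF I(2)[OF y]] I[OF y] E by blast
      then show False using nontriv[OF _ star(2) E(1,3)] ne E by auto
    qed
    moreover have "\<not> \<ominus> x \<sqsubseteq> y"
    proof
      assume "\<ominus> x \<sqsubseteq> y"
      then have "\<ominus> x \<sqsubseteq> \<ominus> f" using le_trans[OF _ I(3)[OF y]] I[OF y] E by simp
      then have "f \<sqsubseteq> x" using E by simp
      then show False using nontriv[OF _ le_fl[OF star(3) E(3,2)] E(2,3)] ne E by auto
    qed
    ultimately show ?thesis
      using nested_cases[OF E(3) I(1)[OF y]] y by (auto simp: L_def U_def)
  qed
  have disj: False if "y \<in> L" "y \<in> U" for y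
    using that nontriv[of x y] I_ne[of y] I(1)[of y] E by (auto simp: L_def U_def)
  have total: "y \<sqsubseteq> z \<or> z \<sqsubseteq> y" if y: "y \<in> I" "z \<in> I" for y z
  proof -
    have "\<not> y \<sqsubseteq> \<ominus> z"
    proof
      assume "y \<sqsubseteq> \<ominus> z"
      then have "c \<sqsubseteq> \<ominus> z" using le_trans[OF I(2)[OF y(1)]] I[OF y(1)] I[OF y(2)] E by simp
      then have "z \<sqsubseteq> \<ominus> c" using le_fl I[OF y(2)] E by blast
      then show False using le_trans[OF I(2)[OF y(2)]] regular(1) I[OF y(2)] E by simp
    qed
    moreover have "\<not> \<ominus> y \<sqsubseteq> z"
    proof
      assume "\<ominus> y \<sqsubseteq> z"
      then have "f \<sqsubseteq> z" using le_trans[OF I(4)[OF y(1)]] I[OF y(1)] I[OF y(2)] E by simp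
      then show False using le_trans[OF _ I(3)[OF y(2)]] regular(2) I[OF y(2)] E by simp
    qed
    ultimately show ?thesis using nested_cases[OF I(1)[OF y(1)] I(1)[OF y(2)]] by blast
  qed
  have cI: "c \<in> I" and fI: "\<ominus> f \<in> I" using E star by (auto simp: I_def)
  have cL: "c \<in> L" using cI le_fl[OF star(2)] E by (simp add: L_def)
  have fU: "\<ominus> f \<in> U" using fI star by (simp add: U_def)
  have LI: "L \<subseteq> I" and UI: "U \<subseteq> I" by (auto simp: L_def U_def)
  have L: "L \<subseteq> E" "L \<noteq> {}" "Complete_Partial_Order.chain (leq T) L"
    using LI I(1) cL total unfolding Complete_Partial_Order.chain_def by blast+
  obtain l where l: "l \<in> E" "\<And>y. y \<in> L \<Longrightarrow> y \<sqsubseteq> l"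
    "\<And>v. v \<in> E \<Longrightarrow> (\<And>y. y \<in> L \<Longrightarrow> y \<sqsubseteq> v) \<Longrightarrow> l \<sqsubseteq> v"
    using chain_completeD[OF cc L] by blast
  \<comment> \<open>The infimum of \<open>U\<close> is formed as the inverse of the supremum
    \<open>v\<close> of the inverses.\<close>
  have U: "flip T ` U \<subseteq> E" "flip T ` U \<noteq> {}"
    using UI I(1) fU by auto
  have chU: "Complete_Partial_Order.chain (leq T) (flip T ` U)"
    unfolding Complete_Partial_Order.chain_def
  proof (intro ballI)
    fix y z assume "y \<in> flip T ` U" "z \<in> flip T ` U"
    then obtain y' z' where yz: "y = \<ominus> y'" "z = \<ominus> z'" "y' \<in> I" "z' \<in> I" using UI by blast
    then show "y \<sqsubseteq> z \<or> z \<sqsubseteq> y" using total[OF yz(3,4)] I(1) by auto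
  qed
  obtain v where v: "v \<in> E" "\<And>y. y \<in> flip T ` U \<Longrightarrow> y \<sqsubseteq> v"
    "\<And>w. w \<in> E \<Longrightarrow> (\<And>y. y \<in> flip T ` U \<Longrightarrow> y \<sqsubseteq> w) \<Longrightarrow> v \<sqsubseteq> w"
    using chain_completeD[OF cc U chU] by blast
  have lL: "l \<in> L"
  proof -
    have "l \<sqsubseteq> \<ominus> f" using l(3)[OF fl_in[OF E(2)]] LI I by blast
    moreover have "l \<sqsubseteq> \<ominus> x"
      by (rule l(3)[OF fl_in[OF E(3)]]) (use LI I E le_fl in \<open>auto simp: L_def\<close>)
    ultimately show ?thesis using l(1) l(2)[OF cL] le_fl E by (simp add: L_def I_def)
  qed
  have uU: "\<ominus> v \<in> U"
  proof -
    have "v \<sqsubseteq> \<ominus> c"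
      by (rule v(3)[OF fl_in[OF E(1)]]) (use UI I E in auto)
    moreover have "v \<sqsubseteq> \<ominus> x"
      by (rule v(3)[OF fl_in[OF E(3)]]) (use UI I E in \<open>auto simp: U_def\<close>)
    moreover have "f \<sqsubseteq> v" using v(2)[OF imageI[OF fU]] E by simp
    ultimately show ?thesis using v(1) le_fl E by (simp add: U_def I_def)
  qed
  have lv: "l \<sqsubseteq> \<ominus> v"
  proof -
    have "\<not> \<ominus> v \<sqsubseteq> l"
    proof
      assume "\<ominus> v \<sqsubseteq> l"
      then have "x \<sqsubseteq> l" using le_trans[of x "\<ominus> v" l] uU l(1) v(1) E by (simp add: U_def)
      then show False using disj[OF lL] lL by (simp add: U_def L_def)
    qed
    then show ?thesis using total lL uU LI UI by blast
  qed
  have lv_ne: "l \<noteq> \<ominus> v" using disj lL uU by auto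
  have "l \<noteq> \<ominus> \<ominus> v"
  proof
    assume "l = \<ominus> \<ominus> v"
    then have "l \<sqsubseteq> \<ominus> l" using lv v(1) by simp
    then show False using small_minimal[of l c] I[of l] lL LI E regular(1) by auto
  qed
  then obtain p q \<sigma> where pq: "p \<in> E" "q \<in> E" "l \<sqsubseteq> p" "p \<sqsubseteq> q" "q \<sqsubseteq> \<ominus> v" "p \<noteq> q" "p \<noteq> \<ominus> q"
    "splitting_star T \<sigma>" "p \<in> \<sigma>" "\<ominus> q \<in> \<sigma>"
    using split_between[OF l(1) fl_in[OF v(1)] lv lv_ne] by metis
  have lI: "l \<in> I" and vI: "\<ominus> v \<in> I" using lL LI uU UI by auto
  have pI: "p \<in> I"
    using le_trans[OF I(2)[OF lI] pq(3)] le_trans[OF le_trans[OF pq(4,5)] I(3)[OF vI]] pq E l v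
    by (simp add: I_def)
  have qI: "q \<in> I"
    using le_trans[OF le_trans[OF I(2)[OF lI] pq(3)] pq(4)] le_trans[OF pq(5) I(3)[OF vI]] pq E l v
    by (simp add: I_def)
  have nqp: "\<not> q \<sqsubseteq> p" using le_antisym pq by blast
  \<comment> \<open>\<open>L\<close> lies below \<open>l\<close> and \<open>U\<close> above the
    inverse of \<open>v\<close>. Hence \<open>p\<close> in \<open>U\<close> or \<open>q\<close> in
    \<open>L\<close> would give \<open>q\<close> below \<open>p\<close>.\<close>
  have pL: "p \<in> L"
  proof (rule ccontr)
    assume "p \<notin> L"
    then have "\<ominus> p \<sqsubseteq> v" using LU pI v(2) by blast
    then have "\<ominus> v \<sqsubseteq> p" using fl_le pq v by blast
    then show False using le_trans[OF pq(5)] nqp pq v by simp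
  qed
  have qU: "q \<in> U"
  proof (rule ccontr)
    assume "q \<notin> U"
    then have "q \<sqsubseteq> l" using LU qI l(2) by blast
    then show False using le_trans[OF _ pq(3)] nqp pq l by blast
  qed
  obtain Or where Or': "splits Or \<sigma>" using pq(8) splitting_star_iff by blast
  note Or = splitsD[OF Or']
  have xp: "x \<sqsubseteq> \<ominus> p" and xq: "x \<sqsubseteq> q" using pL qU by (auto simp: L_def U_def)
  have "x \<in> Or"
  proof (rule ccontr)
    assume "x \<notin> Or"
    then have "\<ominus> x = p" using Or(4)[OF pq(9) Or(8)[OF E(3)]] le_fl[OF xp E(3) pq(1)] by blast
    then show False using I_ne(2)[OF pI] E by auto
  qed
  \<comment> \<open>The element of the star above \<open>x\<close> is the third one, because
    \<open>x\<close> is below the inverse of \<open>p\<close> and below \<open>q\<close>.\<close>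
  then obtain m where m: "m \<in> \<sigma>" "x \<sqsubseteq> m" using Or(5) by blast
  have "m \<noteq> p" using nontriv[OF _ xp E(3) pq(1)] m(2) I_ne[OF pI] by blast
  moreover have "m \<noteq> \<ominus> q" using nontriv[OF xq _ E(3) pq(2)] m(2) I_ne[OF qI] by blast
  ultimately have "card {m, p, \<ominus> q} = 3" using pq(7) by simp
  moreover have sub: "{m, p, \<ominus> q} \<subseteq> \<sigma>" using m pq by blast
  ultimately have "infinite \<sigma> \<or> 3 \<le> card \<sigma>" using card_mono by metis
  then have "p \<in> branching_points T"
    using pq(8,9) by (auto simp: branching_points_def branching_star_def)
  then show ?thesis using I[OF pI] by blast
qed

lemma finite_chain_maximum:
  assumes "finite K" "K \<noteq> {}" "K \<subseteq> X" "X \<subseteq> E" "Complete_Partial_Order.chain (leq T) X"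
  shows "\<exists>M\<in>K. \<forall>x\<in>K. x \<sqsubseteq> M"
  using assms(1-3)
proof (induction K rule: finite_ne_induct)
  case (singleton x)
  then show ?case using assms(4) by auto
next
  case (insert x K)
  then obtain M where M: "M \<in> K" "\<And>y. y \<in> K \<Longrightarrow> y \<sqsubseteq> M" by blast
  have E: "x \<in> E" "M \<in> E" "K \<subseteq> E" using insert M assms(4) by auto
  show ?case
  proof (cases "x \<sqsubseteq> M")
    case True
    then show ?thesis using M by blast
  next
    case False
    then have "M \<sqsubseteq> x" using chain_total[OF assms(5)] insert M by blast
    then have "y \<sqsubseteq> x" if "y \<in> K" for y using M(2)[OF that] le_trans E that by blast
    then show ?thesis using E by auto
  qed
qed

subsection \<open>Limits of ultrafilters\<close>

definition below where
  "below G h = {y \<in> E. eventually (\<lambda>i. y \<sqsubseteq> h i) G}"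

text \<open>The image of \<open>G\<close> under \<open>h\<close> is a non-principal ultrafilter on
  the separations. With \<open>h\<close> kept explicit, inversion is a composition.\<close>

definition free where
  "free G h \<longleftrightarrow> ultra G \<and> eventually (\<lambda>i. h i \<in> E) G \<and> (\<forall>y\<in>E. eventually (\<lambda>i. h i \<noteq> y) G)"

text \<open>Convergence in the topology generated by the conditions that a member of
  \<open>J\<close> lies, or does not lie, below a separation or its inverse.\<close>

definition is_limit where
  "is_limit G h z \<longleftrightarrow> z \<in> E \<and>
     (\<forall>b\<in>J. (b \<in> below G h \<longleftrightarrow> b \<sqsubseteq> z) \<and> (b \<in> below G (\<lambda>i. \<ominus> h i) \<longleftrightarrow> b \<sqsubseteq> \<ominus> z))"

lemma below_flip_flip:
  assumes "eventually (\<lambda>i. h i \<in> E) G"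
  shows "below G (\<lambda>i. \<ominus> \<ominus> h i) = below G h"
proof -
  have "eventually (\<lambda>i. y \<sqsubseteq> \<ominus> \<ominus> h i) G \<longleftrightarrow> eventually (\<lambda>i. y \<sqsubseteq> h i) G" for y
    by (rule eventually_cong[OF assms]) simp
  then show ?thesis by (simp add: below_def)
qed

lemma free_flip:
  assumes "free G h"
  shows "free G (\<lambda>i. \<ominus> h i)"
proof -
  have E: "eventually (\<lambda>i. h i \<in> E) G" using assms by (simp add: free_def)
  then have "eventually (\<lambda>i. \<ominus> h i \<in> E) G" by eventually_elim simp
  moreover have "eventually (\<lambda>i. \<ominus> h i \<noteq> y) G" if y: "y \<in> E" for y
  proof -
    have "eventually (\<lambda>i. h i \<noteq> \<ominus> y) G" using assms y by (simp add: free_def)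
    then show ?thesis using E by eventually_elim (use y in auto)
  qed
  ultimately show ?thesis using assms by (simp add: free_def)
qed

lemma is_limit_flip:
  assumes "free G h" "is_limit G (\<lambda>i. \<ominus> h i) z"
  shows "is_limit G h (\<ominus> z)"
proof -
  have "below G (\<lambda>i. \<ominus> \<ominus> h i) = below G h"
    using below_flip_flip[of h G] assms(1) by (simp add: free_def)
  then show ?thesis using assms(2) by (auto simp: is_limit_def)
qed

lemma below_E: "below G h \<subseteq> E"
  by (auto simp: below_def)

lemma below_down_closed:
  assumes "free G h"
  shows "down_closed (below G h)"
  unfolding down_closed_def
proof (intro ballI impI)
  fix x y assume x: "x \<in> E" and y: "y \<in> below G h" and xy: "x \<sqsubseteq> y"
  have yE: "y \<in> E" using y by (simp add: below_def)
  have "eventually (\<lambda>i. h i \<in> E) G" "eventually (\<lambda>i. y \<sqsubseteq> h i) G"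
    using assms y by (auto simp: free_def below_def)
  then have "eventually (\<lambda>i. x \<sqsubseteq> h i) G"
    by eventually_elim (use le_trans xy x yE in blast)
  then show "x \<in> below G h" using x by (simp add: below_def)
qed

text \<open>Finitely many eventual conditions hold at a common index. This supplies a generic
  \<open>h i\<close> away from all separations under discussion.\<close>

lemma free_generic2:
  assumes fr: "free G h" and F: "finite F" "F \<subseteq> E" and K: "finite K" "K \<subseteq> below G h"
    and N: "finite N" "N \<subseteq> below G (\<lambda>i. \<ominus> h i)"
  shows "\<exists>i. h i \<in> E \<and> h i \<notin> F \<and> (\<forall>y\<in>K. y \<sqsubseteq> h i) \<and> (\<forall>y\<in>N. y \<sqsubseteq> \<ominus> h i)"
proof -
  have "eventually (\<lambda>i. \<forall>y\<in>F. h i \<noteq> y) G"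
    by (rule eventually_ball_finite[OF F(1)]) (use fr F(2) in \<open>auto simp: free_def\<close>)
  moreover have "eventually (\<lambda>i. \<forall>y\<in>K. y \<sqsubseteq> h i) G"
    by (rule eventually_ball_finite[OF K(1)]) (use K(2) in \<open>auto simp: below_def\<close>)
  moreover have "eventually (\<lambda>i. \<forall>y\<in>N. y \<sqsubseteq> \<ominus> h i) G"
    by (rule eventually_ball_finite[OF N(1)]) (use N(2) in \<open>auto simp: below_def\<close>)
  moreover have "eventually (\<lambda>i. h i \<in> E) G" using fr by (simp add: free_def)
  ultimately have *: "eventually (\<lambda>i. h i \<in> E \<and> h i \<notin> F \<and> (\<forall>y\<in>K. y \<sqsubseteq> h i) \<and> (\<forall>y\<in>N. y \<sqsubseteq> \<ominus> h i)) G"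
    by eventually_elim blast
  have "ultra G" using fr by (simp add: free_def)
  from ultra_ex[OF this *] show ?thesis .
qed

lemma free_generic:
  assumes "free G h" "finite F" "F \<subseteq> E" "finite K" "K \<subseteq> below G h"
  shows "\<exists>i. h i \<in> E \<and> h i \<notin> F \<and> (\<forall>y\<in>K. y \<sqsubseteq> h i)"
  using free_generic2[OF assms, of "{}"] by auto

text \<open>For \<open>free G h\<close> this is the limit of the orientations
  \<open>toward (h i)\<close> along the ultrafilter.\<close>

definition near where
  "near G h = below G h \<union> below G (\<lambda>i. \<ominus> h i)"

lemma near_flip: "free G h \<Longrightarrow> near G (\<lambda>i. \<ominus> h i) = near G h"
  using below_flip_flip[of h G] by (auto simp: near_def free_def)

lemma below_disjoint:
  assumes fr: "free G h" and y: "y \<in> below G h" "y \<in> below G (\<lambda>i. \<ominus> h i)"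
  shows False
proof -
  have yE: "y \<in> E" using y below_E by blast
  obtain i where i: "h i \<in> E" "h i \<notin> {y, \<ominus> y}" "y \<sqsubseteq> h i" "y \<sqsubseteq> \<ominus> h i"
    using free_generic2[OF fr, of "{y, \<ominus> y}" "{y}" "{y}"] y yE by auto
  then show False using nontriv[OF i(3,4) yE i(1)] yE by auto
qed

lemma near_down_closed: "free G h \<Longrightarrow> down_closed (near G h)"
  using below_down_closed[of G h] below_down_closed[OF free_flip, of G h]
  unfolding down_closed_def near_def by blast

text \<open>Nestedness gives four alternatives, one of which the ultrafilter selects. Both
  orientations of \<open>y\<close> together would contradict non-triviality or antisymmetry at a
  generic \<open>h i\<close>.\<close>

lemma near_oriented:
  assumes fr: "free G h"
  shows "oriented (near G h)"
proof -
  have *: False if y: "y \<in> below G k" "\<ominus> y \<in> near G k" and k: "free G k" for y k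
  proof -
    have yE: "y \<in> E" using y below_E by blast
    from y(2) consider "\<ominus> y \<in> below G k" | "\<ominus> y \<in> below G (\<lambda>i. \<ominus> k i)"
      by (auto simp: near_def)
    then show False
    proof cases
      case 1
      obtain i where i: "k i \<in> E" "k i \<notin> {y, \<ominus> y}" "y \<sqsubseteq> k i" "\<ominus> y \<sqsubseteq> k i"
        using free_generic[OF k, of "{y, \<ominus> y}" "{y, \<ominus> y}"] y 1 yE by auto
      then have "\<ominus> k i \<sqsubseteq> y" "\<ominus> k i \<sqsubseteq> \<ominus> y" using fl_le yE by auto
      then show False using nontriv[of "\<ominus> k i" y] i yE by auto
    next
      case 2
      obtain i where i: "k i \<in> E" "k i \<notin> {y}" "y \<sqsubseteq> k i" "\<ominus> y \<sqsubseteq> \<ominus> k i"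
        using free_generic2[OF k, of "{y}" "{y}" "{\<ominus> y}"] y 2 yE by auto
      then show False using le_antisym[of y "k i"] yE by auto
    qed
  qed
  have **: "\<ominus> y \<notin> near G h" if y: "y \<in> near G h" for y
    using y *[OF _ _ fr] *[OF _ _ free_flip[OF fr]] near_flip[OF fr] unfolding near_def by blast
  have "y \<in> near G h \<or> \<ominus> y \<in> near G h" if y: "y \<in> E" for y
  proof -
    have E: "eventually (\<lambda>i. h i \<in> E) G" and G: "ultra G" using fr by (auto simp: free_def)
    have "eventually (\<lambda>i. (y \<sqsubseteq> h i \<or> \<ominus> y \<sqsubseteq> h i) \<or> (y \<sqsubseteq> \<ominus> h i \<or> \<ominus> y \<sqsubseteq> \<ominus> h i)) G"
      using E by eventually_elim (use nested_cases y in auto)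
    then show ?thesis
      using ultra_disj[OF G] y unfolding near_def below_def by (auto dest!: ultra_disj[OF G])
  qed
  moreover have "near G h \<subseteq> E" by (auto simp: near_def below_def)
  ultimately show ?thesis using ** unfolding oriented_def by blast
qed

section \<open>Limits from unbounded chains and from infinite stars\<close>

text \<open>The supremum is outside \<open>Or\<close>, as it would bound \<open>X\<close>. If
  \<open>y\<close> is below no member of \<open>X\<close>, then nestedness and unboundedness put all
  of \<open>X\<close> below the inverse of \<open>y\<close>, hence also \<open>e\<close>.\<close>

lemma unbounded_chain:
  assumes Or: "oriented Or" "down_closed Or"
    and X: "X \<subseteq> Or" "X \<noteq> {}" "Complete_Partial_Order.chain (leq T) X"
    and unbounded: "\<not> (\<exists>u\<in>Or. \<forall>x\<in>X. x \<sqsubseteq> u)"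
    and e: "is_supremum T X e"
  shows "limit_point e" "\<ominus> e \<in> Or"
    and "y \<in> Or \<Longrightarrow> (\<exists>c\<in>X. y \<sqsubseteq> c) \<or> y \<sqsubseteq> \<ominus> e"
    and "c \<in> X \<Longrightarrow> \<exists>c'\<in>X. c \<sqsubseteq> c' \<and> c \<noteq> c'"
proof -
  have XE: "X \<subseteq> E" and OrE: "Or \<subseteq> E" using X(1) Or(1) by (auto simp: oriented_def)
  have flip: "\<ominus> x \<notin> Or" if "x \<in> Or" for x using Or(1) that by (auto simp: oriented_def)
  have eE: "e \<in> E" and ub: "\<And>x. x \<in> X \<Longrightarrow> x \<sqsubseteq> e"
    and lub: "\<And>v. v \<in> E \<Longrightarrow> (\<And>x. x \<in> X \<Longrightarrow> x \<sqsubseteq> v) \<Longrightarrow> e \<sqsubseteq> v"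
    using e by (auto simp: is_supremum_def)
  have eO: "e \<notin> Or" using unbounded ub by blast
  then show "limit_point e" using X XE e unfolding limit_point_def by blast
  show "\<ominus> e \<in> Or" using eO eE Or(1) unfolding oriented_def by blast
  show "\<exists>c'\<in>X. c \<sqsubseteq> c' \<and> c \<noteq> c'" if c: "c \<in> X"
  proof -
    have "c \<in> Or" using c X(1) by blast
    then obtain c' where c': "c' \<in> X" "\<not> c' \<sqsubseteq> c" using unbounded by blast
    then show ?thesis using chain_total[OF X(3) c c'(1)] by blast
  qed
  show "(\<exists>c\<in>X. y \<sqsubseteq> c) \<or> y \<sqsubseteq> \<ominus> e" if y: "y \<in> Or"
  proof (rule disjCI)
    assume "\<not> y \<sqsubseteq> \<ominus> e"
    have yE: "y \<in> E" using y OrE by blast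
    show "\<exists>c\<in>X. y \<sqsubseteq> c"
    proof (rule ccontr)
      assume none: "\<not> ?thesis"
      have alt: "c \<sqsubseteq> y \<or> y \<sqsubseteq> \<ominus> c" if c: "c \<in> X" for c
      proof -
        have "\<not> \<ominus> y \<sqsubseteq> c"
          using flip[OF y] Or(2) c X(1) fl_in[OF yE] unfolding down_closed_def by blast
        then show ?thesis using nested_cases[OF yE, of c] none c XE by blast
      qed
      obtain c' where c': "c' \<in> X" "\<not> c' \<sqsubseteq> y" using unbounded y by blast
      have c'E: "c' \<in> E" using c' XE by blast
      \<comment> \<open>Otherwise \<open>c\<close> is below \<open>y\<close>, hence below both
        \<open>c'\<close> and its inverse, against non-triviality.\<close>
      have "y \<sqsubseteq> \<ominus> c" if c: "c \<in> X" for c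
      proof (rule ccontr)
        have cE: "c \<in> E" using c XE by blast
        assume "\<not> y \<sqsubseteq> \<ominus> c"
        then have cy: "c \<sqsubseteq> y" using alt c by blast
        then have "c \<sqsubseteq> \<ominus> c'" using le_trans alt[OF c'(1)] c'(2) cE yE c'E fl_in by blast
        moreover have "c \<sqsubseteq> c'"
          using chain_total[OF X(3) c c'(1)] le_trans[OF _ cy] c'(2) cE yE c'E by blast
        ultimately have "c = c' \<or> c = \<ominus> c'" using nontriv cE c'E by blast
        moreover have "c \<noteq> \<ominus> c'" using flip c c'(1) X(1) by blast
        ultimately show False using cy c'(2) by blast
      qed
      then have "c \<sqsubseteq> \<ominus> y" if "c \<in> X" for c using le_fl[OF _ yE] that XE by blast
      then have "e \<sqsubseteq> \<ominus> y" using lub yE by simp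
      then show False using \<open>\<not> y \<sqsubseteq> \<ominus> e\<close> le_fl eE yE by blast
    qed
  qed
qed

text \<open>Members of the orientation lie below an element of \<open>X\<close> or below
  \<open>a\<close>. The former are below \<open>h i\<close> and below \<open>e\<close>; the point is
  that members of \<open>J\<close> of the latter kind are eventually below the inverse of
  \<open>h i\<close>.\<close>

lemma limit_of_unbounded_chain:
  assumes fr: "free G h"
    and X: "X \<subseteq> below G h" "X \<noteq> {}" "Complete_Partial_Order.chain (leq T) X"
    and unbounded: "\<not> (\<exists>u\<in>near G h. \<forall>x\<in>X. x \<sqsubseteq> u)"
    and e: "is_supremum T X e"
  shows "is_limit G h e"
proof -
  let ?Or = "near G h" and ?P = "below G h" and ?N = "below G (\<lambda>i. \<ominus> h i)"
  define a where "a = \<ominus> e"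
  have Or: "oriented ?Or" "down_closed ?Or" using near_oriented near_down_closed fr by blast+
  have OrE: "?Or \<subseteq> E" using Or(1) by (simp add: oriented_def)
  have down: "x \<in> ?Or" if "x \<in> E" "y \<in> ?Or" "x \<sqsubseteq> y" for x y
    using Or(2) that unfolding down_closed_def by blast
  have downP: "x \<in> ?P" if "x \<in> E" "y \<in> ?P" "x \<sqsubseteq> y" for x y
    using below_down_closed[OF fr] that unfolding down_closed_def by blast
  have flip: "\<ominus> x \<notin> ?Or" if "x \<in> ?Or" for x using Or(1) that by (auto simp: oriented_def)
  have flip': "\<ominus> x \<in> ?Or" if "x \<notin> ?Or" "x \<in> E" for x using Or(1) that by (auto simp: oriented_def)
  have XO: "X \<subseteq> ?Or" using X(1) by (auto simp: near_def)
  have XE: "X \<subseteq> E" using XO OrE by blast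
  note ub = unbounded_chain[OF Or XO X(2,3) unbounded e]
  have eE: "e \<in> E" and sup: "\<And>x. x \<in> X \<Longrightarrow> x \<sqsubseteq> e" using e by (auto simp: is_supremum_def)
  have aE: "a \<in> E" and aO: "a \<in> ?Or" and e_a: "e = \<ominus> a" using ub(2) eE by (auto simp: a_def)
  have eJ: "e \<notin> J" using ub(1) by (simp add: J_def)
  \<comment> \<open>A small \<open>a\<close> is accumulated because its inverse \<open>e\<close> is
    a limit point.\<close>
  have aJ: "a \<notin> J" if "a \<sqsubseteq> \<ominus> a"
    using that aE ub(1) e_a by (simp add: J_def accumulated_def)
  have not_cosmall: "\<not> \<ominus> x \<sqsubseteq> x" if "x \<in> ?Or" for x
    using flip[OF that] down[OF fl_in that] that OrE by blast
  note nca = not_cosmall[OF aO]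
  have below_e: "y \<in> ?Or" if y: "y \<in> E" "y \<sqsubseteq> e" "y \<noteq> e" for y
  proof (rule ccontr)
    assume "y \<notin> ?Or"
    then have yO: "\<ominus> y \<in> ?Or" using flip' y by blast
    have "\<not> \<ominus> y \<sqsubseteq> \<ominus> e" using le_antisym y eE by auto
    then obtain c where c: "c \<in> X" "\<ominus> y \<sqsubseteq> c" using ub(3)[OF yO] by blast
    have cE: "c \<in> E" using c XE by blast
    have ay: "a \<sqsubseteq> \<ominus> y" using y eE by (simp add: a_def)
    have "a \<sqsubseteq> c" using le_trans[OF ay c(2)] aE y cE by simp
    moreover have "a \<sqsubseteq> \<ominus> c" using sup[OF c(1)] eE cE by (simp add: a_def)
    ultimately have "a = c \<or> a = \<ominus> c" using nontriv aE cE by blast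
    moreover have "a \<noteq> \<ominus> c" using flip c(1) XO aO by blast
    ultimately have "\<ominus> y = a" using le_antisym[OF ay] c(2) aE y by simp
    then show False using y e_a by auto
  qed
  \<comment> \<open>Otherwise \<open>h i\<close> branches off beyond each element of \<open>X\<close>, which gives
    infinitely many branching points between some element of \<open>X\<close> and \<open>e\<close>.\<close>
  have not_P: False if reg: "\<not> a \<sqsubseteq> \<ominus> a" and b: "b \<in> ?P" "b \<sqsubseteq> a" for b
  proof -
    have bE: "b \<in> E" using b below_E by blast
    obtain c where c: "c \<in> X" using X(2) by blast
    have cE: "c \<in> E" using c XE by blast
    \<comment> \<open>If \<open>h i\<close> were below \<open>a\<close>, then \<open>c\<close> would
      be below both orientations of \<open>a\<close>; if it were below the inverse of
      \<open>a\<close>, then \<open>b\<close> would be.\<close>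
    have "eventually (\<lambda>i. a \<sqsubseteq> h i \<or> \<ominus> a \<sqsubseteq> h i) G"
    proof -
      have "eventually (\<lambda>i. h i \<in> E) G" "eventually (\<lambda>i. b \<sqsubseteq> h i) G"
        "eventually (\<lambda>i. c \<sqsubseteq> h i) G"
        using fr b(1) c X(1) by (auto simp: free_def below_def)
      then show ?thesis
      proof eventually_elim
        case (elim i)
        have "\<not> h i \<sqsubseteq> a"
        proof
          assume "h i \<sqsubseteq> a"
          then have "c \<sqsubseteq> a" using le_trans[OF elim(3)] cE elim(1) aE by blast
          then have "c = a \<or> c = \<ominus> a" using nontriv sup[OF c] e_a cE aE by blast
          then show False using sup[OF c] e_a reg flip[OF aO] c XO by auto
        qed
        moreover have "\<not> h i \<sqsubseteq> \<ominus> a"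
        proof
          assume "h i \<sqsubseteq> \<ominus> a"
          then have ba: "b \<sqsubseteq> \<ominus> a" using le_trans[OF elim(2)] bE elim(1) aE by simp
          then have "b = a \<or> b = \<ominus> a" using nontriv b(2) bE aE by blast
          then show False using ba b(2) reg nca by auto
        qed
        moreover have "\<ominus> h i \<sqsubseteq> a \<Longrightarrow> \<ominus> a \<sqsubseteq> h i" using fl_le elim(1) aE by blast
        ultimately show ?case using nested_cases[OF elim(1) aE] by blast
      qed
    qed
    then have "a \<in> ?P \<or> \<ominus> a \<in> ?P"
      using ultra_disj[of G "\<lambda>i. a \<sqsubseteq> h i" "\<lambda>i. \<ominus> a \<sqsubseteq> h i"] fr aE by (simp add: free_def below_def)
    then have aP: "a \<in> ?P" using flip[OF aO] by (auto simp: near_def)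
    have branch: "\<exists>l\<in>branching_points T. \<exists>c'\<in>X. c \<sqsubseteq> l \<and> l \<sqsubseteq> c' \<and> c' \<sqsubseteq> e"
      if c: "c \<in> X" "\<not> c \<sqsubseteq> \<ominus> c" for c
    proof -
      have cE: "c \<in> E" using c XE by blast
      \<comment> \<open>The inverse of this generic \<open>h i\<close> is the third direction
        \<open>x\<close>, besides \<open>c\<close> and a later element of the chain.\<close>
      obtain i where i: "h i \<in> E" "h i \<notin> {a, \<ominus> a, c, \<ominus> c}" "a \<sqsubseteq> h i" "c \<sqsubseteq> h i"
        using free_generic[OF fr, of "{a, \<ominus> a, c, \<ominus> c}" "{a, c}"] aE cE aP c X(1) by auto
      define x where "x = \<ominus> h i"
      have x: "x \<in> E" "x \<noteq> a" "x \<noteq> \<ominus> a" "x \<noteq> c" "x \<noteq> \<ominus> c" "x \<sqsubseteq> e" "c \<sqsubseteq> \<ominus> x" "a \<sqsubseteq> \<ominus> x"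
        using i aE cE e_a by (auto simp: x_def)
      have xO: "x \<in> ?Or" using below_e x e_a by blast
      have "\<not> x \<sqsubseteq> a" using nontriv[of x a] x aE e_a by auto
      then obtain d where d: "d \<in> X" "x \<sqsubseteq> d" using ub(3)[OF xO] by (auto simp: a_def)
      \<comment> \<open>One further step along the chain ensures that \<open>x\<close> differs from
        \<open>d'\<close>.\<close>
      obtain d' where d': "d' \<in> X" "d \<sqsubseteq> d'" "d \<noteq> d'" using ub(4)[OF d(1)] by blast
      have dE: "d \<in> E" "d' \<in> E" using d d' XE by auto
      have xd: "x \<sqsubseteq> d'" using le_trans[OF d(2) d'(2)] x dE by blast
      have "x \<noteq> d'" using le_antisym[OF d'(2)] d(2) d'(3) dE by blast
      moreover have "x \<noteq> \<ominus> d'"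
      proof
        assume "x = \<ominus> d'"
        then have "a \<sqsubseteq> d'" using x(8) dE by simp
        then have "a \<sqsubseteq> e" using le_trans[OF _ sup[OF d'(1)]] aE dE eE by blast
        then show False using reg e_a by simp
      qed
      moreover have "c \<sqsubseteq> d'"
      proof -
        have "\<not> d' \<sqsubseteq> c"
        proof
          assume "d' \<sqsubseteq> c"
          then have "x \<sqsubseteq> c" using le_trans[OF xd] x dE cE by blast
          moreover have "x \<sqsubseteq> \<ominus> c" using le_fl[OF x(7)] cE x by blast
          ultimately show False using nontriv[of x c] x cE by blast
        qed
        then show ?thesis using chain_total[OF X(3) c(1) d'(1)] by blast
      qed
      moreover have "\<not> \<ominus> d' \<sqsubseteq> d'"
        using not_cosmall d'(1) XO by blast
      ultimately have "\<exists>l\<in>branching_points T. c \<sqsubseteq> l \<and> l \<sqsubseteq> \<ominus> \<ominus> d'"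
        using branching_point_between[of c "\<ominus> d'" x] cE dE x xd c(2) by simp
      then show ?thesis using d'(1) sup dE by auto
    qed
    \<comment> \<open>An element of the chain with another one strictly below it is not
      small.\<close>
    obtain c0 where c0: "c0 \<in> X" "\<not> c0 \<sqsubseteq> \<ominus> c0"
    proof -
      obtain c' where c': "c' \<in> X" "c \<sqsubseteq> c'" "c \<noteq> c'" using ub(4)[OF c] by blast
      then have "\<not> c' \<sqsubseteq> \<ominus> c'" using small_minimal[of c' c] cE XE by blast
      then show ?thesis using that c' by blast
    qed
    have c0E: "c0 \<in> E" using c0 XE by blast
    have reg_up: "\<not> c \<sqsubseteq> \<ominus> c" if "c \<in> X" "c0 \<sqsubseteq> c" for c
      using small_minimal[of c c0] that c0 c0E XE by blast
    define L where "L = {l \<in> branching_points T. c0 \<sqsubseteq> l \<and> l \<sqsubseteq> e \<and> (\<exists>c\<in>X. l \<sqsubseteq> c)}"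
    have bpE: "l \<in> E" if "l \<in> branching_points T" for l
      using that by (auto simp: branching_points_def branching_star_def splitting_star_def star_def)
    have "finite (branching_between T (unor T c0) (unor T e))"
    proof (rule finite_between)
      show "unor T c0 \<in> unoriented T" "unor T e \<in> unoriented T"
        using c0E eE by (auto simp: unoriented_def)
      have "\<not> \<ominus> c0 \<sqsubseteq> c0" using not_cosmall c0(1) XO by blast
      then show "regular T (unor T c0)" using c0 c0E by (auto simp: regular_def unor_def small_def)
      show "regular T (unor T e)"
        using reg nca aE by (auto simp: regular_def unor_def small_def e_a)
    qed
    moreover have "L \<subseteq> branching_between T (unor T c0) (unor T e)"
      by (auto simp: L_def branching_between_def unor_def)
    ultimately have finL: "finite L" using finite_subset by blast
    have "\<forall>l\<in>L. \<exists>c. c \<in> X \<and> l \<sqsubseteq> c" by (auto simp: L_def)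
    then obtain k where k: "\<And>l. l \<in> L \<Longrightarrow> k l \<in> X \<and> l \<sqsubseteq> k l" by metis
    \<comment> \<open>All branching points of the finite set \<open>L\<close> lie below
      \<open>M\<close>, but the strictly later \<open>M'\<close> has a further one above it.\<close>
    have "\<exists>M\<in>insert c0 (k ` L). \<forall>x\<in>insert c0 (k ` L). x \<sqsubseteq> M"
      by (rule finite_chain_maximum[OF _ _ _ XE X(3)]) (use finL k c0 in auto)
    then obtain M where M: "M \<in> X" "c0 \<sqsubseteq> M" "\<And>l. l \<in> L \<Longrightarrow> k l \<sqsubseteq> M"
      using k c0 by blast
    obtain M' where M': "M' \<in> X" "M \<sqsubseteq> M'" "M \<noteq> M'" using ub(4)[OF M(1)] by blast
    have ME: "M \<in> E" "M' \<in> E" using M M' XE by auto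
    have c0M: "c0 \<sqsubseteq> M'" using le_trans[OF M(2) M'(2)] c0E ME by blast
    obtain l c' where l: "l \<in> branching_points T" "c' \<in> X" "M' \<sqsubseteq> l" "l \<sqsubseteq> c'" "c' \<sqsubseteq> e"
      using branch[OF M'(1) reg_up[OF M'(1) c0M]] by blast
    have lE: "l \<in> E" "c' \<in> E" using bpE l XE by auto
    have "l \<in> L"
      using l le_trans[OF c0M l(3)] le_trans[OF l(4,5)] c0E ME lE eE by (auto simp: L_def)
    then have kl: "k l \<in> X" "l \<sqsubseteq> k l" "k l \<sqsubseteq> M" using k M(3) by auto
    have klE: "k l \<in> E" using kl XE by blast
    have "M' \<sqsubseteq> M"
      using le_trans[OF le_trans[OF l(3) kl(2)] kl(3)] ME lE klE by blast
    then show False using le_antisym[OF M'(2)] M'(3) ME by blast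
  qed
  \<comment> \<open>For small \<open>a\<close>, minimality gives \<open>b = a\<close>, which is
    accumulated; otherwise the branching argument applies.\<close>
  have no_aP: False if b: "b \<in> J" "b \<in> ?P" "b \<sqsubseteq> a" for b
  proof (cases "a \<sqsubseteq> \<ominus> a")
    case True
    then have "b = a" using small_minimal b JE aE by blast
    then show False using aJ[OF True] b by blast
  next
    case False
    then show False using not_P b by blast
  qed
  have "b \<in> ?P \<longleftrightarrow> b \<sqsubseteq> e" if b: "b \<in> J" for b
  proof
    have bE: "b \<in> E" using b JE by blast
    assume bP: "b \<in> ?P"
    then have "(\<exists>c\<in>X. b \<sqsubseteq> c) \<or> b \<sqsubseteq> a" using ub(3)[of b] by (auto simp: near_def a_def)
    then obtain c where "c \<in> X" "b \<sqsubseteq> c" using no_aP b bP by blast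
    then show "b \<sqsubseteq> e" using le_trans sup bE eE XE by blast
  next
    have bE: "b \<in> E" using b JE by blast
    assume be: "b \<sqsubseteq> e"
    then have "b \<in> ?Or" using below_e bE eJ b by blast
    then have "(\<exists>c\<in>X. b \<sqsubseteq> c) \<or> b \<sqsubseteq> a" using ub(3)[of b] by (auto simp: a_def)
    moreover have "\<not> b \<sqsubseteq> a"
    proof
      assume "b \<sqsubseteq> a"
      then have "b = a \<or> b = \<ominus> a" using nontriv be e_a bE aE by blast
      then show False using be e_a aJ eJ b by auto
    qed
    ultimately show "b \<in> ?P" using downP bE X(1) by blast
  qed
  moreover have "b \<in> ?N \<longleftrightarrow> b \<sqsubseteq> a" if b: "b \<in> J" for b
  proof
    have bE: "b \<in> E" using b JE by blast
    assume bN: "b \<in> ?N"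
    then have "(\<exists>c\<in>X. b \<sqsubseteq> c) \<or> b \<sqsubseteq> a" using ub(3)[of b] by (auto simp: near_def a_def)
    moreover have "b \<notin> ?P" using below_disjoint[OF fr] bN by blast
    ultimately show "b \<sqsubseteq> a" using downP bE X(1) by blast
  next
    have bE: "b \<in> E" using b JE by blast
    assume ba: "b \<sqsubseteq> a"
    then have "b \<in> ?Or" using down bE aO by blast
    then show "b \<in> ?N" using no_aP b ba by (auto simp: near_def)
  qed
  ultimately show ?thesis using eE by (simp add: is_limit_def a_def)
qed

text \<open>The whole orientation lies eventually below \<open>h i\<close>, and a finite star is
  impossible. In an infinite star all elements lie below the inverse of the chosen small
  \<open>s\<close>, so on \<open>J\<close> that inverse has the same lower bounds as
  \<open>h i\<close> eventually has.\<close>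

lemma limit_of_star:
  assumes fr: "free G h"
    and \<sigma>: "splits (near G h) \<sigma>" "\<sigma> \<subseteq> below G h" "\<sigma> \<noteq> {}"
  shows "is_limit G h (\<ominus> star_limit \<sigma>)"
proof -
  let ?Or = "near G h" and ?P = "below G h" and ?N = "below G (\<lambda>i. \<ominus> h i)"
  note Or = splitsD[OF \<sigma>(1)]
  have ss: "splitting_star T \<sigma>" using \<sigma>(1) splitting_star_iff by blast
  have downP: "x \<in> ?P" if "x \<in> E" "y \<in> ?P" "x \<sqsubseteq> y" for x y
    using below_down_closed[OF fr] that unfolding down_closed_def by blast
  have OP: "?Or = ?P"
  proof -
    have "x \<in> ?P" if x: "x \<in> ?Or" for x
    proof -
      obtain m where "m \<in> \<sigma>" "x \<sqsubseteq> m" using Or(5)[OF x] by blast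
      then show ?thesis using downP \<sigma>(2) x Or(3) by blast
    qed
    then show ?thesis by (auto simp: near_def)
  qed
  have N0: "?N = {}" using below_disjoint[OF fr] OP by (auto simp: near_def)
  \<comment> \<open>A generic \<open>h i\<close> above all of a finite star is not in the
    orientation, so its inverse lies below some \<open>n\<close> of the star and also below the
    inverse of \<open>n\<close>.\<close>
  have inf: "infinite \<sigma>"
  proof
    assume fin: "finite \<sigma>"
    have F: "finite (\<sigma> \<union> flip T ` \<sigma>)" "\<sigma> \<union> flip T ` \<sigma> \<subseteq> E" using fin Or(1) by auto
    obtain i where i: "h i \<in> E" "h i \<notin> \<sigma> \<union> flip T ` \<sigma>" "\<And>y. y \<in> \<sigma> \<Longrightarrow> y \<sqsubseteq> h i"
      using free_generic[OF fr F fin \<sigma>(2)] by blast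
    obtain m where m: "m \<in> \<sigma>" using \<sigma>(3) by blast
    have "h i \<notin> ?Or" using Or(4)[OF m] i m by auto
    then have "\<ominus> h i \<in> ?Or" using Or(8) i(1) by blast
    then obtain n where n: "n \<in> \<sigma>" "\<ominus> h i \<sqsubseteq> n" using Or(5) by blast
    have nE: "n \<in> E" using n Or(1) by blast
    have "\<ominus> h i \<sqsubseteq> \<ominus> n" using i n nE by simp
    then have "\<ominus> h i = n \<or> \<ominus> h i = \<ominus> n" using nontriv[OF n(2) _ fl_in[OF i(1)] nE] by blast
    then have "h i = \<ominus> n \<or> h i = n" using i(1) nE by auto
    then show False using i(2) n(1) by blast
  qed
  define s where "s = star_limit \<sigma>"
  have s: "s \<in> \<sigma>" "s \<sqsubseteq> \<ominus> s" using star_limit[OF ss inf] by (auto simp: s_def)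
  have sE: "s \<in> E" using s Or(1) by blast
  have "s \<in> accumulated" using ss inf s sE by (auto simp: accumulated_def s_def)
  then have sJ: "s \<notin> J" "\<ominus> s \<notin> J" using sE by (auto simp: J_def)
  have "b \<in> ?P \<longleftrightarrow> b \<sqsubseteq> \<ominus> s" if b: "b \<in> J" for b
  proof
    have bE: "b \<in> E" using b JE by blast
    assume "b \<in> ?P"
    then obtain m where m: "m \<in> \<sigma>" "b \<sqsubseteq> m" using Or(5) OP by blast
    have "m \<sqsubseteq> \<ominus> s" using Or(6)[OF m(1) s(1)] s(2) by blast
    then show "b \<sqsubseteq> \<ominus> s" using le_trans[OF m(2)] bE m(1) Or(1) sE by auto
  next
    have bE: "b \<in> E" using b JE by blast
    assume bs: "b \<sqsubseteq> \<ominus> s"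
    show "b \<in> ?P"
    proof (rule ccontr)
      assume "b \<notin> ?P"
      then have "\<ominus> b \<in> ?Or" using Or(8)[OF bE] OP by blast
      then have "\<ominus> b = s" using Or(4)[OF s(1)] le_fl[OF bs bE sE] by blast
      then show False using sJ b bE by auto
    qed
  qed
  moreover have "\<not> b \<sqsubseteq> \<ominus> \<ominus> s" if b: "b \<in> J" for b
    using small_minimal[OF s(2) _ JE[OF b] sE] sJ b sE by auto
  ultimately show ?thesis using sE N0 unfolding is_limit_def s_def[symmetric] by auto
qed

text \<open>If each element of the orientation is below a maximal one, these form a splitting star;
  otherwise Zorn's lemma gives an unbounded chain. In both cases everything lies on one side of
  \<open>h i\<close>, up to inversion the lower one.\<close>

lemma free_limit:
  assumes fr: "free G h"
  shows "\<exists>z. is_limit G h z"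
proof -
  let ?Or = "near G h" and ?P = "below G h" and ?N = "below G (\<lambda>i. \<ominus> h i)"
  have Or: "oriented ?Or" "down_closed ?Or" using near_oriented near_down_closed fr by blast+
  have OrE: "?Or \<subseteq> E" using Or(1) by (simp add: oriented_def)
  note fr' = free_flip[OF fr]
  have bff: "below G (\<lambda>i. \<ominus> \<ominus> h i) = ?P" using below_flip_flip[of h G] fr by (simp add: free_def)
  show ?thesis
  proof (cases "\<forall>x\<in>?Or. \<exists>y\<in>maximal_elements T ?Or. x \<sqsubseteq> y")
    case True
    define \<sigma> where "\<sigma> = maximal_elements T ?Or"
    have cons: "consistent T ?Or" using consistent_down_closed Or by blast
    have "splitting_star T \<sigma>"
      unfolding \<sigma>_def by (rule splitting_starI[OF Or(1) cons]) (use True in blast)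
    then have sp: "splits ?Or \<sigma>"
      using True Or(1) cons by (auto simp: splits_def \<sigma>_def splitting_star_def)
    note D = splitsD[OF sp]
    have "\<sigma> \<noteq> {}"
    proof -
      obtain i where "h i \<in> E" using free_generic[OF fr, of "{}" "{}"] by blast
      then have "?Or \<noteq> {}" using D(8) by blast
      then show ?thesis using D(5) by blast
    qed
    \<comment> \<open>Elements \<open>p\<close> below \<open>h i\<close> and \<open>n\<close> below
      its inverse would by maximality exclude both orientations of a generic \<open>h i\<close> from
      the orientation.\<close>
    have "\<not> (p \<in> \<sigma> \<inter> ?P \<and> n \<in> \<sigma> \<inter> ?N)" for p n
    proof
      assume pn: "p \<in> \<sigma> \<inter> ?P \<and> n \<in> \<sigma> \<inter> ?N"
      have E: "p \<in> E" "n \<in> E" using pn D(1) by auto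
      obtain i where i: "h i \<in> E" "h i \<notin> {p, \<ominus> n}" "p \<sqsubseteq> h i" "n \<sqsubseteq> \<ominus> h i"
        using free_generic2[OF fr, of "{p, \<ominus> n}" "{p}" "{n}"] pn E by auto
      have "h i \<notin> ?Or" using D(4)[of p "h i"] pn i by auto
      then have "\<ominus> h i = n" using D(8)[OF i(1)] D(4)[of n "\<ominus> h i"] pn i by auto
      then show False using i by auto
    qed
    moreover have "\<sigma> \<subseteq> ?P \<union> ?N" using D(2) by (simp add: near_def)
    ultimately consider "\<sigma> \<subseteq> ?P" | "\<sigma> \<subseteq> ?N" by blast
    then show ?thesis
    proof cases
      case 1
      then show ?thesis using limit_of_star[OF fr sp] \<open>\<sigma> \<noteq> {}\<close> by blast
    next
      case 2
      then show ?thesis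
        using limit_of_star[OF fr' _ _ \<open>\<sigma> \<noteq> {}\<close>] sp near_flip[OF fr] is_limit_flip[OF fr] by metis
    qed
  next
    case False
    then obtain x where x: "x \<in> ?Or" "\<not> (\<exists>y\<in>maximal_elements T ?Or. x \<sqsubseteq> y)" by blast
    have "\<exists>X. X \<subseteq> ?Or \<and> X \<noteq> {} \<and> Complete_Partial_Order.chain (leq T) X \<and>
        \<not> (\<exists>u\<in>?Or. \<forall>y\<in>X. y \<sqsubseteq> u)"
    proof (rule ccontr)
      assume "\<not> ?thesis"
      then have "\<exists>u\<in>?Or. \<forall>y\<in>X. y \<sqsubseteq> u"
        if "X \<subseteq> ?Or" "X \<noteq> {}" "Complete_Partial_Order.chain (leq T) X" "\<forall>y\<in>X. x \<sqsubseteq> y" for X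
        using that by blast
      from zorn[OF OrE x(1) this] obtain m
        where "m \<in> ?Or" "x \<sqsubseteq> m" "\<And>y. y \<in> ?Or \<Longrightarrow> m \<sqsubseteq> y \<Longrightarrow> y = m" by blast
      then show False using x(2) by (auto simp: maximal_elements_def lt_def)
    qed
    then obtain X where X: "X \<subseteq> ?Or" "X \<noteq> {}" "Complete_Partial_Order.chain (leq T) X"
      and ub: "\<not> (\<exists>u\<in>?Or. \<forall>y\<in>X. y \<sqsubseteq> u)" by blast
    have XE: "X \<subseteq> E" using X(1) OrE by blast
    obtain e where e: "is_supremum T X e"
      using cc XE X unfolding chain_complete_def by blast
    have down: "y \<in> below G k" if "free G k" "y \<in> X" "z \<in> below G k" "y \<sqsubseteq> z" for y z k
      using below_down_closed[OF that(1)] that XE unfolding down_closed_def by blast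
    have "\<not> (p \<in> X \<inter> ?P \<and> n \<in> X \<inter> ?N)" for p n
    proof
      assume pn: "p \<in> X \<inter> ?P \<and> n \<in> X \<inter> ?N"
      then have "p \<sqsubseteq> n \<or> n \<sqsubseteq> p" using chain_total[OF X(3)] by blast
      then have "p \<in> ?N \<or> n \<in> ?P" using down[OF fr] down[OF fr'] pn by blast
      then show False using below_disjoint[OF fr] pn by blast
    qed
    moreover have "X \<subseteq> ?P \<union> ?N" using X(1) by (simp add: near_def)
    ultimately consider "X \<subseteq> ?P" | "X \<subseteq> ?N" by blast
    then show ?thesis
    proof cases
      case 1
      then show ?thesis using limit_of_unbounded_chain[OF fr 1 X(2,3) ub e] by blast
    next
      case 2
      have "is_limit G (\<lambda>i. \<ominus> h i) e"
        using limit_of_unbounded_chain[OF fr' 2 X(2,3) _ e] ub near_flip[OF fr] by simp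
      then show ?thesis using is_limit_flip[OF fr] by blast
    qed
  qed
qed

text \<open>An ultrafilter that is not free is eventually constant along \<open>h\<close>, and this
  constant is a limit.\<close>

lemma ultra_limit:
  assumes G: "ultra G" "eventually (\<lambda>i. h i \<in> E) G"
  shows "\<exists>z. is_limit G h z"
proof (cases "free G h")
  case False
  then obtain y where y: "y \<in> E" "\<not> eventually (\<lambda>i. h i \<noteq> y) G" using G by (auto simp: free_def)
  then have ev: "eventually (\<lambda>i. h i = y) G" using G(1) unfolding ultra_def by auto
  have "eventually (\<lambda>i. b \<sqsubseteq> h i) G \<longleftrightarrow> b \<sqsubseteq> y" "eventually (\<lambda>i. b \<sqsubseteq> \<ominus> h i) G \<longleftrightarrow> b \<sqsubseteq> \<ominus> y" for b
  proof -
    have "eventually (\<lambda>i. b \<sqsubseteq> h i) G \<longleftrightarrow> eventually (\<lambda>i. b \<sqsubseteq> y) G"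
      "eventually (\<lambda>i. b \<sqsubseteq> \<ominus> h i) G \<longleftrightarrow> eventually (\<lambda>i. b \<sqsubseteq> \<ominus> y) G"
      by (rule eventually_cong[OF ev], simp)+
    then show "eventually (\<lambda>i. b \<sqsubseteq> h i) G \<longleftrightarrow> b \<sqsubseteq> y" "eventually (\<lambda>i. b \<sqsubseteq> \<ominus> h i) G \<longleftrightarrow> b \<sqsubseteq> \<ominus> y"
      using ultra_const[OF G(1)] by simp_all
  qed
  then have "is_limit G h y" using y JE by (auto simp: is_limit_def below_def)
  then show ?thesis by blast
qed (rule free_limit)

subsection \<open>Finite quotients\<close>

definition trace where
  "trace F x = ({b \<in> F. b \<sqsubseteq> x}, {b \<in> F. b \<sqsubseteq> \<ominus> x})"

text \<open>The second component is ordered by reverse inclusion, so that swapping the components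
  reverses the order.\<close>

definition quotient_system :: "'a set \<Rightarrow> ('a set \<times> 'a set) sep_sys" where
  "quotient_system F = \<lparr>seps = trace F ` E,
     leq = (\<lambda>u v. fst u \<subseteq> fst v \<and> snd v \<subseteq> snd u), flip = (\<lambda>u. (snd u, fst u))\<rparr>"

definition project :: "'a set \<Rightarrow> 'a set \<Rightarrow> 'a set \<times> 'a set \<Rightarrow> 'a set \<times> 'a set" where
  "project G F u = (fst u \<inter> F, snd u \<inter> F)"

definition indices where
  "indices = {F. finite F \<and> F \<subseteq> J}"

lemma trace_flip: "x \<in> E \<Longrightarrow> trace F (\<ominus> x) = (snd (trace F x), fst (trace F x))"
  by (simp add: trace_def)

lemma project_trace: "F \<subseteq> G \<Longrightarrow> project G F (trace G x) = trace F x"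
  by (auto simp: project_def trace_def)

lemma trace_mono:
  assumes "x \<in> E" "y \<in> E" "x \<sqsubseteq> y" "F \<subseteq> E"
  shows "fst (trace F x) \<subseteq> fst (trace F y)" "snd (trace F y) \<subseteq> snd (trace F x)"
proof -
  have "b \<sqsubseteq> y" if "b \<sqsubseteq> x" "b \<in> F" for b
    using le_trans that assms by blast
  moreover have "b \<sqsubseteq> \<ominus> x" if "b \<sqsubseteq> \<ominus> y" "b \<in> F" for b
    using le_trans[OF that(1) fl_mono[OF assms(3,1,2)]] that assms by auto
  ultimately show "fst (trace F x) \<subseteq> fst (trace F y)" "snd (trace F y) \<subseteq> snd (trace F x)"
    by (auto simp: trace_def)
qed

lemma quotient_inverse_system:
  "finite_inverse_system indices (\<subseteq>) quotient_system project"
  unfolding finite_inverse_system_def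
proof (intro conjI ballI impI)
  show "directed_poset indices (\<subseteq>)"
  proof -
    have "\<exists>H\<in>indices. F \<subseteq> H \<and> G \<subseteq> H" if "F \<in> indices" "G \<in> indices" for F G
      using that by (intro bexI[of _ "F \<union> G"]) (auto simp: indices_def)
    moreover have "{} \<in> indices" by (simp add: indices_def)
    moreover have "poset_on indices (\<subseteq>)"
      unfolding poset_on_def by (auto intro!: reflp_onI antisymp_onI transp_onI)
    ultimately show ?thesis unfolding directed_poset_def by blast
  qed
  fix F assume F: "F \<in> indices"
  show "separation_system (quotient_system F)"
    unfolding separation_system_def poset_on_def
    by (auto intro!: reflp_onI antisymp_onI transp_onI simp: quotient_system_def prod_eq_iff
        trace_flip[symmetric])
  have "trace F ` E \<subseteq> Pow F \<times> Pow F" by (auto simp: trace_def)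
  moreover have "finite (Pow F \<times> Pow F)" using F by (simp add: indices_def)
  ultimately have "finite (trace F ` E)" by (rule finite_subset)
  then show "finite (seps (quotient_system F))" by (simp add: quotient_system_def)
  fix G assume G: "G \<in> indices"
  show "sep_hom (project G F) (quotient_system G) (quotient_system F)" if "F \<subseteq> G"
    using that unfolding sep_hom_def
    by (auto simp: quotient_system_def project_trace) (auto simp: project_def trace_def)
next
  fix F u assume "F \<in> indices" "u \<in> seps (quotient_system F)"
  then show "project F F u = u" by (auto simp: quotient_system_def project_trace)
next
  fix F G H u
  assume "F \<subseteq> G \<and> G \<subseteq> H" "u \<in> seps (quotient_system H)"
  then show "project G F (project H G u) = project H F u"
    by (auto simp: project_def)
qed

section \<open>The isomorphism with the inverse limit\<close>

text \<open>The map to the traces reflects the order by \<open>separation\<close>, hence is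
  injective. Surjectivity is compactness: a compatible family is realised by the limit of an
  ultrafilter.\<close>

lemma profinite: "profinite T"
proof (rule profiniteI[OF sepsys quotient_inverse_system])
  let ?L = "inverse_limit indices (\<subseteq>) quotient_system project"
  define \<phi> where "\<phi> x = (\<lambda>F\<in>indices. trace F x)" for x
  have mem: "\<phi> x \<in> seps ?L" if "x \<in> E" for x
    using that by (auto simp: \<phi>_def inverse_limit_def quotient_system_def project_trace)
  have le: "leq ?L (\<phi> x) (\<phi> y) \<longleftrightarrow> x \<sqsubseteq> y" if xy: "x \<in> E" "y \<in> E" for x y
  proof
    assume "x \<sqsubseteq> y"
    then show "leq ?L (\<phi> x) (\<phi> y)"
      using trace_mono[OF xy] JE
      by (simp add: \<phi>_def inverse_limit_def quotient_system_def indices_def) blast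
  next
    assume L: "leq ?L (\<phi> x) (\<phi> y)"
    have *: "(b \<sqsubseteq> x \<longrightarrow> b \<sqsubseteq> y) \<and> (b \<sqsubseteq> \<ominus> y \<longrightarrow> b \<sqsubseteq> \<ominus> x)" if "b \<in> J" for b
    proof -
      have "{b} \<in> indices" using that by (simp add: indices_def)
      then have "leq (quotient_system {b}) (trace {b} x) (trace {b} y)"
        using L by (auto simp: \<phi>_def inverse_limit_def)
      then show ?thesis by (auto simp: quotient_system_def trace_def)
    qed
    then show "x \<sqsubseteq> y" using separation[OF xy] by blast
  qed
  have flip: "\<phi> (\<ominus> x) = flip ?L (\<phi> x)" if "x \<in> E" for x
    using that by (auto simp: \<phi>_def inverse_limit_def quotient_system_def trace_flip intro!: restrict_ext)
  have inj: "inj_on \<phi> E"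
  proof (rule inj_onI)
    fix x y assume xy: "x \<in> E" "y \<in> E" "\<phi> x = \<phi> y"
    then have "x \<sqsubseteq> y" "y \<sqsubseteq> x" using le le_refl by metis+
    then show "x = y" using le_antisym xy by blast
  qed
  have surj: "t \<in> \<phi> ` E" if t: "t \<in> seps ?L" for t
  proof -
    have tE: "\<exists>x\<in>E. trace F x = t F" if "F \<in> indices" for F
      using t that by (fastforce simp: inverse_limit_def quotient_system_def PiE_def Pi_def)
    have tp: "project G F (t G) = t F" if "F \<in> indices" "G \<in> indices" "F \<subseteq> G" for F G
      using t that by (simp add: inverse_limit_def)
    \<comment> \<open>The separations realising \<open>t\<close> at a single index are non-empty
      sets and, by compatibility, a filter base.\<close>
    define A where "A F = {x \<in> E. trace F x = t F}" for F
    have A_mono: "A G \<subseteq> A F" if "F \<in> indices" "G \<in> indices" "F \<subseteq> G" for F G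
    proof
      fix x assume "x \<in> A G"
      then have x: "x \<in> E" "t G = trace G x" by (simp_all add: A_def)
      then show "x \<in> A F" using tp[OF that] project_trace[OF that(3)] by (simp add: A_def)
    qed
    define W where "W = (INF F\<in>indices. principal (A F))"
    have ne: "indices \<noteq> {}" by (auto simp: indices_def)
    have W: "eventually Q W \<longleftrightarrow> (\<exists>F\<in>indices. \<forall>x\<in>A F. Q x)" for Q
      unfolding W_def
    proof (subst eventually_INF_base[OF ne])
      fix F G assume FG: "F \<in> indices" "G \<in> indices"
      then have "F \<union> G \<in> indices" by (auto simp: indices_def)
      then show "\<exists>H\<in>indices. principal (A H) \<le> inf (principal (A F)) (principal (A G))"
        using A_mono[of F "F \<union> G"] A_mono[of G "F \<union> G"] FG by (intro bexI[of _ "F \<union> G"]) auto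
    qed (simp add: eventually_principal)
    have "W \<noteq> bot" using tE by (auto simp: trivial_limit_def W A_def)
    then obtain G where G: "G \<le> W" "ultra G" by (rule ultra_exists)
    have ev: "eventually (\<lambda>x. x \<in> A F) G" if "F \<in> indices" for F
      by (rule filter_leD[OF G(1)]) (use that in \<open>auto simp: W\<close>)
    have "{} \<in> indices" by (simp add: indices_def)
    from ev[OF this] have evE: "eventually (\<lambda>x. x \<in> E) G"
      by eventually_elim (simp add: A_def)
    obtain z where z: "is_limit G (\<lambda>x. x) z" using ultra_limit[OF G(2) evE] by blast
    have zE: "z \<in> E" using z by (simp add: is_limit_def)
    \<comment> \<open>Eventually \<open>x\<close> has trace \<open>t F\<close>, and members of
      \<open>F\<close> are in \<open>J\<close>, where convergence decides which of them lie below
      \<open>z\<close> or its inverse.\<close>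
    have "trace F z = t F" if F: "F \<in> indices" for F
    proof -
      have "b \<in> fst (t F) \<longleftrightarrow> b \<in> F \<and> b \<sqsubseteq> z" "b \<in> snd (t F) \<longleftrightarrow> b \<in> F \<and> b \<sqsubseteq> \<ominus> z" for b
      proof -
        have tF: "t F = trace F x" if "x \<in> A F" for x using that by (simp add: A_def)
        have evb: "eventually (\<lambda>x. b \<in> fst (t F) \<longleftrightarrow> b \<in> F \<and> b \<sqsubseteq> x) G"
          "eventually (\<lambda>x. b \<in> snd (t F) \<longleftrightarrow> b \<in> F \<and> b \<sqsubseteq> \<ominus> x) G"
          by (rule eventually_mono[OF ev[OF F]], simp add: tF trace_def)+
        show "b \<in> fst (t F) \<longleftrightarrow> b \<in> F \<and> b \<sqsubseteq> z" "b \<in> snd (t F) \<longleftrightarrow> b \<in> F \<and> b \<sqsubseteq> \<ominus> z"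
        proof (atomize (full), cases "b \<in> F")
          case False
          then show "(b \<in> fst (t F) \<longleftrightarrow> b \<in> F \<and> b \<sqsubseteq> z) \<and> (b \<in> snd (t F) \<longleftrightarrow> b \<in> F \<and> b \<sqsubseteq> \<ominus> z)"
            using ultra_ex[OF G(2) evb(1)] ultra_ex[OF G(2) evb(2)] by auto
        next
          case True
          have bJ: "b \<in> J" using True F by (auto simp: indices_def)
          note const = ultra_const[OF G(2)]
          have "b \<in> fst (t F) \<longleftrightarrow> eventually (\<lambda>x. b \<sqsubseteq> x) G"
            using eventually_cong[OF evb(1), of "\<lambda>x. b \<in> fst (t F)" "\<lambda>x. b \<sqsubseteq> x"] True const by simp
          moreover have "b \<in> snd (t F) \<longleftrightarrow> eventually (\<lambda>x. b \<sqsubseteq> \<ominus> x) G"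
            using eventually_cong[OF evb(2), of "\<lambda>x. b \<in> snd (t F)" "\<lambda>x. b \<sqsubseteq> \<ominus> x"] True const by simp
          ultimately show "(b \<in> fst (t F) \<longleftrightarrow> b \<in> F \<and> b \<sqsubseteq> z) \<and> (b \<in> snd (t F) \<longleftrightarrow> b \<in> F \<and> b \<sqsubseteq> \<ominus> z)"
            using z bJ JE[OF bJ] True by (auto simp: is_limit_def below_def)
        qed
      qed
      then show ?thesis by (auto simp: trace_def prod_eq_iff)
    qed
    moreover have "t \<in> extensional indices" using t by (auto simp: inverse_limit_def PiE_def)
    ultimately have "t = \<phi> z"
      unfolding \<phi>_def by (auto intro!: extensionalityI[of t indices])
    then show ?thesis using zE by blast
  qed
  have bij: "bij_betw \<phi> E (seps ?L)"
    using inj surj mem by (auto simp: bij_betw_def)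
  have "sep_hom \<phi> T ?L"
    unfolding sep_hom_def using mem flip le by auto
  moreover have "sep_hom (inv_into E \<phi>) ?L T"
  proof -
    have im: "seps ?L = \<phi> ` E" using bij by (simp add: bij_betw_def)
    show ?thesis
      unfolding sep_hom_def im using inj le by (auto simp: flip[symmetric])
  qed
  ultimately show "sep_iso \<phi> T ?L" using bij unfolding sep_iso_def by blast
qed

end

theorem theorem3p33:
  fixes T :: "'a sep_sys"
  assumes "tree_set T"
  shows "profinite T \<longleftrightarrow>
    chain_complete T \<and> splittable T \<and>
    \<not> (\<exists>\<sigma>. splitting_star T \<sigma> \<and> regular T \<sigma> \<and> infinite \<sigma>) \<and>
    (\<forall>s\<in>unoriented T. \<forall>s'\<in>unoriented T.
       regular T s \<and> regular T s' \<longrightarrow> finite (branching_between T s s'))"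
proof
  assume "profinite T"
  then show "chain_complete T \<and> splittable T \<and>
    \<not> (\<exists>\<sigma>. splitting_star T \<sigma> \<and> regular T \<sigma> \<and> infinite \<sigma>) \<and>
    (\<forall>s\<in>unoriented T. \<forall>s'\<in>unoriented T.
       regular T s \<and> regular T s' \<longrightarrow> finite (branching_between T s s'))"
    using profinite_necessary assms by blast
next
  assume *: "chain_complete T \<and> splittable T \<and>
    \<not> (\<exists>\<sigma>. splitting_star T \<sigma> \<and> regular T \<sigma> \<and> infinite \<sigma>) \<and>
    (\<forall>s\<in>unoriented T. \<forall>s'\<in>unoriented T.
       regular T s \<and> regular T s' \<longrightarrow> finite (branching_between T s s'))"
  interpret splittable_tree T
  proof
    show "\<exists>s\<in>\<sigma>. leq T s (flip T s)" if "splitting_star T \<sigma>" "infinite \<sigma>" for \<sigma>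
      using * that unfolding regular_def small_def by blast
  qed (use assms * in auto)
  show "profinite T" by (rule profinite)
qed

end
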